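(* Let $\mathbb{G}$ denote the canonical neutral Kähler metric on $TS^2$ (respectively on $TH^2$). The identity component of the isometry group of $(TS^2,\mathbb{G})$ is isomorphic to the identity component of the isometry group of Euclidean 3-space $\mathbb{E}^3$; respectively, the identity component of the isometry group of $(TH^2,\mathbb{G})$ is isomorphic to the identity component of the (affine) isometry group of Lorentzian 3-space $\mathbb{E}^3_1$.
   Context: $\mathbb{E}^3_1$ is $\mathbb{R}^3$ with the flat metric $(dx^1)^2+(dx^2)^2-(dx^3)^2$. $S^2$ is the 2-sphere with the round metric of Gauss curvature $1$ and $H^2$ is the hyperbolic plane with the metric of Gauss curvature $-1$. In a complex coordinate $\xi$ these metrics are $g=e^{2u}d\xi d\bar\xi$ with $e^{2u}=4(1\pm\xi\bar\xi)^{-2}$, upper sign for $S^2$, lower sign (with $|\xi|<1$) for $H^2$. Canonical neutral Kähler structure on $TN$: for a Riemannian 2-manifold $(N,g,j)$ ($j$ the complex structure of the oriented Riemannian surface), the Levi-Civita connection splits $TTN\cong TN\oplus TN$ and $\mathbb{J}=j\oplus j$; $\Omega$ is the pull-back to $TN$, by $g$ regarded as a map $TN\to T^*N$, of the canonical symplectic form of $T^*N$; and $\mathbb{G}(\cdot,\cdot)=\Omega(\mathbb{J}\cdot,\cdot)$. If $\xi$ is a conformal coordinate with $g=e^{2u}d\xi d\bar\xi$ and $(\xi,\eta)$ denotes the tangent vector $\eta\,\partial/\partial\xi+\bar\eta\,\partial/\partial\bar\xi\in T_\xi N$, then $$\Omega=2\,\mathrm{Re}\left(e^{2u}d\eta\wedge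 d\bar\xi+\eta\,\partial(e^{2u})d\xi\wedge d\bar\xi\right),\qquad \mathbb{G}=2\,\mathrm{Im}\left(e^{2u}d\bar\eta\, d\xi-\eta\,\partial(e^{2u})d\xi\, d\bar\xi\right),$$ where $\partial=\partial/\partial\xi$. $\mathbb{G}$ has signature $(++--)$. *)

theory Defs
  imports "HOL-Analysis.Analysis" "HOL-Algebra.Bij"
begin

section \<open>Smooth maps and isometries of embedded pseudo-Riemannian manifolds\<close>

text \<open>For open \<open>U\<close> this is the usual class \<open>C\<^sup>k\<close>; the second clause iterates over all directional
  derivatives, which is adequate because the domain is finite-dimensional.\<close>

primrec Ck_on :: "nat \<Rightarrow> 'a::euclidean_space set \<Rightarrow> ('a \<Rightarrow> 'b::real_normed_vector) \<Rightarrow> bool" where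
  "Ck_on 0 U f \<longleftrightarrow> continuous_on U f"
| "Ck_on (Suc k) U f \<longleftrightarrow>
     f differentiable_on U \<and> (\<forall>v. Ck_on k U (\<lambda>x. frechet_derivative f (at x) v))"

text \<open>A map defined on an embedded submanifold \<open>S\<close> is smooth iff it extends locally to smooth maps
  on open sets of the ambient space.\<close>

definition smooth_on :: "'a::euclidean_space set \<Rightarrow> ('a \<Rightarrow> 'b::euclidean_space) \<Rightarrow> bool" where
  "smooth_on S f \<longleftrightarrow>
     (\<forall>x\<in>S. \<exists>U F. open U \<and> x \<in> U \<and> (\<forall>k. Ck_on k U F) \<and> (\<forall>y\<in>S \<inter> U. F y = f y))"

text \<open>An embedded submanifold \<open>points\<close> of a Euclidean space, its tangent spaces as linear subspaces of
  the ambient space, and a field of bilinear forms on them; values of \<open>metric\<close> on vectors that are not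
  tangent are irrelevant.\<close>

record 'a pseudo_riemannian =
  points :: "'a set"
  tangent_space :: "'a \<Rightarrow> 'a set"
  metric :: "'a \<Rightarrow> 'a \<Rightarrow> 'a \<Rightarrow> real"

text \<open>A derivative within \<open>points M\<close> is uniquely determined on tangent vectors, where it is the
  differential of \<open>f\<close>.\<close>

definition preserves_metric :: "'a::euclidean_space pseudo_riemannian \<Rightarrow> ('a \<Rightarrow> 'a) \<Rightarrow> bool" where
  "preserves_metric M f \<longleftrightarrow>
     (\<forall>x\<in>points M. \<exists>D. (f has_derivative D) (at x within points M) \<and>
        (\<forall>X\<in>tangent_space M x. \<forall>Y\<in>tangent_space M x.
           metric M (f x) (D X) (D Y) = metric M x X Y))"

definition isometry_group :: "'a::euclidean_space pseudo_riemannian \<Rightarrow> ('a \<Rightarrow> 'a) monoid" where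
  "isometry_group M = BijGroup (points M)
     \<lparr>carrier := {f \<in> Bij (points M). smooth_on (points M) f \<and>
                   smooth_on (points M) (inv_into (points M) f) \<and> preserves_metric M f}\<rparr>"

text \<open>The Lie group topology of the isometry group of a pseudo-Riemannian manifold is the
  compact-open topology.\<close>

definition compact_open_topology ::
    "'a::topological_space set \<Rightarrow> ('a \<Rightarrow> 'a) set \<Rightarrow> ('a \<Rightarrow> 'a) topology" where
  "compact_open_topology S F =
     topology_generated_by {{f \<in> F. f ` K \<subseteq> U} |K U. compact K \<and> K \<subseteq> S \<and> open U}"

definition Isom0 :: "'a::euclidean_space pseudo_riemannian \<Rightarrow> ('a \<Rightarrow> 'a) monoid" where
  "Isom0 M = isometry_group M
     \<lparr>carrier := connected_component_of_set
        (compact_open_topology (points M) (carrier (isometry_group M))) \<one>\<^bsub>isometry_group M\<^esub>\<rparr>"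

definition Isom0_topology :: "'a::euclidean_space pseudo_riemannian \<Rightarrow> ('a \<Rightarrow> 'a) topology" where
  "Isom0_topology M = compact_open_topology (points M) (carrier (Isom0 M))"

text \<open>For Lie groups, isomorphism as topological groups is the same as isomorphism as Lie groups,
  since continuous homomorphisms are smooth.\<close>

definition isomorphic_topological_groups ::
    "'a monoid \<Rightarrow> 'a topology \<Rightarrow> 'b monoid \<Rightarrow> 'b topology \<Rightarrow> bool" where
  "isomorphic_topological_groups G X H Y \<longleftrightarrow> (\<exists>h\<in>iso G H. homeomorphic_map X Y h)"


section \<open>Euclidean and Lorentzian 3-space\<close>

text \<open>The parameter \<open>\<epsilon>\<close> is \<open>1\<close> in the Euclidean and \<open>-1\<close> in the Lorentzian case.\<close>

definition form :: "real \<Rightarrow> real^3 \<Rightarrow> real^3 \<Rightarrow> real" where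
  "form \<epsilon> x y = x$1 * y$1 + x$2 * y$2 + \<epsilon> * (x$3 * y$3)"

definition flat_space :: "real \<Rightarrow> (real^3) pseudo_riemannian" where
  "flat_space \<epsilon> = \<lparr>points = UNIV, tangent_space = (\<lambda>_. UNIV), metric = (\<lambda>_. form \<epsilon>)\<rparr>"

definition E3 :: "(real^3) pseudo_riemannian" where
  "E3 = flat_space 1"

definition E31 :: "(real^3) pseudo_riemannian" where
  "E31 = flat_space (-1)"


section \<open>The neutral Kaehler metric on the tangent bundle of the sphere and the hyperbolic plane\<close>

text \<open>The unit sphere in Euclidean space, and the upper sheet of the hyperboloid in Lorentzian space,
  with the Riemannian metric induced by \<open>form \<epsilon>\<close>. The position vector \<open>p\<close> is a unit normal at
  \<open>p\<close>, with \<open>form \<epsilon> p p = \<epsilon>\<close>.\<close>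

definition surface :: "real \<Rightarrow> (real^3) set" where
  "surface \<epsilon> = {p. form \<epsilon> p p = \<epsilon> \<and> (\<epsilon> < 0 \<longrightarrow> p$3 > 0)}"

definition tangent_bundle :: "real \<Rightarrow> ((real^3) \<times> (real^3)) set" where
  "tangent_bundle \<epsilon> = {(p, v). p \<in> surface \<epsilon> \<and> form \<epsilon> p v = 0}"

text \<open>Tangent spaces of the total space: the kernel of the derivative of the defining equations
  \<open>form \<epsilon> p p = \<epsilon>\<close>, \<open>form \<epsilon> p v = 0\<close>.\<close>

definition tangent_bundle_tangent :: "real \<Rightarrow> (real^3) \<times> (real^3) \<Rightarrow> ((real^3) \<times> (real^3)) set" where
  "tangent_bundle_tangent \<epsilon> = (\<lambda>(p, v). {(a, b). form \<epsilon> p a = 0 \<and> form \<epsilon> a v + form \<epsilon> p b = 0})"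

text \<open>Rotation by a right angle in the tangent plane at \<open>p\<close>: the Euclidean, respectively Lorentzian,
  cross product with the unit normal \<open>p\<close>.\<close>

definition complex_structure :: "real \<Rightarrow> real^3 \<Rightarrow> real^3 \<Rightarrow> real^3" where
  "complex_structure \<epsilon> p a = (let c = cross3 p a in vector [c$1, c$2, \<epsilon> * c$3])"

text \<open>The Levi-Civita connection of the surface is the tangential part of the flat connection. So a
  curve \<open>(p(t), v(t))\<close> in the tangent bundle with velocity \<open>(a, b)\<close> has horizontal part \<open>a\<close>, the
  velocity of \<open>p\<close>, and vertical part the tangential projection of \<open>b\<close>, the covariant derivative
  of \<open>v\<close> along \<open>p\<close>.\<close>

definition horizontal :: "(real^3) \<times> (real^3) \<Rightarrow> real^3" where
  "horizontal X = fst X"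

definition vertical :: "real \<Rightarrow> (real^3) \<times> (real^3) \<Rightarrow> (real^3) \<times> (real^3) \<Rightarrow> real^3" where
  "vertical \<epsilon> z X = snd X - (\<epsilon> * form \<epsilon> (fst z) (snd X)) *\<^sub>R fst z"

text \<open>The tangent vector with prescribed horizontal and vertical parts.\<close>

definition from_parts :: "real \<Rightarrow> (real^3) \<times> (real^3) \<Rightarrow> real^3 \<Rightarrow> real^3 \<Rightarrow> (real^3) \<times> (real^3)" where
  "from_parts \<epsilon> z h k = (h, k - (\<epsilon> * form \<epsilon> h (snd z)) *\<^sub>R fst z)"

definition bundle_J :: "real \<Rightarrow> (real^3) \<times> (real^3) \<Rightarrow> (real^3) \<times> (real^3) \<Rightarrow> (real^3) \<times> (real^3)" where
  "bundle_J \<epsilon> z X = from_parts \<epsilon> z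
     (complex_structure \<epsilon> (fst z) (horizontal X))
     (complex_structure \<epsilon> (fst z) (vertical \<epsilon> z X))"

text \<open>The canonical 1-form of the cotangent bundle, pulled back by the metric of the surface. The same
  formula defines a 1-form on the ambient space, so that its exterior derivative can be computed
  there and then restricted.\<close>

definition canonical_1form :: "real \<Rightarrow> (real^3) \<times> (real^3) \<Rightarrow> (real^3) \<times> (real^3) \<Rightarrow> real" where
  "canonical_1form \<epsilon> z X = form \<epsilon> (snd z) (horizontal X)"

definition exterior_derivative ::
    "('a::real_normed_vector \<Rightarrow> 'a \<Rightarrow> real) \<Rightarrow> 'a \<Rightarrow> 'a \<Rightarrow> 'a \<Rightarrow> real" where
  "exterior_derivative \<theta> z X Y =
     frechet_derivative (\<lambda>w. \<theta> w Y) (at z) X - frechet_derivative (\<lambda>w. \<theta> w X) (at z) Y"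

definition bundle_Omega ::
    "real \<Rightarrow> (real^3) \<times> (real^3) \<Rightarrow> (real^3) \<times> (real^3) \<Rightarrow> (real^3) \<times> (real^3) \<Rightarrow> real" where
  "bundle_Omega \<epsilon> = exterior_derivative (canonical_1form \<epsilon>)"

definition neutral_metric ::
    "real \<Rightarrow> (real^3) \<times> (real^3) \<Rightarrow> (real^3) \<times> (real^3) \<Rightarrow> (real^3) \<times> (real^3) \<Rightarrow> real" where
  "neutral_metric \<epsilon> z X Y = bundle_Omega \<epsilon> z (bundle_J \<epsilon> z X) Y"

definition neutral_tangent_bundle :: "real \<Rightarrow> ((real^3) \<times> (real^3)) pseudo_riemannian" where
  "neutral_tangent_bundle \<epsilon> =
     \<lparr>points = tangent_bundle \<epsilon>, tangent_space = tangent_bundle_tangent \<epsilon>, metric = neutral_metric \<epsilon>\<rparr>"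

definition TS2 :: "((real^3) \<times> (real^3)) pseudo_riemannian" where
  "TS2 = neutral_tangent_bundle 1"

definition TH2 :: "((real^3) \<times> (real^3)) pseudo_riemannian" where
  "TH2 = neutral_tangent_bundle (-1)"


section \<open>Agreement with the expressions in a conformal coordinate\<close>

lemma surface_1: "surface 1 = sphere 0 1"
  by (auto simp: surface_def form_def sphere_def norm_eq_sqrt_inner inner_vec_def sum_3)

lemma bundle_Omega_eq:
  "bundle_Omega \<epsilon> z X Y = form \<epsilon> (snd X) (fst Y) - form \<epsilon> (snd Y) (fst X)"
proof -
  have "bounded_linear (\<lambda>w. canonical_1form \<epsilon> w Y)" for Y
    unfolding canonical_1form_def horizontal_def form_def linear_conv_bounded_linear[symmetric]
    by (rule linearI) (auto simp: algebra_simps)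
  then have "frechet_derivative (\<lambda>w. canonical_1form \<epsilon> w Y) (at z) = (\<lambda>w. canonical_1form \<epsilon> w Y)"
    for Y
    by (metis bounded_linear_imp_has_derivative frechet_derivative_at)
  then show ?thesis
    by (simp add: bundle_Omega_def exterior_derivative_def canonical_1form_def horizontal_def)
qed

lemma form_complex_structure:
  assumes "\<epsilon>\<^sup>2 = 1"
  shows "form \<epsilon> (complex_structure \<epsilon> p a) b = inner (cross3 p a) b"
proof -
  have "\<epsilon> * (\<epsilon> * c * d) = c * d" for c d
    using assms by (metis mult.assoc mult_1 power2_eq_square)
  then show ?thesis
    by (simp add: form_def complex_structure_def Let_def inner_vec_def sum_3)
qed

lemma form_commute: "form \<epsilon> x y = form \<epsilon> y x"
  by (simp add: form_def mult.commute)

lemma form_diff_scaleR: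
  "form \<epsilon> (x - c *\<^sub>R p) y = form \<epsilon> x y - c * form \<epsilon> p y"
  "form \<epsilon> y (x - c *\<^sub>R p) = form \<epsilon> y x - c * form \<epsilon> y p"
  by (simp_all add: form_def algebra_simps)

lemma form_complex_structure_self:
  assumes "\<epsilon>\<^sup>2 = 1"
  shows "form \<epsilon> p (complex_structure \<epsilon> p a) = 0"
  using form_complex_structure[OF assms, of p a p]
  by (simp add: form_commute dot_cross_self)

lemma bundle_J_parts:
  assumes "\<epsilon>\<^sup>2 = 1" "z \<in> tangent_bundle \<epsilon>"
  shows "bundle_J \<epsilon> z X \<in> tangent_bundle_tangent \<epsilon> z"
    and "horizontal (bundle_J \<epsilon> z X) = complex_structure \<epsilon> (fst z) (horizontal X)"
    and "vertical \<epsilon> z (bundle_J \<epsilon> z X) = complex_structure \<epsilon> (fst z) (vertical \<epsilon> z X)"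
proof -
  have pp: "form \<epsilon> (fst z) (fst z) = \<epsilon>"
    using assms(2) by (auto simp: tangent_bundle_def surface_def)
  have ee: "\<epsilon> * \<epsilon> = 1" using assms(1) by (simp add: power2_eq_square)
  show "bundle_J \<epsilon> z X \<in> tangent_bundle_tangent \<epsilon> z"
    using pp ee form_complex_structure_self[OF assms(1)]
    by (cases z) (simp add: tangent_bundle_tangent_def bundle_J_def from_parts_def form_diff_scaleR
        form_commute mult.commute mult.left_commute)
  show "horizontal (bundle_J \<epsilon> z X) = complex_structure \<epsilon> (fst z) (horizontal X)"
    by (simp add: bundle_J_def from_parts_def horizontal_def)
  have *: "\<epsilon> * (\<epsilon> * (\<epsilon> * x)) = \<epsilon> * x" for x
    using ee by (simp add: mult.assoc[symmetric])
  show "vertical \<epsilon> z (bundle_J \<epsilon> z X) = complex_structure \<epsilon> (fst z) (vertical \<epsilon> z X)"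
    using pp ee form_complex_structure_self[OF assms(1)] *
    by (simp add: vertical_def bundle_J_def from_parts_def form_diff_scaleR mult.commute mult.left_commute)
qed

lemma neutral_metric_eq:
  assumes "\<epsilon>\<^sup>2 = 1" "Y \<in> tangent_bundle_tangent \<epsilon> z"
  shows "neutral_metric \<epsilon> z X Y =
    inner (fst z) (cross3 (snd X) (fst Y)) + inner (fst z) (cross3 (snd Y) (fst X))"
proof -
  have "form \<epsilon> (fst z) (fst Y) = 0"
    using assms(2) by (auto simp: tangent_bundle_tangent_def split: prod.splits)
  then have "neutral_metric \<epsilon> z X Y =
      inner (cross3 (fst z) (vertical \<epsilon> z X)) (fst Y) - inner (cross3 (fst z) (fst X)) (snd Y)"
    by (simp add: neutral_metric_def bundle_Omega_eq bundle_J_def from_parts_def horizontal_def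
        form_diff_scaleR form_complex_structure[OF assms(1)] form_commute[of _ "snd Y"]
        form_complex_structure[OF assms(1), simplified form_commute])
  also have "\<dots> = inner (fst z) (cross3 (snd X) (fst Y)) + inner (fst z) (cross3 (snd Y) (fst X))"
    by (simp add: vertical_def cross3_simps)
  finally show ?thesis .
qed

text \<open>The coordinate \<open>\<xi> = (x\<^sub>1 + i x\<^sub>2) / (1 + x\<^sub>3)\<close> on the surface (stereographic projection,
  respectively the Poincare disc), and the induced coordinates \<open>(\<xi>, \<eta>)\<close> on its tangent bundle.\<close>

definition stereo :: "real \<Rightarrow> complex \<Rightarrow> real^3" where
  "stereo \<epsilon> \<xi> = (1 / (1 + \<epsilon> * (cmod \<xi>)\<^sup>2)) *\<^sub>R vector [2 * Re \<xi>, 2 * Im \<xi>, 1 - \<epsilon> * (cmod \<xi>)\<^sup>2]"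

definition stereo_bundle :: "real \<Rightarrow> complex \<times> complex \<Rightarrow> (real^3) \<times> (real^3)" where
  "stereo_bundle \<epsilon> = (\<lambda>(\<xi>, \<eta>). (stereo \<epsilon> \<xi>, frechet_derivative (stereo \<epsilon>) (at \<xi>) \<eta>))"

definition stereo_deriv :: "real \<Rightarrow> complex \<Rightarrow> complex \<Rightarrow> real^3" where
  "stereo_deriv \<epsilon> \<xi> \<eta> = (1 / (1 + \<epsilon> * (cmod \<xi>)\<^sup>2)\<^sup>2) *\<^sub>R
    vector [2 * Re \<eta> * (1 + \<epsilon> * (cmod \<xi>)\<^sup>2) - 4 * \<epsilon> * Re (cnj \<xi> * \<eta>) * Re \<xi>,
            2 * Im \<eta> * (1 + \<epsilon> * (cmod \<xi>)\<^sup>2) - 4 * \<epsilon> * Re (cnj \<xi> * \<eta>) * Im \<xi>,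
            - 4 * \<epsilon> * Re (cnj \<xi> * \<eta>)]"

lemma has_derivative_vector3:
  fixes f g h :: "'a::real_normed_vector \<Rightarrow> real"
  assumes "(f has_derivative f') F" "(g has_derivative g') F" "(h has_derivative h') F"
  shows "((\<lambda>x. vector [f x, g x, h x] :: real^3) has_derivative (\<lambda>x. vector [f' x, g' x, h' x])) F"
proof -
  have eq: "(vector [a, b, c] :: real^3) = a *\<^sub>R axis 1 1 + b *\<^sub>R axis 2 1 + c *\<^sub>R axis 3 1" for a b c
    by (simp add: vec_eq_iff forall_3 axis_def)
  show ?thesis
    unfolding eq by (intro has_derivative_add has_derivative_scaleR_left assms)
qed

lemma stereo_has_derivative:
  assumes "1 + \<epsilon> * (cmod \<xi>)\<^sup>2 \<noteq> 0"
  shows "(stereo \<epsilon> has_derivative stereo_deriv \<epsilon> \<xi>) (at \<xi>)"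
proof -
  have 1: "stereo \<epsilon> = (\<lambda>\<xi>. vector [2 * Re \<xi> / (1 + \<epsilon> * ((Re \<xi>)\<^sup>2 + (Im \<xi>)\<^sup>2)),
      2 * Im \<xi> / (1 + \<epsilon> * ((Re \<xi>)\<^sup>2 + (Im \<xi>)\<^sup>2)), (1 - \<epsilon> * ((Re \<xi>)\<^sup>2 + (Im \<xi>)\<^sup>2)) / (1 + \<epsilon> * ((Re \<xi>)\<^sup>2 + (Im \<xi>)\<^sup>2))])"
    by (auto simp: stereo_def vec_eq_iff forall_3 cmod_power2)
  have nz: "1 + \<epsilon> * ((Re \<xi>)\<^sup>2 + (Im \<xi>)\<^sup>2) \<noteq> 0" using assms by (simp add: cmod_power2)
  let ?m = "1 + \<epsilon> * ((Re \<xi>)\<^sup>2 + (Im \<xi>)\<^sup>2)"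
  define dm where "dm = (\<lambda>h. 2 * \<epsilon> * (Re \<xi> * Re h + Im \<xi> * Im h))"
  have m: "((\<lambda>\<xi>. 1 + \<epsilon> * ((Re \<xi>)\<^sup>2 + (Im \<xi>)\<^sup>2)) has_derivative dm) (at \<xi>)"
    unfolding dm_def by (auto intro!: derivative_eq_intros simp: fun_eq_iff algebra_simps)
  have n: "((\<lambda>\<xi>. 1 - \<epsilon> * ((Re \<xi>)\<^sup>2 + (Im \<xi>)\<^sup>2)) has_derivative (\<lambda>h. - dm h)) (at \<xi>)"
    unfolding dm_def by (auto intro!: derivative_eq_intros simp: fun_eq_iff algebra_simps)
  have r: "((\<lambda>\<xi>. 2 * Re \<xi>) has_derivative (\<lambda>h. 2 * Re h)) (at \<xi>)"
     "((\<lambda>\<xi>. 2 * Im \<xi>) has_derivative (\<lambda>h. 2 * Im h)) (at \<xi>)"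
    by (auto intro!: derivative_eq_intros)
  have q: "stereo_deriv \<epsilon> \<xi> = (\<lambda>h. vector [(2 * Re h * ?m - 2 * Re \<xi> * dm h) / (?m * ?m),
      (2 * Im h * ?m - 2 * Im \<xi> * dm h) / (?m * ?m), ((- dm h) * ?m - (1 - \<epsilon> * ((Re \<xi>)\<^sup>2 + (Im \<xi>)\<^sup>2)) * dm h) / (?m * ?m)])"
  proof (rule ext)
    fix h
    define m where "m = ?m"
    have r: "1 - \<epsilon> * ((Re \<xi>)\<^sup>2 + (Im \<xi>)\<^sup>2) = 2 - m" by (simp add: m_def)
    have 3: "- dm h * m - (2 - m) * dm h = - 2 * dm h" by (simp add: algebra_simps)
    have "dm h = 2 * \<epsilon> * Re (cnj \<xi> * h)" by (simp add: dm_def)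
    then show "stereo_deriv \<epsilon> \<xi> h = vector [(2 * Re h * ?m - 2 * Re \<xi> * dm h) / (?m * ?m),
      (2 * Im h * ?m - 2 * Im \<xi> * dm h) / (?m * ?m), ((- dm h) * ?m - (1 - \<epsilon> * ((Re \<xi>)\<^sup>2 + (Im \<xi>)\<^sup>2)) * dm h) / (?m * ?m)]"
      unfolding stereo_deriv_def cmod_power2 r m_def[symmetric] 3
      by (simp add: vec_eq_iff forall_3 power2_eq_square)
  qed
  show ?thesis
    unfolding 1 q by (intro has_derivative_vector3 has_derivative_divide' m n r nz)
qed

lemma form_scaleR: "form \<epsilon> (c *\<^sub>R x) (d *\<^sub>R y) = c * d * form \<epsilon> x y"
  by (simp add: form_def algebra_simps)

lemma bounded_bilinear_form: "bounded_bilinear (form \<epsilon>)"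
proof -
  have "bilinear (form \<epsilon>)"
    unfolding bilinear_def form_def by (auto intro!: linearI simp: algebra_simps)
  then show ?thesis by (simp add: bilinear_conv_bounded_bilinear)
qed

lemma form_vector: "form \<epsilon> (vector [a, b, c]) (vector [d, e, f]) = a * d + b * e + \<epsilon> * (c * f)"
  by (simp add: form_def)

lemma triple_scaleR:
  "inner (c *\<^sub>R x) (cross3 (d *\<^sub>R y) (e *\<^sub>R z)) = c * d * e * inner x (cross3 y z)"
  by (simp add: cross_mult_left cross_mult_right)

lemma triple_vector:
  "inner (vector [a1, a2, a3]) (cross3 (vector [b1, b2, b3]) (vector [c1, c2, c3])) =
    a1 * (b2 * c3 - b3 * c2) + a2 * (b3 * c1 - b1 * c3) + a3 * (b1 * c2 - b2 * c1)"
  by (simp add: cross3_def inner_vec_def sum_3)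

lemma stereo_in_surface:
  assumes "\<epsilon> = 1 \<or> \<epsilon> = -1" "1 + \<epsilon> * (cmod \<xi>)\<^sup>2 > 0"
  shows "stereo \<epsilon> \<xi> \<in> surface \<epsilon>"
proof -
  define m where "m = 1 + \<epsilon> * ((Re \<xi>)\<^sup>2 + (Im \<xi>)\<^sup>2)"
  have m: "m > 0" using assms(2) by (simp add: m_def cmod_power2)
  have ee: "\<epsilon> * \<epsilon> = 1" using assms(1) by auto
  have v: "stereo \<epsilon> \<xi> = (1 / m) *\<^sub>R vector [2 * Re \<xi>, 2 * Im \<xi>, 2 - m]"
    by (simp add: stereo_def m_def cmod_power2)
  have "form \<epsilon> (stereo \<epsilon> \<xi>) (stereo \<epsilon> \<xi>) = (4 * ((Re \<xi>)\<^sup>2 + (Im \<xi>)\<^sup>2) + \<epsilon> * (2 - m)\<^sup>2) / m\<^sup>2"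
    unfolding v form_scaleR form_vector using m by (simp add: field_simps power2_eq_square)
  also have "4 * ((Re \<xi>)\<^sup>2 + (Im \<xi>)\<^sup>2) + \<epsilon> * (2 - m)\<^sup>2 = \<epsilon> * m\<^sup>2"
  proof -
    have "\<epsilon> * m = \<epsilon> + (\<epsilon> * \<epsilon>) * ((Re \<xi>)\<^sup>2 + (Im \<xi>)\<^sup>2)"
      unfolding m_def by (simp add: algebra_simps)
    then show ?thesis unfolding ee by (simp add: algebra_simps power2_eq_square)
  qed
  finally have 1: "form \<epsilon> (stereo \<epsilon> \<xi>) (stereo \<epsilon> \<xi>) = \<epsilon>" using m by simp
  have "stereo \<epsilon> \<xi> $ 3 > 0" if "\<epsilon> < 0"
  proof -
    have "m \<le> 1" using that by (simp add: m_def mult_nonpos_nonneg)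
    then show ?thesis using m by (simp add: v)
  qed
  then show ?thesis using 1 by (simp add: surface_def)
qed

lemma stereo_bundle_eq:
  assumes "1 + \<epsilon> * (cmod \<xi>)\<^sup>2 \<noteq> 0"
  shows "stereo_bundle \<epsilon> (\<xi>, \<eta>) = (stereo \<epsilon> \<xi>, stereo_deriv \<epsilon> \<xi> \<eta>)"
  using frechet_derivative_at[OF stereo_has_derivative[OF assms]] by (simp add: stereo_bundle_def)

lemma form_stereo_stereo_deriv:
  assumes "\<epsilon>\<^sup>2 = 1" "1 + \<epsilon> * (cmod \<xi>)\<^sup>2 \<noteq> 0"
  shows "form \<epsilon> (stereo \<epsilon> \<xi>) (stereo_deriv \<epsilon> \<xi> \<eta>) = 0"
proof -
  define m where "m = 1 + \<epsilon> * ((Re \<xi>)\<^sup>2 + (Im \<xi>)\<^sup>2)"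
  define s where "s = Re \<xi> * Re \<eta> + Im \<xi> * Im \<eta>"
  have v: "stereo \<epsilon> \<xi> = (1 / m) *\<^sub>R vector [2 * Re \<xi>, 2 * Im \<xi>, 2 - m]"
    by (simp add: stereo_def m_def cmod_power2)
  have d: "stereo_deriv \<epsilon> \<xi> \<eta> = (1 / m\<^sup>2) *\<^sub>R vector [2 * Re \<eta> * m - 4 * \<epsilon> * s * Re \<xi>,
      2 * Im \<eta> * m - 4 * \<epsilon> * s * Im \<xi>, - 4 * \<epsilon> * s]"
    by (simp add: stereo_deriv_def m_def s_def cmod_power2)
  have "form \<epsilon> (stereo \<epsilon> \<xi>) (stereo_deriv \<epsilon> \<xi> \<eta>) = (2 * Re \<xi> * (2 * Re \<eta> * m - 4 * \<epsilon> * s * Re \<xi>)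
     + 2 * Im \<xi> * (2 * Im \<eta> * m - 4 * \<epsilon> * s * Im \<xi>) + \<epsilon> * ((2 - m) * (- 4 * \<epsilon> * s))) / m ^ 3"
    unfolding v d form_scaleR form_vector by (simp add: power2_eq_square power3_eq_cube)
  also have "2 * Re \<xi> * (2 * Re \<eta> * m - 4 * \<epsilon> * s * Re \<xi>)
     + 2 * Im \<xi> * (2 * Im \<eta> * m - 4 * \<epsilon> * s * Im \<xi>) + \<epsilon> * ((2 - m) * (- 4 * \<epsilon> * s))
     = 4 * m * (Re \<xi> * Re \<eta> + Im \<xi> * Im \<eta>) - 8 * s * (\<epsilon> * ((Re \<xi>)\<^sup>2 + (Im \<xi>)\<^sup>2)) - 4 * \<epsilon>\<^sup>2 * s * (2 - m)"
    by (simp add: algebra_simps power2_eq_square)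
  also have "\<epsilon> * ((Re \<xi>)\<^sup>2 + (Im \<xi>)\<^sup>2) = m - 1"
    by (simp add: m_def)
  also have "4 * m * (Re \<xi> * Re \<eta> + Im \<xi> * Im \<eta>) - 8 * s * (m - 1) - 4 * \<epsilon>\<^sup>2 * s * (2 - m) = 0"
    unfolding assms(1) s_def[symmetric] by (simp add: algebra_simps)
  finally show ?thesis by simp
qed

lemma stereo_bundle_in_tangent_bundle:
  assumes "\<epsilon> = 1 \<or> \<epsilon> = -1" "1 + \<epsilon> * (cmod \<xi>)\<^sup>2 > 0"
  shows "stereo_bundle \<epsilon> (\<xi>, \<eta>) \<in> tangent_bundle \<epsilon>"
proof -
  have "\<epsilon>\<^sup>2 = 1" "1 + \<epsilon> * (cmod \<xi>)\<^sup>2 \<noteq> 0" using assms by auto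
  then show ?thesis
    using stereo_in_surface[OF assms] form_stereo_stereo_deriv
    by (simp add: stereo_bundle_eq tangent_bundle_def)
qed

text \<open>The coordinate is conformal, with conformal factor \<open>4 (1 + \<epsilon> \<xi> \<xi>\<^sup>*)\<^sup>-\<^sup>2\<close>.\<close>

lemma form_stereo_deriv:
  assumes "\<epsilon>\<^sup>2 = 1" "1 + \<epsilon> * (cmod \<xi>)\<^sup>2 \<noteq> 0"
  shows "form \<epsilon> (stereo_deriv \<epsilon> \<xi> \<eta>) (stereo_deriv \<epsilon> \<xi> \<eta>)
    = 4 / (1 + \<epsilon> * (cmod \<xi>)\<^sup>2)\<^sup>2 * (cmod \<eta>)\<^sup>2"
proof -
  define m where "m = 1 + \<epsilon> * ((Re \<xi>)\<^sup>2 + (Im \<xi>)\<^sup>2)"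
  define s where "s = Re \<xi> * Re \<eta> + Im \<xi> * Im \<eta>"
  have m: "m \<noteq> 0" using assms(2) by (simp add: m_def cmod_power2)
  have d: "stereo_deriv \<epsilon> \<xi> \<eta> = (1 / m\<^sup>2) *\<^sub>R vector [2 * Re \<eta> * m - 4 * \<epsilon> * s * Re \<xi>,
      2 * Im \<eta> * m - 4 * \<epsilon> * s * Im \<xi>, - 4 * \<epsilon> * s]"
    by (simp add: stereo_deriv_def m_def s_def cmod_power2)
  have "form \<epsilon> (stereo_deriv \<epsilon> \<xi> \<eta>) (stereo_deriv \<epsilon> \<xi> \<eta>) = ((2 * Re \<eta> * m - 4 * \<epsilon> * s * Re \<xi>)\<^sup>2
     + (2 * Im \<eta> * m - 4 * \<epsilon> * s * Im \<xi>)\<^sup>2 + \<epsilon> * (- 4 * \<epsilon> * s)\<^sup>2) / m ^ 4"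
    unfolding d form_scaleR form_vector by (simp add: power2_eq_square power4_eq_xxxx)
  also have "(2 * Re \<eta> * m - 4 * \<epsilon> * s * Re \<xi>)\<^sup>2
     + (2 * Im \<eta> * m - 4 * \<epsilon> * s * Im \<xi>)\<^sup>2 + \<epsilon> * (- 4 * \<epsilon> * s)\<^sup>2
     = 4 * ((Re \<eta>)\<^sup>2 + (Im \<eta>)\<^sup>2) * m\<^sup>2 - 16 * \<epsilon> * s * m * (Re \<xi> * Re \<eta> + Im \<xi> * Im \<eta>)
       + 16 * \<epsilon>\<^sup>2 * s\<^sup>2 * ((Re \<xi>)\<^sup>2 + (Im \<xi>)\<^sup>2) + 16 * \<epsilon> * \<epsilon>\<^sup>2 * s\<^sup>2"
    by (simp add: algebra_simps power2_eq_square)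
  also have "\<dots> = 4 * ((Re \<eta>)\<^sup>2 + (Im \<eta>)\<^sup>2) * m\<^sup>2
       + 16 * s\<^sup>2 * ((Re \<xi>)\<^sup>2 + (Im \<xi>)\<^sup>2 + \<epsilon> - \<epsilon> * m)"
    unfolding s_def[symmetric] assms(1) by (simp add: algebra_simps power2_eq_square)
  also have "\<epsilon> * m = \<epsilon> + \<epsilon>\<^sup>2 * ((Re \<xi>)\<^sup>2 + (Im \<xi>)\<^sup>2)"
    unfolding m_def by (simp add: algebra_simps power2_eq_square)
  also have "4 * ((Re \<eta>)\<^sup>2 + (Im \<eta>)\<^sup>2) * m\<^sup>2
       + 16 * s\<^sup>2 * ((Re \<xi>)\<^sup>2 + (Im \<xi>)\<^sup>2 + \<epsilon> - (\<epsilon> + \<epsilon>\<^sup>2 * ((Re \<xi>)\<^sup>2 + (Im \<xi>)\<^sup>2)))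
     = 4 * ((Re \<eta>)\<^sup>2 + (Im \<eta>)\<^sup>2) * m\<^sup>2"
    unfolding assms(1) by simp
  finally show ?thesis using m
    unfolding cmod_power2 m_def[symmetric] by (simp add: power2_eq_square power4_eq_xxxx)
qed

text \<open>The expression of the metric in these coordinates is
  \<open>2 Im (e\<^sup>2\<^sup>u d\<eta>\<^sup>* d\<xi> - \<eta> \<partial>(e\<^sup>2\<^sup>u) d\<xi> d\<xi>\<^sup>*)\<close>, with \<open>e\<^sup>2\<^sup>u\<close> as above and \<open>\<partial>\<close> the derivative
  with respect to \<open>\<xi>\<close>.\<close>

lemma neutral_metric_stereo:
  fixes \<epsilon> :: real and \<xi> \<eta> d\<xi> d\<eta> :: complex
  defines "m \<equiv> 1 + \<epsilon> * (cmod \<xi>)\<^sup>2"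
  assumes \<epsilon>: "\<epsilon> = 1 \<or> \<epsilon> = -1" and m: "m > 0"
  obtains D where "(stereo_bundle \<epsilon> has_derivative D) (at (\<xi>, \<eta>))"
    and "neutral_metric \<epsilon> (stereo_bundle \<epsilon> (\<xi>, \<eta>)) (D (d\<xi>, d\<eta>)) (D (d\<xi>, d\<eta>)) =
      2 * Im (of_real (4 / m\<^sup>2) * cnj d\<eta> * d\<xi> - \<eta> * (of_real (- 8 * \<epsilon> / m ^ 3) * cnj \<xi>) * d\<xi> * cnj d\<xi>)"
proof -
  have ee: "\<epsilon>\<^sup>2 = 1" using \<epsilon> by auto
  obtain x y where \<xi>: "\<xi> = Complex x y" by (cases \<xi>)
  obtain u w where \<eta>: "\<eta> = Complex u w" by (cases \<eta>)
  obtain x' y' where d\<xi>: "d\<xi> = Complex x' y'" by (cases d\<xi>)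
  obtain u' w' where d\<eta>: "d\<eta> = Complex u' w'" by (cases d\<eta>)
  have meq: "m = 1 + \<epsilon> * (x\<^sup>2 + y\<^sup>2)" by (simp add: m_def \<xi> cmod_power2)
  let ?M = "\<lambda>z::complex\<times>complex. 1 + \<epsilon> * ((Re (fst z))\<^sup>2 + (Im (fst z))\<^sup>2)"
  let ?S = "\<lambda>z::complex\<times>complex. Re (fst z) * Re (snd z) + Im (fst z) * Im (snd z)"
  define dM where "dM = (\<lambda>z::complex\<times>complex. 2 * \<epsilon> * (x * Re (fst z) + y * Im (fst z)))"
  define dS where "dS = (\<lambda>z::complex\<times>complex. Re (fst z) * u + x * Re (snd z) + Im (fst z) * w + y * Im (snd z))"
  define N1 where "N1 = (\<lambda>z. 2 * Re (snd z) * ?M z - 4 * \<epsilon> * ?S z * Re (fst z))"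
  define N2 where "N2 = (\<lambda>z. 2 * Im (snd z) * ?M z - 4 * \<epsilon> * ?S z * Im (fst z))"
  define N3 where "N3 = (\<lambda>z. - 4 * \<epsilon> * ?S z)"
  define d1 where "d1 = (\<lambda>z. 2 * Re (snd z) * m + 2 * u * dM z - 4 * \<epsilon> * (dS z * x + (x * u + y * w) * Re (fst z)))"
  define d2 where "d2 = (\<lambda>z. 2 * Im (snd z) * m + 2 * w * dM z - 4 * \<epsilon> * (dS z * y + (x * u + y * w) * Im (fst z)))"
  define d3 where "d3 = (\<lambda>z. - 4 * \<epsilon> * dS z)"
  define n1 where "n1 = 2 * u * m - 4 * \<epsilon> * (x * u + y * w) * x"
  define n2 where "n2 = 2 * w * m - 4 * \<epsilon> * (x * u + y * w) * y"
  define n3 where "n3 = - 4 * \<epsilon> * (x * u + y * w)"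
  have hM: "((\<lambda>z. (?M z)\<^sup>2) has_derivative (\<lambda>z. 2 * m * dM z)) (at (\<xi>, \<eta>))"
    unfolding dM_def meq
    by (auto intro!: derivative_eq_intros simp: fun_eq_iff \<xi> algebra_simps)
  have h1: "(N1 has_derivative d1) (at (\<xi>, \<eta>))"
    unfolding N1_def d1_def meq dM_def dS_def
    by (auto intro!: derivative_eq_intros simp: fun_eq_iff \<xi> \<eta> algebra_simps power2_eq_square)
  have h2: "(N2 has_derivative d2) (at (\<xi>, \<eta>))"
    unfolding N2_def d2_def meq dM_def dS_def
    by (auto intro!: derivative_eq_intros simp: fun_eq_iff \<xi> \<eta> algebra_simps power2_eq_square)
  have h3: "(N3 has_derivative d3) (at (\<xi>, \<eta>))"
    unfolding N3_def d3_def meq dM_def dS_def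
    by (auto intro!: derivative_eq_intros simp: fun_eq_iff \<xi> \<eta> algebra_simps power2_eq_square)
  have nz: "(?M (\<xi>, \<eta>))\<^sup>2 \<noteq> 0" using m by (simp add: meq \<xi>)
  let ?Q = "\<lambda>N d z. (d z * m\<^sup>2 - N * (2 * m * dM z)) / (m\<^sup>2 * m\<^sup>2)"
  define B where "B = (\<lambda>z. vector [?Q n1 d1 z, ?Q n2 d2 z, ?Q n3 d3 z] :: real^3)"
  have q: "((\<lambda>z. N z / (?M z)\<^sup>2) has_derivative ?Q n d) (at (\<xi>, \<eta>))"
    if "(N has_derivative d) (at (\<xi>, \<eta>))" "N (\<xi>, \<eta>) = n" for N d n
    using has_derivative_divide'[OF that(1) hM nz] that(2) by (simp add: \<xi> meq)
  have "((\<lambda>z. vector [N1 z / (?M z)\<^sup>2, N2 z / (?M z)\<^sup>2, N3 z / (?M z)\<^sup>2]) has_derivative B) (at (\<xi>, \<eta>))"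
    unfolding B_def
    by (intro has_derivative_vector3 q h1 h2 h3)
      (auto simp: N1_def N2_def N3_def n1_def n2_def n3_def \<xi> \<eta> meq)
  also have "(\<lambda>z. vector [N1 z / (?M z)\<^sup>2, N2 z / (?M z)\<^sup>2, N3 z / (?M z)\<^sup>2])
      = (\<lambda>z. stereo_deriv \<epsilon> (fst z) (snd z))"
    by (auto simp: fun_eq_iff stereo_deriv_def N1_def N2_def N3_def cmod_power2 vec_eq_iff forall_3)
  finally have hB: "((\<lambda>z. stereo_deriv \<epsilon> (fst z) (snd z)) has_derivative B) (at (\<xi>, \<eta>))" .
  have hA: "((\<lambda>z. stereo \<epsilon> (fst z)) has_derivative (\<lambda>z. stereo_deriv \<epsilon> \<xi> (fst z))) (at (\<xi>, \<eta>))"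
  proof -
    have "(stereo \<epsilon> has_derivative stereo_deriv \<epsilon> \<xi>) (at (fst (\<xi>, \<eta>)))"
      using stereo_has_derivative m by (simp add: m_def)
    from has_derivative_compose[OF has_derivative_fst[OF has_derivative_ident] this] show ?thesis by simp
  qed
  define D where "D = (\<lambda>z. (stereo_deriv \<epsilon> \<xi> (fst z), B z))"
  have hD: "((\<lambda>z. (stereo \<epsilon> (fst z), stereo_deriv \<epsilon> (fst z) (snd z))) has_derivative D) (at (\<xi>, \<eta>))"
    unfolding D_def by (intro has_derivative_Pair hA hB)
  let ?U = "{z::complex\<times>complex. 0 < 1 + \<epsilon> * (cmod (fst z))\<^sup>2}"
  have U: "open ?U" "(\<xi>, \<eta>) \<in> ?U"
    using m by (auto simp: m_def intro!: open_Collect_less continuous_intros)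
  have DD: "(stereo_bundle \<epsilon> has_derivative D) (at (\<xi>, \<eta>))"
    by (rule has_derivative_transform_within_open[OF hD U]) (auto simp: stereo_bundle_eq)
  have S: "stereo \<epsilon> \<xi> = (1 / m) *\<^sub>R vector [2 * x, 2 * y, 2 - m]"
    unfolding stereo_def m_def[symmetric] by (simp add: \<xi> meq cmod_power2)
  have A: "stereo_deriv \<epsilon> \<xi> d\<xi> = (1 / m\<^sup>2) *\<^sub>R
      vector [2 * x' * m - 4 * \<epsilon> * (x * x' + y * y') * x, 2 * y' * m - 4 * \<epsilon> * (x * x' + y * y') * y,
        - 4 * \<epsilon> * (x * x' + y * y')]"
    unfolding stereo_deriv_def m_def[symmetric] by (simp add: \<xi> d\<xi>)
  define P where "P = dM (d\<xi>, d\<eta>)"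
  define b1 where "b1 = d1 (d\<xi>, d\<eta>) * m - 2 * n1 * P"
  define b2 where "b2 = d2 (d\<xi>, d\<eta>) * m - 2 * n2 * P"
  define b3 where "b3 = d3 (d\<xi>, d\<eta>) * m - 2 * n3 * P"
  have Q: "?Q n d (d\<xi>, d\<eta>) = (d (d\<xi>, d\<eta>) * m - 2 * n * P) / m ^ 3" for n d
    using m by (simp add: P_def field_simps power2_eq_square power3_eq_cube)
  have B: "B (d\<xi>, d\<eta>) = (1 / m ^ 3) *\<^sub>R vector [b1, b2, b3]"
    unfolding B_def Q by (simp add: vec_eq_iff forall_3 b1_def b2_def b3_def)
  let ?a1 = "2 * x' * m - 4 * \<epsilon> * (x * x' + y * y') * x"
  let ?a2 = "2 * y' * m - 4 * \<epsilon> * (x * x' + y * y') * y"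
  let ?a3 = "- 4 * \<epsilon> * (x * x' + y * y')"
  have poly: "2 * x * (b2 * ?a3 - b3 * ?a2) + 2 * y * (b3 * ?a1 - b1 * ?a3) + (2 - m) * (b1 * ?a2 - b2 * ?a1)
      = 4 * m ^ 4 * (u' * y' - w' * x') + 8 * \<epsilon> * m ^ 3 * (w * x - u * y) * (x'\<^sup>2 + y'\<^sup>2)"
  proof -
    let ?t = "x * x' + y * y'" and ?\<sigma> = "x * u + y * w"
    let ?dS = "x' * u + x * u' + y' * w + y * w'"
    have P: "P = 2 * \<epsilon> * ?t" by (simp add: P_def dM_def d\<xi> d\<eta>)
    define z1 where "z1 = 2 * m\<^sup>2 * u' - 2 * m * P * u - 4 * \<epsilon> * ?\<sigma> * m * x'"
    define z2 where "z2 = 2 * m\<^sup>2 * w' - 2 * m * P * w - 4 * \<epsilon> * ?\<sigma> * m * y'"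
    define \<zeta> where "\<zeta> = 8 * \<epsilon> * ?\<sigma> * P - 4 * \<epsilon> * m * ?dS"
    have b: "b1 = z1 + \<zeta> * x" "b2 = z2 + \<zeta> * y" "b3 = \<zeta>"
      unfolding b1_def b2_def b3_def d1_def d2_def d3_def n1_def n2_def n3_def P_def[symmetric] z1_def z2_def \<zeta>_def
      unfolding dS_def d\<xi> d\<eta> by (simp_all add: algebra_simps power2_eq_square)
    have det: "2 * x * ((z2 + \<zeta> * y) * \<delta> - \<zeta> * (Y2 + \<delta> * y)) + 2 * y * (\<zeta> * (Y1 + \<delta> * x) - (z1 + \<zeta> * x) * \<delta>)
        + (2 - m) * ((z1 + \<zeta> * x) * (Y2 + \<delta> * y) - (z2 + \<zeta> * y) * (Y1 + \<delta> * x))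
      = (2 - m) * (z1 * Y2 - z2 * Y1) + \<delta> * m * (x * z2 - y * z1) - \<zeta> * m * (x * Y2 - y * Y1)" for Y1 Y2 \<delta>
      by (simp add: algebra_simps)
    have core: "(2 - m) * (m * (u' * y' - w' * x') - 2 * \<epsilon> * ?t * (u * y' - w * x'))
        - 2 * \<epsilon> * ?t * (m * (x * w' - y * u') - 2 * \<epsilon> * ?t * (x * w - y * u) - 2 * \<epsilon> * ?\<sigma> * (x * y' - y * x'))
        + (2 * \<epsilon> * m * ?dS - 8 * \<epsilon>\<^sup>2 * ?\<sigma> * ?t) * (x * y' - y * x')
      = m\<^sup>2 * (u' * y' - w' * x') + 2 * \<epsilon> * m * (x * w - y * u) * (x'\<^sup>2 + y'\<^sup>2)"
      unfolding meq by (simp add: algebra_simps power2_eq_square)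
    have "2 * x * (b2 * ?a3 - b3 * ?a2) + 2 * y * (b3 * ?a1 - b1 * ?a3) + (2 - m) * (b1 * ?a2 - b2 * ?a1)
        = (2 - m) * (z1 * (2 * m * y') - z2 * (2 * m * x')) + (- 4 * \<epsilon> * ?t) * m * (x * z2 - y * z1)
          - \<zeta> * m * (x * (2 * m * y') - y * (2 * m * x'))"
      unfolding det[symmetric] b by (simp add: algebra_simps)
    also have "\<dots> = 4 * m\<^sup>2 * ((2 - m) * (m * (u' * y' - w' * x') - 2 * \<epsilon> * ?t * (u * y' - w * x'))
        - 2 * \<epsilon> * ?t * (m * (x * w' - y * u') - 2 * \<epsilon> * ?t * (x * w - y * u) - 2 * \<epsilon> * ?\<sigma> * (x * y' - y * x'))
        + (2 * \<epsilon> * m * ?dS - 8 * \<epsilon>\<^sup>2 * ?\<sigma> * ?t) * (x * y' - y * x'))"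
      unfolding z1_def z2_def \<zeta>_def P by (simp add: algebra_simps power2_eq_square)
    also have "\<dots> = 4 * m ^ 4 * (u' * y' - w' * x') + 8 * \<epsilon> * m ^ 3 * (w * x - u * y) * (x'\<^sup>2 + y'\<^sup>2)"
      unfolding core by (simp add: algebra_simps eval_nat_numeral)
    finally show ?thesis .
  qed
  have zD: "D (d\<xi>, d\<eta>) = (stereo_deriv \<epsilon> \<xi> d\<xi>, B (d\<xi>, d\<eta>))" by (simp add: D_def)
  have tangent: "D (d\<xi>, d\<eta>) \<in> tangent_bundle_tangent \<epsilon> (stereo_bundle \<epsilon> (\<xi>, \<eta>))"
  proof -
    let ?F = "\<lambda>z. form \<epsilon> (stereo \<epsilon> (fst z)) (stereo_deriv \<epsilon> (fst z) (snd z))"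
    have nz: "1 + \<epsilon> * (cmod \<xi>)\<^sup>2 \<noteq> 0" using m by (simp add: m_def)
    have "(?F has_derivative (\<lambda>z. form \<epsilon> (stereo \<epsilon> \<xi>) (B z) + form \<epsilon> (stereo_deriv \<epsilon> \<xi> (fst z)) (stereo_deriv \<epsilon> \<xi> \<eta>)))
        (at (\<xi>, \<eta>))"
      using bounded_bilinear.FDERIV[OF bounded_bilinear_form hA hB] by simp
    moreover have "(?F has_derivative (\<lambda>z. 0)) (at (\<xi>, \<eta>))"
      by (rule has_derivative_transform_within_open[OF has_derivative_const U])
        (auto simp: form_stereo_stereo_deriv[OF ee])
    ultimately have "(\<lambda>z. form \<epsilon> (stereo \<epsilon> \<xi>) (B z) + form \<epsilon> (stereo_deriv \<epsilon> \<xi> (fst z)) (stereo_deriv \<epsilon> \<xi> \<eta>)) = (\<lambda>z. 0)"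
      by (rule has_derivative_unique)
    from fun_cong[OF this, of "(d\<xi>, d\<eta>)"] show ?thesis
      using form_stereo_stereo_deriv[OF ee nz]
      by (simp add: zD stereo_bundle_eq[OF nz] tangent_bundle_tangent_def add.commute)
  qed
  have m6: "1 / m * (1 / m ^ 3) * (1 / m\<^sup>2) = 1 / m ^ 6"
    by (simp add: eval_nat_numeral)
  have m46: "(4 * m ^ 4 * \<alpha> + 8 * \<epsilon> * m ^ 3 * \<beta> * \<gamma>) / m ^ 6 = 4 / m\<^sup>2 * \<alpha> + 8 * \<epsilon> / m ^ 3 * \<beta> * \<gamma>"
    for \<alpha> \<beta> \<gamma>
    using m by (simp add: field_simps eval_nat_numeral)
  show thesis
  proof (rule that[OF DD])
    have "neutral_metric \<epsilon> (stereo_bundle \<epsilon> (\<xi>, \<eta>)) (D (d\<xi>, d\<eta>)) (D (d\<xi>, d\<eta>)) =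
        2 * inner (stereo \<epsilon> \<xi>) (cross3 (B (d\<xi>, d\<eta>)) (stereo_deriv \<epsilon> \<xi> d\<xi>))"
      unfolding neutral_metric_eq[OF ee tangent] using stereo_bundle_eq[of \<epsilon> \<xi> \<eta>] m
      by (simp add: zD m_def)
    also have "\<dots> = 2 * ((4 * m ^ 4 * (u' * y' - w' * x') + 8 * \<epsilon> * m ^ 3 * (w * x - u * y) * (x'\<^sup>2 + y'\<^sup>2)) / m ^ 6)"
      unfolding S A B triple_scaleR triple_vector poly m6 by simp
    also have "\<dots> = 2 * (4 / m\<^sup>2 * (u' * y' - w' * x') + 8 * \<epsilon> / m ^ 3 * (w * x - u * y) * (x'\<^sup>2 + y'\<^sup>2))"
      unfolding m46 ..
    also have "\<dots> = 2 * Im (of_real (4 / m\<^sup>2) * cnj d\<eta> * d\<xi> - \<eta> * (of_real (- 8 * \<epsilon> / m ^ 3) * cnj \<xi>) * d\<xi> * cnj d\<xi>)"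
      by (simp add: \<xi> \<eta> d\<xi> d\<eta> power2_eq_square algebra_simps)
    finally show "neutral_metric \<epsilon> (stereo_bundle \<epsilon> (\<xi>, \<eta>)) (D (d\<xi>, d\<eta>)) (D (d\<xi>, d\<eta>)) =
      2 * Im (of_real (4 / m\<^sup>2) * cnj d\<eta> * d\<xi> - \<eta> * (of_real (- 8 * \<epsilon> / m ^ 3) * cnj \<xi>) * d\<xi> * cnj d\<xi>)" .
  qed
qed

end

(* In the coordinates (p, m), m = J v, the tangent bundle is the submanifold form p p = eps, form p m = 0
   of R^3 x R^3, and the neutral metric is induced by the constant form (a, n), (a', n') |-> form a n' + form a' n.
   The normal bundle at (p, m) is spanned by (0, p) and (p, m), and the Gauss equation shows that the
   curvature is the Kulkarni-Nomizu product of the neutral metric with the pull-back of the metric of the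
   surface. Hence isometries preserve that pull-back. Therefore they map fibres to fibres, and they map
   the geodesics of the zero section to solutions of u'' = -eps u, which makes them linear there. This gives
   (p, m) |-> (A p, A m + J (A p) s) with A in O(form).

   Isometries of the flat space are affine by the same Koszul formula. On both sides the parameters (A, s) are
   continuous in finitely many values of the isometry, so the compact-open topologies are pulled back from the
   space of parameters. The conditions det A = 1 (and A_33 > 0 in the Lorentzian case) cut out open and closed
   subsets, on which matching parameters is both a homeomorphism and compatible with composition, so it
   matches the identity components. *)

theory Submission
  imports Defs
begin

section \<open>Maps of class $C^k$\<close>

text \<open>Geometrically \<open>(p, v)\<close> is the oriented line through \<open>v\<close> with
  direction \<open>p\<close>, and \<open>(p, m)\<close> are, up to sign, its Plucker coordinates. A
  motion x |-> A x + s acts on lines, and this explains why the group of the flat space reappears.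
  In Study's dual numbers p + e m, e^2 = 0, the form extends to a dual-number-valued one whose
  e-part is the constant form inducing the neutral metric, and the bundle becomes the set of dual
  vectors of square \<epsilon>. So the formulas of a round sphere hold with dual coefficients. The
  obstacle is that an isometry lives on a submanifold of codimension two, while three derivatives
  are needed. It is therefore composed with a retraction \<open>\<pi>\<close> of an open
  neighbourhood and differentiated along constant ambient directions. The pulled-back forms are then
  degenerate, so no metric is inverted: every identity compares the isometry with
  \<open>\<pi>\<close>. For det A = -1 a bundle isometry acts on v by -A, not by A, and matching
  parameters is no homomorphism there; hence the restriction to det A = 1.\<close>

definition ddir :: "'a::euclidean_space \<Rightarrow> ('a \<Rightarrow> 'b::real_normed_vector) \<Rightarrow> 'a \<Rightarrow> 'b" where
  "ddir v f x = frechet_derivative f (at x) v"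

lemma ddir_eq: "(f has_derivative f') (at x) \<Longrightarrow> ddir v f x = f' v"
  by (simp add: ddir_def frechet_derivative_at[symmetric])

lemma has_derivative_ddir:
  "f differentiable (at x) \<Longrightarrow> (f has_derivative (\<lambda>v. ddir v f x)) (at x)"
  by (simp only: ddir_def frechet_derivative_works)

declare Ck_on.simps(2) [simp del]

text \<open>With the direction as first argument, \<open>ddir v f\<close> is again a map, so that
  derivatives can be iterated and inductions on \<open>k\<close> apply to it directly.\<close>

lemma Ck_on_Suc_ddir:
  "Ck_on (Suc k) U f \<longleftrightarrow> f differentiable_on U \<and> (\<forall>v. Ck_on k U (ddir v f))"
  by (simp add: ddir_def[abs_def] Ck_on.simps(2))

lemma Ck_on_differentiable:
  "\<lbrakk>Ck_on (Suc k) U f; open U; x \<in> U\<rbrakk> \<Longrightarrow> f differentiable (at x)"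
  by (auto simp: Ck_on_Suc_ddir differentiable_on_eq_differentiable_at)

lemma Ck_on_ddir: "Ck_on (Suc k) U f \<Longrightarrow> Ck_on k U (ddir v f)"
  by (simp add: Ck_on_Suc_ddir)

lemma Ck_on_subset: "\<lbrakk>Ck_on k U f; V \<subseteq> U\<rbrakk> \<Longrightarrow> Ck_on k V f"
  by (induction k arbitrary: f) (auto simp: Ck_on_Suc_ddir intro: continuous_on_subset differentiable_on_subset)

text \<open>Both maps have the same set of derivatives at \<open>x\<close>, so the choice inside
  \<open>frechet_derivative\<close> returns the same value, even where neither map is
  differentiable.\<close>

lemma ddir_cong_open:
  assumes "open U" "x \<in> U" "\<And>y. y \<in> U \<Longrightarrow> f y = g y"
  shows "ddir v f x = ddir v g x"
proof -
  have "(f has_derivative D) (at x) \<longleftrightarrow> (g has_derivative D) (at x)" for D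
    using assms has_derivative_transform_within_open[of _ D x UNIV U] by metis
  then show ?thesis by (simp add: ddir_def frechet_derivative_def)
qed

lemma Ck_on_cong:
  assumes "open U" "\<And>x. x \<in> U \<Longrightarrow> f x = g x" "Ck_on k U f"
  shows "Ck_on k U g"
  using assms(2,3)
proof (induction k arbitrary: f g)
  case 0
  then show ?case by (simp cong: continuous_on_cong)
next
  case (Suc k)
  have "g differentiable_on U"
    unfolding differentiable_on_def
  proof
    fix x assume x: "x \<in> U"
    then obtain D where "(f has_derivative D) (at x within U)"
      using Suc.prems(2) by (auto simp: Ck_on_Suc_ddir differentiable_on_def differentiable_def)
    then have "(g has_derivative D) (at x within U)"
      using Suc.prems(1) by (intro has_derivative_transform[OF x, of g f]) auto
    then show "g differentiable (at x within U)" by (auto simp: differentiable_def)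
  qed
  moreover have "Ck_on k U (ddir v g)" for v
  proof (rule Suc.IH)
    show "Ck_on k U (ddir v f)" using Suc.prems(2) by (rule Ck_on_ddir)
    show "ddir v f x = ddir v g x" if "x \<in> U" for x
      using ddir_cong_open[OF assms(1) that] Suc.prems(1) by blast
  qed
  ultimately show ?case by (simp add: Ck_on_Suc_ddir)
qed

lemma Ck_on_SucI:
  assumes "open U" "\<And>x. x \<in> U \<Longrightarrow> (f has_derivative f' x) (at x)" "\<And>v. Ck_on k U (\<lambda>x. f' x v)"
  shows "Ck_on (Suc k) U f"
proof -
  have "Ck_on k U (ddir v f)" for v
    by (rule Ck_on_cong[OF assms(1) _ assms(3)[of v]]) (simp add: ddir_eq[OF assms(2)])
  moreover have "f differentiable_on U"
    using assms(1,2) by (auto simp: differentiable_on_eq_differentiable_at differentiable_def)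
  ultimately show ?thesis by (simp add: Ck_on_Suc_ddir)
qed

text \<open>Glues the local extensions that \<open>smooth_on\<close> provides.\<close>

lemma Ck_on_local:
  assumes "\<And>x. x \<in> U \<Longrightarrow> \<exists>V. open V \<and> x \<in> V \<and> Ck_on k V f"
  shows "Ck_on k U f"
  using assms
proof (induction k arbitrary: f)
  case 0
  have "isCont f x" if "x \<in> U" for x
    using 0[OF that] by (auto simp: continuous_on_eq_continuous_at)
  then show ?case by (simp add: continuous_at_imp_continuous_on)
next
  case (Suc k)
  have "f differentiable (at x)" if "x \<in> U" for x
    using Suc.prems[OF that] Ck_on_differentiable by blast
  then have "f differentiable_on U"
    by (simp add: differentiable_on_def differentiable_at_withinI)
  moreover have "Ck_on k U (ddir v f)" for v
  proof (rule Suc.IH)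
    fix x assume "x \<in> U"
    then obtain V where V: "open V" "x \<in> V" "Ck_on (Suc k) V f" using Suc.prems by blast
    show "\<exists>V. open V \<and> x \<in> V \<and> Ck_on k V (ddir v f)"
      using V(1,2) Ck_on_ddir[OF V(3)] by blast
  qed
  ultimately show ?case by (simp add: Ck_on_Suc_ddir)
qed

lemma Ck_on_SucD: "\<lbrakk>open U; Ck_on (Suc k) U f\<rbrakk> \<Longrightarrow> Ck_on k U f"
proof (induction k arbitrary: f)
  case 0
  then show ?case by (simp add: Ck_on_Suc_ddir differentiable_imp_continuous_on)
next
  case (Suc k)
  then show ?case unfolding Ck_on_Suc_ddir[of "Suc k"] Ck_on_Suc_ddir[of k] by blast
qed

lemma Ck_on_const: "open U \<Longrightarrow> Ck_on k U (\<lambda>x. c)"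
proof (induction k arbitrary: c)
  case (Suc k)
  show ?case
    by (rule Ck_on_SucI[OF Suc.prems has_derivative_const Suc.IH[OF Suc.prems]])
qed simp

lemma Ck_on_bounded_linear: "\<lbrakk>open U; bounded_linear f\<rbrakk> \<Longrightarrow> Ck_on k U f"
proof (cases k)
  case (Suc n)
  assume f: "open U" "bounded_linear f"
  then show ?thesis
    unfolding Suc
    by (intro Ck_on_SucI[OF f(1) bounded_linear_imp_has_derivative[OF f(2)] Ck_on_const[OF f(1)]])
qed (simp add: linear_continuous_on)

lemma Ck_on_add:
  assumes "open U" "Ck_on k U f" "Ck_on k U g"
  shows "Ck_on k U (\<lambda>x. f x + g x)"
  using assms(2,3)
proof (induction k arbitrary: f g)
  case 0
  then show ?case by (simp add: continuous_on_add)
next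
  case (Suc k)
  show ?case
    using has_derivative_add[OF has_derivative_ddir[OF Ck_on_differentiable[OF Suc.prems(1) assms(1)]]
        has_derivative_ddir[OF Ck_on_differentiable[OF Suc.prems(2) assms(1)]]]
      Suc.IH[OF Ck_on_ddir[OF Suc.prems(1)] Ck_on_ddir[OF Suc.prems(2)]]
    by (intro Ck_on_SucI[OF assms(1)])
qed

lemma Ck_on_bilinear:
  assumes "bounded_bilinear \<beta>" "open U" "Ck_on k U f" "Ck_on k U g"
  shows "Ck_on k U (\<lambda>x. \<beta> (f x) (g x))"
  using assms(3,4)
proof (induction k arbitrary: f g)
  case 0
  then show ?case by (simp add: bounded_bilinear.continuous_on[OF assms(1)])
next
  case (Suc k)
  show ?case
    using bounded_bilinear.FDERIV[OF assms(1) has_derivative_ddir[OF Ck_on_differentiable[OF Suc.prems(1) assms(2)]]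
        has_derivative_ddir[OF Ck_on_differentiable[OF Suc.prems(2) assms(2)]]]
      Ck_on_add[OF assms(2) Suc.IH[OF Ck_on_SucD[OF assms(2) Suc.prems(1)] Ck_on_ddir[OF Suc.prems(2)]]
        Suc.IH[OF Ck_on_ddir[OF Suc.prems(1)] Ck_on_SucD[OF assms(2) Suc.prems(2)]]]
    by (intro Ck_on_SucI[OF assms(2)])
qed

lemmas Ck_on_scaleR = Ck_on_bilinear[OF bounded_bilinear_scaleR]
lemmas Ck_on_mult = Ck_on_bilinear[OF bounded_bilinear_mult]

lemma Ck_on_sum: "\<lbrakk>open U; \<And>i. i \<in> I \<Longrightarrow> Ck_on k U (f i)\<rbrakk> \<Longrightarrow> Ck_on k U (\<lambda>x. \<Sum>i\<in>I. f i x)"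
  by (induction I rule: infinite_finite_induct) (simp_all add: Ck_on_const Ck_on_add)

lemma Ck_on_compose:
  fixes g :: "'a::euclidean_space \<Rightarrow> 'b::euclidean_space"
  assumes "open U" "open V" "g ` U \<subseteq> V" "Ck_on k V f" "Ck_on k U g"
  shows "Ck_on k U (\<lambda>x. f (g x))"
  using assms(4,5)
proof (induction k arbitrary: f)
  case 0
  then show ?case using continuous_on_compose2[OF _ _ assms(3)] by auto
next
  case (Suc k)
  have g: "Ck_on k U g" by (rule Ck_on_SucD[OF assms(1) Suc.prems(2)])
  show ?case
  proof (rule Ck_on_SucI[OF assms(1)])
    fix x assume x: "x \<in> U"
    have dg: "g differentiable (at x)" using Ck_on_differentiable[OF Suc.prems(2) assms(1) x] .
    have df: "f differentiable (at (g x))"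
      using Ck_on_differentiable[OF Suc.prems(1) assms(2)] x assms(3) by blast
    have lin: "linear (\<lambda>w. ddir w f (g x))"
      using has_derivative_ddir[OF df] has_derivative_linear by blast
    \<comment> \<open>The direction \<open>ddir v g x\<close> varies with \<open>x\<close>, whereas
      \<open>Ck_on\<close> controls derivatives in constant directions only. Expanding it in the
      basis restores constant directions \<open>i\<close>.\<close>
    have "ddir (ddir v g x) f (g x) = (\<Sum>i\<in>Basis. (ddir v g x \<bullet> i) *\<^sub>R ddir i f (g x))" for v
    proof -
      have "ddir (ddir v g x) f (g x) = ddir (\<Sum>i\<in>Basis. (ddir v g x \<bullet> i) *\<^sub>R i) f (g x)"
        by (simp add: euclidean_representation)
      then show ?thesis by (simp add: linear_sum[OF lin] linear_scale[OF lin])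
    qed
    moreover have "((\<lambda>x. f (g x)) has_derivative (\<lambda>v. ddir (ddir v g x) f (g x))) (at x)"
      using has_derivative_compose[OF has_derivative_ddir[OF dg] has_derivative_ddir[OF df]] .
    ultimately show "((\<lambda>x. f (g x)) has_derivative
        (\<lambda>v. \<Sum>i\<in>Basis. (ddir v g x \<bullet> i) *\<^sub>R ddir i f (g x))) (at x)"
      by simp
  next
    fix v
    show "Ck_on k U (\<lambda>x. \<Sum>i\<in>Basis. (ddir v g x \<bullet> i) *\<^sub>R ddir i f (g x))"
      by (intro Ck_on_sum Ck_on_scaleR Ck_on_bilinear[OF bounded_bilinear_inner] Ck_on_const assms(1)
          Ck_on_ddir[OF Suc.prems(2)] Suc.IH[OF _ g] Ck_on_ddir[OF Suc.prems(1)])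
  qed
qed

lemma Ck_on_linear_image:
  fixes g :: "'a::euclidean_space \<Rightarrow> 'b::euclidean_space"
  assumes "bounded_linear L" "open U" "Ck_on k U g"
  shows "Ck_on k U (\<lambda>x. L (g x))"
  using Ck_on_compose[OF assms(2) open_UNIV _ Ck_on_bounded_linear[OF open_UNIV assms(1)] assms(3)] by simp

lemma Ck_on_Pair:
  fixes f :: "'a::euclidean_space \<Rightarrow> 'b::euclidean_space" and g :: "'a \<Rightarrow> 'c::euclidean_space"
  assumes "open U" "Ck_on k U f" "Ck_on k U g"
  shows "Ck_on k U (\<lambda>x. (f x, g x))"
proof -
  have L: "bounded_linear (\<lambda>y::'b. (y, 0::'c))" "bounded_linear (\<lambda>y::'c. (0::'b, y))"
    by (auto intro!: bounded_linear_Pair bounded_linear_ident bounded_linear_zero)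
  show ?thesis
    using Ck_on_add[OF assms(1) Ck_on_linear_image[OF L(1) assms(1,2)] Ck_on_linear_image[OF L(2) assms(1,3)]]
    by simp
qed


text \<open>Schwarz: the mean value theorem expresses the second difference through either mixed
  derivative.\<close>

lemma second_difference_mean_value:
  fixes f :: "'a::euclidean_space \<Rightarrow> real"
  assumes "open U" "Ck_on 2 U f" "h > 0"
    and seg: "\<And>s t. \<lbrakk>0 \<le> s; s \<le> h; 0 \<le> t; t \<le> h\<rbrakk> \<Longrightarrow> x + s *\<^sub>R u + t *\<^sub>R v \<in> U"
  obtains s t where "0 \<le> s" "s \<le> h" "0 \<le> t" "t \<le> h"
    "f (x + h *\<^sub>R u + h *\<^sub>R v) - f (x + h *\<^sub>R u) - f (x + h *\<^sub>R v) + f x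
      = h\<^sup>2 * ddir v (ddir u f) (x + s *\<^sub>R u + t *\<^sub>R v)"
proof -
  have C1: "Ck_on (Suc 0) U f" and C1': "Ck_on (Suc 0) U (ddir u f)"
    using assms(1,2) Ck_on_SucD[of U "Suc 0" f] Ck_on_ddir[of "Suc 0" U f] by (auto simp: numeral_2_eq_2)
  have d: "((\<lambda>s. g (a s)) has_real_derivative ddir w g (a s)) (at s)"
    if "Ck_on (Suc 0) U g" "(a has_derivative (\<lambda>r. r *\<^sub>R w)) (at s)" "a s \<in> U"
    for g :: "'a \<Rightarrow> real" and a s w
  proof -
    have g: "(g has_derivative (\<lambda>v. ddir v g (a s))) (at (a s))"
      using Ck_on_differentiable[OF that(1) assms(1) that(3)] by (rule has_derivative_ddir)
    show ?thesis
      using has_derivative_compose[OF that(2) g] linear_scale[OF has_derivative_linear[OF g]]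
      by (simp add: has_field_derivative_def mult_commute_abs)
  qed
  let ?g = "\<lambda>s. f (x + s *\<^sub>R u + h *\<^sub>R v) - f (x + s *\<^sub>R u)"
  have dg: "(?g has_real_derivative ddir u f (x + s *\<^sub>R u + h *\<^sub>R v) - ddir u f (x + s *\<^sub>R u)) (at s)"
    if "0 \<le> s" "s \<le> h" for s
    using seg[of s h] seg[of s 0] that assms(3)
    by (intro DERIV_diff d[OF C1]) (auto intro!: derivative_eq_intros)
  obtain s where s: "0 < s" "s < h"
    "?g h - ?g 0 = h * (ddir u f (x + s *\<^sub>R u + h *\<^sub>R v) - ddir u f (x + s *\<^sub>R u))"
    using MVT2[OF assms(3), of ?g, OF dg] by (auto simp del: scaleR_zero_left)
  have dk: "((\<lambda>t. ddir u f (x + s *\<^sub>R u + t *\<^sub>R v)) has_real_derivative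
      ddir v (ddir u f) (x + s *\<^sub>R u + t *\<^sub>R v)) (at t)" if "0 \<le> t" "t \<le> h" for t
    using seg[of s t] that s by (intro d[OF C1']) (auto intro!: derivative_eq_intros)
  obtain t where t: "0 < t" "t < h"
    "ddir u f (x + s *\<^sub>R u + h *\<^sub>R v) - ddir u f (x + s *\<^sub>R u + 0 *\<^sub>R v)
      = h * ddir v (ddir u f) (x + s *\<^sub>R u + t *\<^sub>R v)"
    using MVT2[OF assms(3), of "\<lambda>t. ddir u f (x + s *\<^sub>R u + t *\<^sub>R v)", OF dk] by (auto simp del: scaleR_zero_left)
  have "f (x + h *\<^sub>R u + h *\<^sub>R v) - f (x + h *\<^sub>R u) - f (x + h *\<^sub>R v) + f x
      = h\<^sup>2 * ddir v (ddir u f) (x + s *\<^sub>R u + t *\<^sub>R v)"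
    using s(3) t(3) by (simp add: power2_eq_square algebra_simps)
  then show thesis using that[of s t] s t by simp
qed

lemma ddir_commute_real:
  fixes f :: "'a::euclidean_space \<Rightarrow> real"
  assumes "open U" "Ck_on 2 U f" "x \<in> U"
  shows "ddir v (ddir u f) x = ddir u (ddir v f) x"
proof (rule ccontr)
  let ?a = "ddir v (ddir u f)" and ?b = "ddir u (ddir v f)"
  assume "?a x \<noteq> ?b x"
  define e where "e = \<bar>?a x - ?b x\<bar> / 2"
  have e: "e > 0" using \<open>?a x \<noteq> ?b x\<close> by (simp add: e_def)
  have "isCont (ddir v (ddir u f)) x" for u v
    using assms Ck_on_ddir[of 0 U "ddir u f" v] Ck_on_ddir[of "Suc 0" U f u]
    by (auto simp: numeral_2_eq_2 continuous_on_eq_continuous_at)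
  then obtain d1 d2 where d: "d1 > 0" "\<And>y. dist y x < d1 \<Longrightarrow> dist (?a y) (?a x) < e"
      "d2 > 0" "\<And>y. dist y x < d2 \<Longrightarrow> dist (?b y) (?b x) < e"
    using e unfolding continuous_at_eps_delta by (metis dist_commute)
  obtain d3 where d3: "d3 > 0" "ball x d3 \<subseteq> U" using assms(1,3) openE by blast
  define m where "m = min d1 (min d2 d3)"
  have m: "m > 0" using d d3 by (simp add: m_def)
  \<comment> \<open>Chosen so that the parallelogram at \<open>x\<close> with sides
    \<open>h u\<close> and \<open>h v\<close> stays within distance \<open>m\<close>; the summand 1
    covers \<open>u = v = 0\<close>.\<close>
  define h where "h = m / (norm u + norm v + 1)"
  have n: "norm u + norm v + 1 > 0" using norm_ge_zero[of u] norm_ge_zero[of v] by linarith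
  have h: "h > 0" using m n by (simp add: h_def)
  have near: "dist (x + s *\<^sub>R u + t *\<^sub>R v) x < m" if "0 \<le> s" "s \<le> h" "0 \<le> t" "t \<le> h" for s t
  proof -
    have "dist (x + s *\<^sub>R u + t *\<^sub>R v) x = norm (s *\<^sub>R u + t *\<^sub>R v)" by (simp add: dist_norm add.assoc)
    also have "\<dots> \<le> s * norm u + t * norm v"
      using norm_triangle_ineq[of "s *\<^sub>R u" "t *\<^sub>R v"] that by simp
    also have "\<dots> \<le> h * norm u + h * norm v"
      using that by (intro add_mono mult_right_mono) auto
    also have "\<dots> < h * (norm u + norm v + 1)" using h by (simp add: algebra_simps)
    also have "\<dots> = m" using n by (simp add: h_def)
    finally show ?thesis .
  qed
  have U: "x + s *\<^sub>R u + t *\<^sub>R v \<in> U" if "0 \<le> s" "s \<le> h" "0 \<le> t" "t \<le> h" for s t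
    using near[OF that] d3(2) by (auto simp: m_def dist_commute subset_iff)
  have U': "x + s *\<^sub>R v + t *\<^sub>R u \<in> U" if "0 \<le> s" "s \<le> h" "0 \<le> t" "t \<le> h" for s t
    using U[of t s] that by (simp add: algebra_simps)
  obtain s t where st: "0 \<le> s" "s \<le> h" "0 \<le> t" "t \<le> h"
    "f (x + h *\<^sub>R u + h *\<^sub>R v) - f (x + h *\<^sub>R u) - f (x + h *\<^sub>R v) + f x = h\<^sup>2 * ?a (x + s *\<^sub>R u + t *\<^sub>R v)"
    using second_difference_mean_value[OF assms(1,2) h U] by blast
  obtain s' t' where st': "0 \<le> s'" "s' \<le> h" "0 \<le> t'" "t' \<le> h"
    "f (x + h *\<^sub>R v + h *\<^sub>R u) - f (x + h *\<^sub>R v) - f (x + h *\<^sub>R u) + f x = h\<^sup>2 * ?b (x + s' *\<^sub>R v + t' *\<^sub>R u)"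
    using second_difference_mean_value[OF assms(1,2) h U'] by blast
  \<comment> \<open>The second difference is symmetric in \<open>u\<close> and \<open>v\<close>. So
    the two mixed derivatives agree at two points near \<open>x\<close>, while each is within
    \<open>e\<close>, half the gap, of its value at \<open>x\<close>.\<close>
  have "h\<^sup>2 * ?a (x + s *\<^sub>R u + t *\<^sub>R v) = h\<^sup>2 * ?b (x + t' *\<^sub>R u + s' *\<^sub>R v)"
    using st(5) st'(5) by (simp add: algebra_simps)
  then have "?a (x + s *\<^sub>R u + t *\<^sub>R v) = ?b (x + t' *\<^sub>R u + s' *\<^sub>R v)" using h by simp
  moreover have "dist (?a (x + s *\<^sub>R u + t *\<^sub>R v)) (?a x) < e"
    using near[OF st(1-4)] by (intro d) (simp add: m_def)
  moreover have "dist (?b (x + t' *\<^sub>R u + s' *\<^sub>R v)) (?b x) < e"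
    using near[OF st'(3,4,1,2)] by (intro d) (simp add: m_def)
  ultimately show False by (simp add: e_def dist_real_def abs_if split: if_splits)
qed

lemma ddir_linear_image:
  assumes "bounded_linear L" "f differentiable (at x)"
  shows "ddir v (\<lambda>x. L (f x)) x = L (ddir v f x)"
  by (rule ddir_eq[OF bounded_linear.has_derivative[OF assms(1) has_derivative_ddir[OF assms(2)]]])

lemma ddir_commute:
  fixes f :: "'a::euclidean_space \<Rightarrow> 'b::euclidean_space"
  assumes "open U" "Ck_on 2 U f" "x \<in> U"
  shows "ddir v (ddir u f) x = ddir u (ddir v f) x"
proof (rule euclidean_eqI)
  fix b :: 'b assume "b \<in> Basis"
  have bl: "bounded_linear (\<lambda>y. y \<bullet> b)" by (rule bounded_linear_inner_left)
  have C: "Ck_on (Suc (Suc 0)) U f" using assms(2) by (simp add: numeral_2_eq_2)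
  have C1: "Ck_on (Suc 0) U (ddir u f)" for u by (rule Ck_on_ddir[OF C])
  have 1: "ddir u (\<lambda>x. f x \<bullet> b) y = ddir u f y \<bullet> b" if "y \<in> U" for u y
    by (rule ddir_linear_image[OF bl Ck_on_differentiable[OF C assms(1) that]])
  have 2: "ddir v (ddir u (\<lambda>x. f x \<bullet> b)) x = ddir v (ddir u f) x \<bullet> b" for u v
    using ddir_cong_open[OF assms(1,3) 1] ddir_linear_image[OF bl Ck_on_differentiable[OF C1 assms(1,3)]]
    by simp
  have "Ck_on 2 U (\<lambda>x. f x \<bullet> b)" by (rule Ck_on_linear_image[OF bl assms(1,2)])
  from ddir_commute_real[OF assms(1) this assms(3)] show "ddir v (ddir u f) x \<bullet> b = ddir u (ddir v f) x \<bullet> b"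
    by (simp add: 2)
qed

section \<open>Koszul formula and Gauss equation for two maps inducing the same form\<close>

lemma ddir_bilinear:
  assumes "bounded_bilinear \<beta>" "f differentiable (at x)" "g differentiable (at x)"
  shows "ddir v (\<lambda>x. \<beta> (f x) (g x)) x = \<beta> (f x) (ddir v g x) + \<beta> (ddir v f x) (g x)"
  by (rule ddir_eq[OF bounded_bilinear.FDERIV[OF assms(1) has_derivative_ddir[OF assms(2)] has_derivative_ddir[OF assms(3)]]])

text \<open>\<open>P\<close> is the reference map: \<open>\<pi>\<close> for the bundle, the identity
  for the flat space. Three derivatives are what the Gauss equation costs.\<close>

locale equal_induced_metrics =
  fixes U :: "'a::euclidean_space set" and F P :: "'a \<Rightarrow> 'b::euclidean_space" and \<beta> :: "'b \<Rightarrow> 'b \<Rightarrow> real"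
  assumes U: "open U" and CF: "Ck_on 3 U F" and CP: "Ck_on 3 U P"
    and bil: "bounded_bilinear \<beta>" and sym: "\<beta> a b = \<beta> b a"
    and eq: "x \<in> U \<Longrightarrow> \<beta> (ddir X F x) (ddir Y F x) = \<beta> (ddir X P x) (ddir Y P x)"
begin

lemma smoothness:
  assumes "G = F \<or> G = P"
  shows "Ck_on 2 U G" "Ck_on 2 U (ddir X G)" "x \<in> U \<Longrightarrow> ddir X G differentiable (at x)"
    "x \<in> U \<Longrightarrow> ddir X (ddir Y G) differentiable (at x)"
proof -
  have 3: "Ck_on (Suc (Suc (Suc 0))) U G" using CF CP assms by (auto simp: eval_nat_numeral)
  show "Ck_on 2 U G" using Ck_on_SucD[OF U 3] by (simp add: numeral_2_eq_2)
  have 2: "Ck_on (Suc (Suc 0)) U (ddir X G)" for X by (rule Ck_on_ddir[OF 3])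
  then show "Ck_on 2 U (ddir X G)" by (simp add: numeral_2_eq_2)
  show "ddir X G differentiable (at x)" if "x \<in> U" by (rule Ck_on_differentiable[OF 2 U that])
  show "ddir X (ddir Y G) differentiable (at x)" if "x \<in> U"
    by (rule Ck_on_differentiable[OF Ck_on_ddir[OF 2] U that])
qed

text \<open>The difference \<open>e\<close> of the two sides is symmetric in its first two arguments
  by Schwarz, and skew in the last two by differentiating \<open>eq\<close>. Alternating both
  symmetries around the six permutations gives \<open>e = - e\<close>.\<close>

lemma koszul:
  assumes "x \<in> U"
  shows "\<beta> (ddir X (ddir Y F) x) (ddir Z F x) = \<beta> (ddir X (ddir Y P) x) (ddir Z P x)"
proof -
  define e where "e X Y Z = \<beta> (ddir X (ddir Y F) x) (ddir Z F x) - \<beta> (ddir X (ddir Y P) x) (ddir Z P x)"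
    for X Y Z
  have s: "e X Y Z = e Y X Z" for X Y Z
    using ddir_commute[OF U smoothness(1) assms] by (simp add: e_def)
  have a: "e X Y Z = - e X Z Y" for X Y Z
  proof -
    have "ddir X (\<lambda>x. \<beta> (ddir Y F x) (ddir Z F x)) x = ddir X (\<lambda>x. \<beta> (ddir Y P x) (ddir Z P x)) x"
      by (rule ddir_cong_open[OF U assms eq])
    then show ?thesis
      using assms by (simp add: ddir_bilinear[OF bil] smoothness sym e_def)
  qed
  have "e X Y Z = 0"
    using s[of X Y Z] a[of Y X Z] s[of Y Z X] a[of Z Y X] s[of Z X Y] a[of X Z Y] by linarith
  then show ?thesis by (simp add: e_def)
qed

text \<open>Differentiate \<open>koszul\<close> for (X, X, Y) along \<open>Y\<close> and for (X, Y,
  Y) along \<open>X\<close>, and subtract. The third derivatives cancel, which leaves only second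
  ones.\<close>

lemma gauss:
  assumes "x \<in> U"
  shows "\<beta> (ddir X (ddir X F) x) (ddir Y (ddir Y F) x) - \<beta> (ddir X (ddir Y F) x) (ddir X (ddir Y F) x)
    = \<beta> (ddir X (ddir X P) x) (ddir Y (ddir Y P) x) - \<beta> (ddir X (ddir Y P) x) (ddir X (ddir Y P) x)"
proof -
  have third: "ddir Y (ddir X (ddir X G)) x = ddir X (ddir X (ddir Y G)) x" if G: "G = F \<or> G = P" for G
    unfolding ddir_commute[OF U smoothness(2)[OF G] assms]
    by (rule ddir_cong_open[OF U assms ddir_commute[OF U smoothness(1)[OF G]]])
  have "ddir Y (\<lambda>x. \<beta> (ddir X (ddir X F) x) (ddir Y F x)) x = ddir Y (\<lambda>x. \<beta> (ddir X (ddir X P) x) (ddir Y P x)) x"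
    by (rule ddir_cong_open[OF U assms koszul])
  moreover have "ddir X (\<lambda>x. \<beta> (ddir X (ddir Y F) x) (ddir Y F x)) x = ddir X (\<lambda>x. \<beta> (ddir X (ddir Y P) x) (ddir Y P x)) x"
    by (rule ddir_cong_open[OF U assms koszul])
  ultimately show ?thesis
    using assms by (simp add: ddir_bilinear[OF bil] smoothness third)
qed

end

section \<open>The tangent bundle as a submanifold of a flat space\<close>

definition dual_form :: "real \<Rightarrow> (real^3) \<times> (real^3) \<Rightarrow> (real^3) \<times> (real^3) \<Rightarrow> real" where
  "dual_form \<epsilon> X Y = form \<epsilon> (fst X) (snd Y) + form \<epsilon> (fst Y) (snd X)"

lemma dual_form_commute: "dual_form \<epsilon> X Y = dual_form \<epsilon> Y X"
  by (simp add: dual_form_def add.commute)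

lemma bounded_bilinear_dual_form: "bounded_bilinear (dual_form \<epsilon>)"
proof -
  have "bilinear (dual_form \<epsilon>)"
    unfolding bilinear_def dual_form_def form_def by (auto intro!: linearI simp: algebra_simps)
  then show ?thesis by (simp add: bilinear_conv_bounded_bilinear)
qed

lemmas form_linear = bounded_bilinear.add_left[OF bounded_bilinear_form]
  bounded_bilinear.add_right[OF bounded_bilinear_form]
  bounded_bilinear.diff_left[OF bounded_bilinear_form]
  bounded_bilinear.diff_right[OF bounded_bilinear_form]
  bounded_bilinear.scaleR_left[OF bounded_bilinear_form]
  bounded_bilinear.scaleR_right[OF bounded_bilinear_form]
  bounded_bilinear.minus_left[OF bounded_bilinear_form]
  bounded_bilinear.minus_right[OF bounded_bilinear_form]
  bounded_bilinear.zero_left[OF bounded_bilinear_form]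
  bounded_bilinear.zero_right[OF bounded_bilinear_form]

lemma form_has_derivative [derivative_intros]:
  "\<lbrakk>(f has_derivative f') (at x within S); (g has_derivative g') (at x within S)\<rbrakk> \<Longrightarrow>
    ((\<lambda>x. form \<epsilon> (f x) (g x)) has_derivative (\<lambda>h. form \<epsilon> (f x) (g' h) + form \<epsilon> (f' h) (g x))) (at x within S)"
  by (rule bounded_bilinear.FDERIV[OF bounded_bilinear_form])

lemma continuous_on_form [continuous_intros]:
  "\<lbrakk>continuous_on S f; continuous_on S g\<rbrakk> \<Longrightarrow> continuous_on S (\<lambda>x. form \<epsilon> (f x) (g x))"
  by (rule bounded_bilinear.continuous_on[OF bounded_bilinear_form])

lemma bounded_bilinear_complex_structure: "bounded_bilinear (complex_structure \<epsilon>)"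
proof -
  have "bilinear (complex_structure \<epsilon>)"
    unfolding bilinear_def complex_structure_def
    by (auto intro!: linearI simp: Let_def cross3_simps forall_3)
  then show ?thesis by (simp add: bilinear_conv_bounded_bilinear)
qed

locale sign =
  fixes \<epsilon> :: real
  assumes sign: "\<epsilon> = 1 \<or> \<epsilon> = -1"
begin

lemma sign_square [simp]: "\<epsilon>\<^sup>2 = 1" "\<epsilon> * \<epsilon> = 1" "\<epsilon> * (\<epsilon> * x) = x" "\<epsilon> \<noteq> 0"
  using sign by auto

abbreviation J :: "real^3 \<Rightarrow> real^3 \<Rightarrow> real^3" where "J \<equiv> complex_structure \<epsilon>"

text \<open>The expansion of a double cross product. For \<open>p\<close> in the surface and
  \<open>v\<close> tangent at \<open>p\<close> it becomes \<open>- v\<close>.\<close>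

lemma J_J: "J p (J p v) = \<epsilon> *\<^sub>R (form \<epsilon> p v *\<^sub>R p - form \<epsilon> p p *\<^sub>R v)"
  using sign by (auto simp: complex_structure_def Let_def form_def vec_eq_iff forall_3 cross3_simps)

lemma form_J_self [simp]: "form \<epsilon> p (J p a) = 0" "form \<epsilon> (J p a) p = 0" "form \<epsilon> a (J p a) = 0" "form \<epsilon> (J p a) a = 0"
  using form_complex_structure_self[of \<epsilon> p a] form_complex_structure[of \<epsilon> p a a]
  by (simp_all add: form_commute dot_cross_self)

lemma form_nondegenerate: "(\<And>y. form \<epsilon> u y = 0) \<Longrightarrow> u = 0"
proof -
  assume "\<And>y. form \<epsilon> u y = 0"
  from this[of "axis 1 1"] this[of "axis 2 1"] this[of "axis 3 1"] show "u = 0"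
    by (simp add: form_def vec_eq_iff forall_3 axis_def)
qed

text \<open>In the Lorentzian case, tangency turns \<open>p$3 * a$3\<close> into an inner product of
  the first two coordinates. Cauchy-Schwarz bounds it, and \<open>p$3\<close> squared exceeds the
  sum of the other two squares by 1.\<close>

lemma form_pos:
  assumes p: "p \<in> surface \<epsilon>" and a: "form \<epsilon> p a = 0" "a \<noteq> 0"
  shows "form \<epsilon> a a > 0"
proof (cases "\<epsilon> = 1")
  case True
  then have "form \<epsilon> a a = a \<bullet> a" by (simp add: form_def inner_vec_def sum_3)
  then show ?thesis using a by simp
next
  case False
  then have e: "\<epsilon> = -1" using sign by simp
  let ?s = "(a$1)\<^sup>2 + (a$2)\<^sup>2"
  have pp: "(p$3)\<^sup>2 = 1 + (p$1)\<^sup>2 + (p$2)\<^sup>2" and pos: "p$3 > 0"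
    using p e by (auto simp: surface_def form_def power2_eq_square)
  have pa: "p$1 * a$1 + p$2 * a$2 = p$3 * a$3" using a e by (simp add: form_def)
  have "(p$3 * a$3)\<^sup>2 \<le> ((p$1)\<^sup>2 + (p$2)\<^sup>2) * ?s"
    unfolding pa[symmetric] using zero_le_power2[of "p$1 * a$2 - p$2 * a$1"]
    by (simp add: power2_eq_square algebra_simps)
  then have "?s \<le> (p$3)\<^sup>2 * (?s - (a$3)\<^sup>2)"
    using pp by (simp add: algebra_simps power_mult_distrib)
  moreover have "?s > 0"
  proof (rule ccontr)
    assume "\<not> ?s > 0"
    then have "a$1 = 0" "a$2 = 0" using sum_power2_gt_zero_iff by blast+
    then show False using pa pos a(2) by (simp add: vec_eq_iff forall_3)
  qed
  ultimately have "(p$3)\<^sup>2 * (?s - (a$3)\<^sup>2) > 0" by linarith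
  then have "?s - (a$3)\<^sup>2 > 0" using zero_less_mult_pos by (metis pos zero_less_power)
  then show ?thesis using e by (simp add: form_def power2_eq_square)
qed

lemma form_eq_0_surface:
  assumes "p \<in> surface \<epsilon>" "form \<epsilon> p a = 0" "form \<epsilon> a a = 0"
  shows "a = 0"
  using form_pos[OF assms(1,2)] assms(3) by force

lemma surface_form: "p \<in> surface \<epsilon> \<Longrightarrow> form \<epsilon> p p = \<epsilon>"
  by (simp add: surface_def)

lemma orthogonal_to_tangent:
  assumes q: "form \<epsilon> q q = \<epsilon>" and u: "\<And>n. form \<epsilon> q n = 0 \<Longrightarrow> form \<epsilon> u n = 0"
  shows "u = (\<epsilon> * form \<epsilon> u q) *\<^sub>R q"
proof -
  let ?u = "u - (\<epsilon> * form \<epsilon> u q) *\<^sub>R q"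
  have uq: "form \<epsilon> ?u q = 0" using q by (simp add: form_linear)
  have "form \<epsilon> ?u y = 0" for y
  proof -
    let ?n = "y - (\<epsilon> * form \<epsilon> y q) *\<^sub>R q"
    have n: "form \<epsilon> q ?n = 0" using q by (simp add: form_linear form_commute)
    have "form \<epsilon> ?u ?n = 0"
      unfolding form_diff_scaleR(1)[of \<epsilon> u _ q ?n] using u[OF n] n by simp
    moreover have "form \<epsilon> ?u ?n = form \<epsilon> ?u y - \<epsilon> * form \<epsilon> y q * form \<epsilon> ?u q"
      by (rule form_diff_scaleR(2))
    ultimately show ?thesis using uq by simp
  qed
  then show ?thesis using form_nondegenerate[of ?u] by simp
qed

abbreviation M :: "((real^3) \<times> (real^3)) set" where "M \<equiv> tangent_bundle \<epsilon>"
abbreviation T :: "(real^3) \<times> (real^3) \<Rightarrow> ((real^3) \<times> (real^3)) set" where "T \<equiv> tangent_bundle_tangent \<epsilon>"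

lemma M_iff: "x \<in> M \<longleftrightarrow> fst x \<in> surface \<epsilon> \<and> form \<epsilon> (fst x) (snd x) = 0"
  by (cases x) (simp add: tangent_bundle_def)

lemma T_iff: "X \<in> T x \<longleftrightarrow> form \<epsilon> (fst x) (fst X) = 0 \<and> form \<epsilon> (fst X) (snd x) + form \<epsilon> (fst x) (snd X) = 0"
  by (cases x; cases X) (simp add: tangent_bundle_tangent_def)

text \<open>Both \<open>y\<close> and \<open>(0, fst y)\<close> are null for
  \<open>dual_form\<close> and pair to \<epsilon>, so each coefficient is found by pairing
  \<open>V\<close> with the other vector.\<close>

lemma normal_vector:
  assumes y: "y \<in> M" and V: "\<And>Z. Z \<in> T y \<Longrightarrow> dual_form \<epsilon> V Z = 0"
  shows "V = (\<epsilon> * form \<epsilon> (fst V) (fst y)) *\<^sub>R y + (\<epsilon> * dual_form \<epsilon> V y) *\<^sub>R (0, fst y)"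
proof -
  obtain q w where yq: "y = (q, w)" by (cases y)
  obtain V1 V2 where VV: "V = (V1, V2)" by (cases V)
  have q: "form \<epsilon> q q = \<epsilon>" and qw: "form \<epsilon> q w = 0" using y yq by (auto simp: M_iff surface_form)
  define c where "c = \<epsilon> * form \<epsilon> V1 q"
  have 1: "V1 = c *\<^sub>R q"
    unfolding c_def
  proof (rule orthogonal_to_tangent[OF q])
    fix n assume "form \<epsilon> q n = 0"
    then have "(0, n) \<in> T y" by (simp add: T_iff yq form_linear)
    from V[OF this] show "form \<epsilon> V1 n = 0" by (simp add: dual_form_def VV form_linear)
  qed
  have 2: "V2 - c *\<^sub>R w = (\<epsilon> * form \<epsilon> (V2 - c *\<^sub>R w) q) *\<^sub>R q"
  proof (rule orthogonal_to_tangent[OF q])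
    fix a assume a: "form \<epsilon> q a = 0"
    \<comment> \<open>The horizontal lift of \<open>a\<close>. Vertical test vectors determined
      \<open>V1\<close>; these lifts determine \<open>V2\<close>.\<close>
    have "(a, (- \<epsilon> * form \<epsilon> a w) *\<^sub>R q) \<in> T y" using a q by (simp add: T_iff yq form_linear)
    from V[OF this] show "form \<epsilon> (V2 - c *\<^sub>R w) a = 0"
      using q by (simp add: dual_form_def VV 1 form_linear form_commute)
  qed
  have "dual_form \<epsilon> V y = form \<epsilon> (V2 - c *\<^sub>R w) q + 2 * c * form \<epsilon> q w"
    by (simp add: dual_form_def VV yq 1 form_linear form_commute)
  then have "V2 = c *\<^sub>R w + (\<epsilon> * dual_form \<epsilon> V y) *\<^sub>R q"
    using 2 qw by (simp add: algebra_simps)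
  with 1 have "V = c *\<^sub>R y + (\<epsilon> * dual_form \<epsilon> V y) *\<^sub>R (0, q)"
    unfolding prod_eq_iff by (simp add: VV yq)
  then show ?thesis by (simp add: yq VV c_def)
qed

section \<open>The retraction of an open neighbourhood onto the submanifold\<close>

definition \<Omega> :: "((real^3) \<times> (real^3)) set" where
  "\<Omega> = {x. 0 < \<epsilon> * form \<epsilon> (fst x) (fst x) \<and> (\<epsilon> < 0 \<longrightarrow> fst x $ 3 > 0)}"

lemma open_\<Omega>: "open \<Omega>"
proof -
  have "\<Omega> = {x. 0 < \<epsilon> * form \<epsilon> (fst x) (fst x)} \<inter> (if \<epsilon> < 0 then {x. fst x $ 3 > 0} else UNIV)"
    by (auto simp: \<Omega>_def)
  also have "open \<dots>"
    by (auto intro!: open_Int open_Collect_less continuous_intros)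
  finally show ?thesis .
qed

lemma M_subset_\<Omega>: "M \<subseteq> \<Omega>"
  by (auto simp: \<Omega>_def M_iff surface_def)

lemma M_in_\<Omega>: "x \<in> M \<Longrightarrow> x \<in> \<Omega>"
  using M_subset_\<Omega> by blast

definition r :: "(real^3) \<times> (real^3) \<Rightarrow> real" where
  "r x = 1 / sqrt (\<epsilon> * form \<epsilon> (fst x) (fst x))"

text \<open>Normalisation of the dual vector \<open>p + e m\<close>, \<open>e\<^sup>2 = 0\<close>, with respect to the dual-number-valued
  extension of the form.\<close>

definition \<pi> :: "(real^3) \<times> (real^3) \<Rightarrow> (real^3) \<times> (real^3)" where
  "\<pi> x = (r x *\<^sub>R fst x, r x *\<^sub>R snd x - (\<epsilon> * r x ^ 3 * form \<epsilon> (fst x) (snd x)) *\<^sub>R fst x)"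

lemma r_pos: "x \<in> \<Omega> \<Longrightarrow> r x > 0"
  by (simp add: r_def \<Omega>_def)

lemma r_square: "x \<in> \<Omega> \<Longrightarrow> (r x)\<^sup>2 * form \<epsilon> (fst x) (fst x) = \<epsilon>"
  by (auto simp: r_def \<Omega>_def power_divide field_simps)

lemma r_M: "x \<in> M \<Longrightarrow> r x = 1"
  by (simp add: r_def M_iff surface_form)

lemma \<pi>_M: "x \<in> M \<Longrightarrow> \<pi> x = x"
  by (cases x) (simp add: \<pi>_def r_M M_iff)

lemma \<pi>_in_M: assumes "x \<in> \<Omega>" shows "\<pi> x \<in> M"
proof -
  have "form \<epsilon> (r x *\<^sub>R fst x) (r x *\<^sub>R fst x) = \<epsilon>"
    using r_square[OF assms] by (simp add: form_linear power2_eq_square mult.assoc)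
  moreover have "form \<epsilon> (r x *\<^sub>R fst x) (snd (\<pi> x)) = (r x)\<^sup>2 * form \<epsilon> (fst x) (snd x) * (1 - \<epsilon> * ((r x)\<^sup>2 * form \<epsilon> (fst x) (fst x)))"
    by (simp add: form_linear \<pi>_def algebra_simps power2_eq_square power3_eq_cube)
  ultimately show ?thesis
    using r_pos[OF assms] r_square[OF assms] assms by (simp add: M_iff surface_def \<pi>_def \<Omega>_def)
qed

lemma r_has_derivative:
  assumes "x \<in> \<Omega>"
  shows "(r has_derivative (\<lambda>X. - \<epsilon> * r x ^ 3 * form \<epsilon> (fst x) (fst X))) (at x)"
proof -
  define N where "N = (\<lambda>x::(real^3)\<times>(real^3). \<epsilon> * form \<epsilon> (fst x) (fst x))"
  have N: "(N has_derivative (\<lambda>X. 2 * \<epsilon> * form \<epsilon> (fst x) (fst X))) (at x)"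
    unfolding N_def by (auto intro!: derivative_eq_intros simp: fun_eq_iff form_commute algebra_simps)
  have pos: "N x > 0" using assms by (simp add: N_def \<Omega>_def)
  have d: "((\<lambda>t. 1 / sqrt t) has_real_derivative - 1 / (2 * sqrt (N x) ^ 3)) (at (N x))"
    using pos by (auto intro!: derivative_eq_intros simp: field_simps power2_eq_square power3_eq_cube)
  show ?thesis
    using has_derivative_compose[OF N d[unfolded has_field_derivative_def]]
    by (simp add: r_def[abs_def] N_def power_divide mult.commute mult.left_commute)
qed

lemma Ck_on_fst_snd: "open U \<Longrightarrow> Ck_on k U (fst :: 'a::euclidean_space \<times> 'b::euclidean_space \<Rightarrow> 'a)"
  "open U \<Longrightarrow> Ck_on k U (snd :: 'a \<times> 'b \<Rightarrow> 'b)"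
  by (rule Ck_on_bounded_linear; simp add: bounded_linear_fst bounded_linear_snd)+

lemmas Ck_on_form = Ck_on_bilinear[OF bounded_bilinear_form]

lemma Ck_on_power: "\<lbrakk>open U; Ck_on k U f\<rbrakk> \<Longrightarrow> Ck_on k U (\<lambda>x. f x ^ n :: real)"
  by (induction n) (auto intro: Ck_on_const Ck_on_mult)

text \<open>The derivative of \<open>r\<close> is polynomial in \<open>r\<close> and in values of
  the form, so the induction on \<open>k\<close> closes.\<close>

lemma Ck_on_r: "Ck_on k \<Omega> r"
proof (induction k)
  case 0
  have "r differentiable_on \<Omega>"
    using r_has_derivative unfolding differentiable_on_eq_differentiable_at[OF open_\<Omega>] differentiable_def by blast
  then show ?case by (simp add: differentiable_imp_continuous_on)
next
  case (Suc k)
  show ?case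
    by (rule Ck_on_SucI[OF open_\<Omega> r_has_derivative], assumption)
      (intro Ck_on_mult Ck_on_power Ck_on_form Ck_on_const Ck_on_fst_snd open_\<Omega> Suc)
qed

lemma Ck_on_diff: "\<lbrakk>open U; Ck_on k U f; Ck_on k U g\<rbrakk> \<Longrightarrow> Ck_on k U (\<lambda>x. f x - g x)"
  using Ck_on_add[of U k f "\<lambda>x. (-1) *\<^sub>R g x"] Ck_on_scaleR[OF _ Ck_on_const, of U k g "-1"] by simp

lemma Ck_on_\<pi>: "Ck_on k \<Omega> \<pi>"
  unfolding \<pi>_def[abs_def]
  by (intro Ck_on_Pair Ck_on_diff Ck_on_scaleR Ck_on_mult Ck_on_power Ck_on_form Ck_on_const Ck_on_fst_snd
      Ck_on_r open_\<Omega>)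

text \<open>The differential of \<open>\<pi>\<close> in closed form, so that
  \<open>second_ddir_\<pi>\<close> can differentiate it once more. The factor
  \<open>3 * r x ^ 5\<close> comes from differentiating \<open>r ^ 3\<close>, with the two signs
  \<epsilon> cancelling.\<close>

definition d\<pi> :: "(real^3) \<times> (real^3) \<Rightarrow> (real^3) \<times> (real^3) \<Rightarrow> (real^3) \<times> (real^3)" where
  "d\<pi> X x = (r x *\<^sub>R fst X - (\<epsilon> * r x ^ 3 * form \<epsilon> (fst x) (fst X)) *\<^sub>R fst x,
    r x *\<^sub>R snd X - (\<epsilon> * r x ^ 3 * form \<epsilon> (fst x) (fst X)) *\<^sub>R snd x
    + (3 * r x ^ 5 * form \<epsilon> (fst x) (fst X) * form \<epsilon> (fst x) (snd x)) *\<^sub>R fst x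
    - (\<epsilon> * r x ^ 3 * (form \<epsilon> (fst X) (snd x) + form \<epsilon> (fst x) (snd X))) *\<^sub>R fst x
    - (\<epsilon> * r x ^ 3 * form \<epsilon> (fst x) (snd x)) *\<^sub>R fst X)"

lemma \<pi>_has_derivative:
  assumes "x \<in> \<Omega>"
  shows "(\<pi> has_derivative (\<lambda>X. d\<pi> X x)) (at x)"
  unfolding \<pi>_def[abs_def] d\<pi>_def
  by (rule derivative_eq_intros r_has_derivative[OF assms] refl)+
    (auto simp: fun_eq_iff algebra_simps eval_nat_numeral form_commute)

lemma ddir_\<pi>: "x \<in> \<Omega> \<Longrightarrow> ddir X \<pi> x = d\<pi> X x"
  by (rule ddir_eq[OF \<pi>_has_derivative])

lemma ddir_\<pi>_M: assumes "x \<in> M" "X \<in> T x" shows "ddir X \<pi> x = X"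
proof -
  have "form \<epsilon> (fst x) (snd x) = 0" using assms(1) by (simp add: M_iff)
  then show ?thesis
    using assms by (simp add: ddir_\<pi>[OF M_in_\<Omega>] d\<pi>_def r_M T_iff)
qed

text \<open>\<open>\<pi>\<close> is invariant under scaling both components by the same positive
  factor.\<close>

lemma ddir_\<pi>_radial: assumes "x \<in> M" shows "ddir x \<pi> x = 0"
proof -
  have "form \<epsilon> (fst x) (snd x) = 0" "form \<epsilon> (fst x) (fst x) = \<epsilon>" using assms by (simp_all add: M_iff surface_form)
  then show ?thesis
    by (simp add: ddir_\<pi>[OF M_in_\<Omega>] assms d\<pi>_def r_M zero_prod_def)
qed

text \<open>The second fundamental form of the submanifold. In dual numbers it reads - \<epsilon>
  <X, Y> x as for a round sphere, where <X, Y> has real part \<open>form\<close> of the horizontal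
  parts and e-part \<open>dual_form\<close>. There is no tangential part.\<close>

lemma second_ddir_\<pi>:
  assumes x: "x \<in> M" and X: "X \<in> T x" and Y: "Y \<in> T x"
  shows "ddir Y (ddir X \<pi>) x = - \<epsilon> *\<^sub>R (form \<epsilon> (fst X) (fst Y) *\<^sub>R x + dual_form \<epsilon> X Y *\<^sub>R (0, fst x))"
proof -
  have x': "x \<in> \<Omega>" using x by (rule M_in_\<Omega>)
  have pm: "form \<epsilon> (fst x) (snd x) = 0" using x by (simp add: M_iff)
  have Xp: "form \<epsilon> (fst x) (fst X) = 0" "form \<epsilon> (fst x) (snd X) = - form \<epsilon> (fst X) (snd x)"
    and Yp: "form \<epsilon> (fst x) (fst Y) = 0" "form \<epsilon> (fst x) (snd Y) = - form \<epsilon> (fst Y) (snd x)"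
    using X Y by (auto simp: T_iff)
  have eq: "ddir Y (ddir X \<pi>) x = ddir Y (d\<pi> X) x"
    by (rule ddir_cong_open[OF open_\<Omega> x' ddir_\<pi>])
  have D: "(d\<pi> X has_derivative (\<lambda>Y.
      let s = form \<epsilon> (fst x) (fst Y); a = fst X; n = snd X; p = fst x; m = snd x in
      ((- \<epsilon> * s) *\<^sub>R a - (\<epsilon> * form \<epsilon> (fst Y) a) *\<^sub>R p,
       (- \<epsilon> * s) *\<^sub>R n - (\<epsilon> * form \<epsilon> (fst Y) a) *\<^sub>R m
       - (\<epsilon> * (form \<epsilon> a (snd Y) + form \<epsilon> (fst Y) n)) *\<^sub>R p
       - (\<epsilon> * (form \<epsilon> (fst Y) m + form \<epsilon> p (snd Y))) *\<^sub>R a))) (at x)"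
    unfolding d\<pi>_def[abs_def] Let_def
    by (rule derivative_eq_intros r_has_derivative[OF x'] refl)+
      (auto simp: fun_eq_iff pm Xp r_M[OF x] form_linear form_commute[of _ "snd x" "fst x"] algebra_simps)
  show ?thesis
    unfolding eq ddir_eq[OF D]
    by (simp add: Let_def Xp Yp dual_form_def form_commute[of \<epsilon> "fst Y"] prod_eq_iff algebra_simps)
qed

lemma ddir_tangent:
  assumes "open U" "x \<in> U" "\<And>y. y \<in> U \<Longrightarrow> G y \<in> M" "G differentiable (at x)"
  shows "ddir X G x \<in> T (G x)"
proof -
  have D: "(G has_derivative (\<lambda>X. ddir X G x)) (at x)" by (rule has_derivative_ddir[OF assms(4)])
  have 1: "ddir X (\<lambda>x. form \<epsilon> (fst (G x)) (fst (G x))) x = 2 * form \<epsilon> (fst (G x)) (fst (ddir X G x))"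
    using ddir_eq[OF form_has_derivative[OF has_derivative_fst[OF D] has_derivative_fst[OF D]]]
    by (simp add: form_commute)
  have 2: "ddir X (\<lambda>x. form \<epsilon> (fst (G x)) (snd (G x))) x
      = form \<epsilon> (fst (G x)) (snd (ddir X G x)) + form \<epsilon> (fst (ddir X G x)) (snd (G x))"
    by (rule ddir_eq[OF form_has_derivative[OF has_derivative_fst[OF D] has_derivative_snd[OF D]]])
  have c: "ddir X (\<lambda>x. c :: real) x = 0" for c by (rule ddir_eq[OF has_derivative_const])
  have "ddir X (\<lambda>x. form \<epsilon> (fst (G x)) (fst (G x))) x = ddir X (\<lambda>x. \<epsilon>) x"
    "ddir X (\<lambda>x. form \<epsilon> (fst (G x)) (snd (G x))) x = ddir X (\<lambda>x. 0) x"
    using assms(3) by (auto intro!: ddir_cong_open[OF assms(1,2)] simp: M_iff surface_form)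
  then show ?thesis using 1 2 c by (simp add: T_iff)
qed

end

section \<open>Rigidity of isometries\<close>

lemma has_vector_derivative_ddir:
  assumes "G differentiable (at (c t))" "(c has_vector_derivative v) (at t)"
  shows "((\<lambda>t. G (c t)) has_vector_derivative ddir v G (c t)) (at t)"
proof -
  have G: "(G has_derivative (\<lambda>v. ddir v G (c t))) (at (c t))" by (rule has_derivative_ddir[OF assms(1)])
  show ?thesis
    using has_derivative_compose[OF assms(2)[unfolded has_vector_derivative_def] G]
      linear_scale[OF has_derivative_linear[OF G]]
    by (simp add: has_vector_derivative_def)
qed

lemma constant_of_vector_derivative_zero:
  fixes f :: "real \<Rightarrow> 'a::real_normed_vector"
  assumes "\<And>t. (f has_vector_derivative 0) (at t)"
  shows "f s = f t"
proof -
  obtain c where "\<And>t. f t = c"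
    using assms has_vector_derivative_zero_constant[OF convex_UNIV, of f] by auto
  then show ?thesis by simp
qed

section \<open>Unit speed geodesics of the surface\<close>

context sign
begin

text \<open>With \<open>gsin\<close>, the fundamental solutions of u'' = - \<epsilon> u.\<close>

definition gcos :: "real \<Rightarrow> real" where "gcos = (if \<epsilon> = 1 then cos else cosh)"
definition gsin :: "real \<Rightarrow> real" where "gsin = (if \<epsilon> = 1 then sin else sinh)"

lemma gcos_0 [simp]: "gcos 0 = 1" and gsin_0 [simp]: "gsin 0 = 0"
  by (simp_all add: gcos_def gsin_def)

lemma gcos_derivative: "(gcos has_real_derivative - \<epsilon> * gsin t) (at t)"
  using sign by (auto simp: gcos_def gsin_def intro!: derivative_eq_intros)

lemma gsin_derivative: "(gsin has_real_derivative gcos t) (at t)"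
  by (auto simp: gcos_def gsin_def intro!: derivative_eq_intros)

lemma gcos_gsin: "(gcos t)\<^sup>2 + \<epsilon> * (gsin t)\<^sup>2 = 1"
  using sign by (auto simp: gcos_def gsin_def cosh_square_eq)

lemma gcos_gsin_total:
  assumes "k\<^sup>2 + \<epsilon> * s\<^sup>2 = 1" "\<epsilon> < 0 \<Longrightarrow> k > 0"
  obtains t where "gcos t = k" "gsin t = s"
proof (cases "\<epsilon> = 1")
  case True
  then have "k\<^sup>2 + s\<^sup>2 = 1" using assms(1) by simp
  then obtain t where "k = cos t" "s = sin t" using sincos_total_2pi by blast
  then show thesis using that[of t] True unfolding gcos_def gsin_def by simp
next
  case False
  then have e: "\<epsilon> = -1" using sign by simp
  have "(cosh (arsinh s))\<^sup>2 = k\<^sup>2" using assms(1) e by (simp add: cosh_square_eq)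
  then have "cosh (arsinh s) = k" using assms(2) e by (smt (verit) cosh_real_pos power2_eq_iff_nonneg)
  then show thesis using that[of "arsinh s"] False unfolding gcos_def gsin_def by simp
qed

lemma geodesic_in_surface:
  assumes p: "p \<in> surface \<epsilon>" and a: "form \<epsilon> p a = 0" "form \<epsilon> a a = 1"
  shows "gcos t *\<^sub>R p + gsin t *\<^sub>R a \<in> surface \<epsilon>"
proof -
  let ?g = "gcos t *\<^sub>R p + gsin t *\<^sub>R a"
  have "form \<epsilon> ?g ?g = (gcos t)\<^sup>2 * \<epsilon> + (gsin t)\<^sup>2"
    using surface_form[OF p] a by (simp add: form_linear form_commute[of \<epsilon> a p] power2_eq_square algebra_simps)
  also have "\<dots> = \<epsilon> * ((gcos t)\<^sup>2 + \<epsilon> * (gsin t)\<^sup>2)" by (simp add: algebra_simps)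
  finally have 1: "form \<epsilon> ?g ?g = \<epsilon>" by (simp add: gcos_gsin)
  have "?g $ 3 > 0" if "\<epsilon> < 0"
  proof -
    have e: "\<epsilon> = -1" using that sign by auto
    have pp: "(p$3)\<^sup>2 = 1 + (p$1)\<^sup>2 + (p$2)\<^sup>2" and pos: "p$3 > 0"
      using p e by (auto simp: surface_def form_def power2_eq_square)
    have pa: "p$1 * a$1 + p$2 * a$2 = p$3 * a$3" and aa: "(a$1)\<^sup>2 + (a$2)\<^sup>2 = 1 + (a$3)\<^sup>2"
      using a e by (auto simp: form_def power2_eq_square)
    \<comment> \<open>Cauchy-Schwarz yields \<bar>a$3\<bar> < p$3. Since also \<bar>sinh\<bar> \<le>
      cosh, the geodesic never leaves the upper sheet.\<close>
    have "(p$3 * a$3)\<^sup>2 \<le> ((p$1)\<^sup>2 + (p$2)\<^sup>2) * ((a$1)\<^sup>2 + (a$2)\<^sup>2)"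
      unfolding pa[symmetric] using zero_le_power2[of "p$1 * a$2 - p$2 * a$1"]
      by (simp add: power2_eq_square algebra_simps)
    also have "\<dots> = ((p$3)\<^sup>2 - 1) * (1 + (a$3)\<^sup>2)" using pp aa by simp
    finally have "(a$3)\<^sup>2 < (p$3)\<^sup>2" by (simp add: power_mult_distrib algebra_simps)
    then have "\<bar>a$3\<bar> < p$3" using pos by (metis abs_le_square_iff abs_of_pos not_le)
    moreover have cpos: "gcos t > 0"
    proof -
      have "\<epsilon> \<noteq> 1" using e by simp
      then show ?thesis by (simp add: gcos_def)
    qed
    moreover have "\<bar>gsin t\<bar> \<le> \<bar>gcos t\<bar>"
    proof -
      have "\<epsilon> * y = - y" for y using e by simp
      from gcos_gsin[of t, unfolded this] have "(gsin t)\<^sup>2 \<le> (gcos t)\<^sup>2" by simp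
      then show ?thesis by (simp add: abs_le_square_iff)
    qed
    ultimately have "\<bar>gsin t * a$3\<bar> < gcos t * p$3"
      unfolding abs_mult
      by (intro le_less_trans[OF mult_right_mono mult_strict_left_mono]) auto
    then show ?thesis by simp
  qed
  then show ?thesis using 1 by (simp add: surface_def)
qed

end

text \<open>An isometry and its inverse in the coordinates (p, m), both made constant along the
  fibres of \<open>\<pi>\<close>. This is why the composites equal \<open>\<pi>\<close> instead of
  the identity. \<open>H\<close> serves only to show that the differential of \<open>F\<close> is
  onto, so one derivative is enough for it.\<close>

locale model_isometry = sign +
  fixes F H :: "(real^3) \<times> (real^3) \<Rightarrow> (real^3) \<times> (real^3)"
  assumes CF: "Ck_on 3 \<Omega> F" and CH: "Ck_on 1 \<Omega> H"
    and F_M: "x \<in> \<Omega> \<Longrightarrow> F x \<in> M" and H_M: "x \<in> \<Omega> \<Longrightarrow> H x \<in> M"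
    and FH: "x \<in> \<Omega> \<Longrightarrow> F (H x) = \<pi> x" and HF: "x \<in> \<Omega> \<Longrightarrow> H (F x) = \<pi> x"
    and isometric: "x \<in> \<Omega> \<Longrightarrow> dual_form \<epsilon> (ddir X F x) (ddir Y F x) = dual_form \<epsilon> (ddir X \<pi> x) (ddir Y \<pi> x)"
begin

sublocale equal_induced_metrics \<Omega> F \<pi> "dual_form \<epsilon>"
  by (rule equal_induced_metrics.intro)
    (fact open_\<Omega> CF Ck_on_\<pi> bounded_bilinear_dual_form dual_form_commute isometric)+

lemma F_differentiable: "x \<in> \<Omega> \<Longrightarrow> F differentiable (at x)"
  using Ck_on_differentiable[of "Suc (Suc 0)" \<Omega> F] CF open_\<Omega> by (simp add: eval_nat_numeral)

lemma ddir_F_differentiable: "x \<in> \<Omega> \<Longrightarrow> ddir X F differentiable (at x)"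
  using smoothness(3) by blast

lemma linear_ddir_F: "x \<in> \<Omega> \<Longrightarrow> linear (\<lambda>X. ddir X F x)"
  using has_derivative_linear[OF has_derivative_ddir[OF F_differentiable]] .

lemma F_\<pi>: "x \<in> \<Omega> \<Longrightarrow> F (\<pi> x) = F x"
  using HF[of x] FH[of "F x"] \<pi>_M[OF F_M] M_in_\<Omega>[OF F_M] by simp

lemma ddir_F_tangent: "x \<in> \<Omega> \<Longrightarrow> ddir X F x \<in> T (F x)"
  by (rule ddir_tangent[OF open_\<Omega> _ F_M F_differentiable])

lemma isometric_M: "\<lbrakk>x \<in> M; X \<in> T x; Y \<in> T x\<rbrakk> \<Longrightarrow> dual_form \<epsilon> (ddir X F x) (ddir Y F x) = dual_form \<epsilon> X Y"
  by (simp add: isometric M_in_\<Omega> ddir_\<pi>_M)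

text \<open>The preimage is the derivative of \<open>H\<close> along \<open>Y\<close>:
  \<open>F\<close> after \<open>H\<close> is \<open>\<pi>\<close>, whose differential fixes tangent
  vectors.\<close>

lemma ddir_F_surjective:
  assumes x: "x \<in> M" and Y: "Y \<in> T (F x)"
  obtains Z where "Z \<in> T x" "ddir Z F x = Y"
proof
  let ?y = "F x"
  have x': "x \<in> \<Omega>" and y: "?y \<in> M" and y': "?y \<in> \<Omega>" using x M_in_\<Omega> F_M by auto
  have Hy: "H ?y = x" using HF[OF x'] \<pi>_M[OF x] by simp
  have H: "H differentiable (at ?y)"
    using Ck_on_differentiable[of 0 \<Omega> H] CH open_\<Omega> y' by simp
  show "ddir Y H ?y \<in> T x" using ddir_tangent[OF open_\<Omega> y' H_M H, of Y] Hy by simp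
  have "ddir Y (\<lambda>z. F (H z)) ?y = ddir (ddir Y H ?y) F (H ?y)"
    using F_differentiable x' Hy
    by (intro ddir_eq has_derivative_compose[OF has_derivative_ddir[OF H] has_derivative_ddir]) auto
  moreover have "ddir Y (\<lambda>z. F (H z)) ?y = ddir Y \<pi> ?y"
    by (rule ddir_cong_open[OF open_\<Omega> y' FH])
  ultimately show "ddir (ddir Y H ?y) F x = Y" by (simp add: Hy ddir_\<pi>_M[OF y Y])
qed

text \<open>\<open>F\<close> factors through \<open>\<pi>\<close>, which is constant along
  rays.\<close>

lemma ddir_F_radial: "x \<in> M \<Longrightarrow> ddir x F x = 0"
proof -
  assume x: "x \<in> M"
  have x': "x \<in> \<Omega>" using x by (rule M_in_\<Omega>)
  have DF: "(F has_derivative (\<lambda>v. ddir v F (\<pi> x))) (at (\<pi> x))"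
    using x x' by (simp add: \<pi>_M has_derivative_ddir F_differentiable)
  have "ddir x (\<lambda>y. F (\<pi> y)) x = ddir (ddir x \<pi> x) F (\<pi> x)"
    using ddir_eq[OF has_derivative_compose[OF \<pi>_has_derivative[OF x'] DF]] by (simp add: ddir_\<pi>[OF x'])
  moreover have "ddir x (\<lambda>y. F (\<pi> y)) x = ddir x F x"
    by (rule ddir_cong_open[OF open_\<Omega> M_in_\<Omega>[OF x] F_\<pi>])
  ultimately show ?thesis
    using linear_0[OF linear_ddir_F[OF M_in_\<Omega>[OF x]]] by (simp add: ddir_\<pi>_radial x \<pi>_M)
qed

text \<open>\<open>koszul\<close> and \<open>second_ddir_\<pi>\<close> exclude a tangential part,
  because every tangent vector at \<open>F x\<close> is an image. The two normal coefficients come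
  from differentiating the tangency relations of \<open>ddir Y F\<close>. One is already
  \<open>dual_form X Y\<close>; the other involves the horizontal parts of the images, which are
  still unknown.\<close>

lemma second_ddir_F:
  assumes x: "x \<in> M" and X: "X \<in> T x" and Y: "Y \<in> T x"
  shows "ddir X (ddir Y F) x = - \<epsilon> *\<^sub>R (form \<epsilon> (fst (ddir X F x)) (fst (ddir Y F x)) *\<^sub>R F x
    + dual_form \<epsilon> X Y *\<^sub>R (0, fst (F x)))"
proof -
  let ?V = "ddir X (ddir Y F) x"
  have x': "x \<in> \<Omega>" using x by (rule M_in_\<Omega>)
  have "dual_form \<epsilon> ?V Z = 0" if "Z \<in> T (F x)" for Z
  proof -
    obtain W where W: "W \<in> T x" "ddir W F x = Z" using ddir_F_surjective[OF x \<open>Z \<in> T (F x)\<close>] .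
    have "dual_form \<epsilon> ?V Z = dual_form \<epsilon> (ddir X (ddir Y \<pi>) x) W"
      using koszul[OF x'] W ddir_\<pi>_M[OF x W(1)] by metis
    also have "\<dots> = 0"
    proof -
      have "dual_form \<epsilon> x W = 0" "dual_form \<epsilon> (0, fst x) W = 0"
        using W(1) by (simp_all add: T_iff dual_form_def form_linear form_commute add.commute)
      then show ?thesis
        unfolding second_ddir_\<pi>[OF x Y X] bounded_bilinear.add_left[OF bounded_bilinear_dual_form]
          bounded_bilinear.scaleR_left[OF bounded_bilinear_dual_form] by simp
    qed
    finally show ?thesis .
  qed
  note V = normal_vector[OF F_M[OF x'] this]
  have c: "ddir X (\<lambda>x. 0 :: real) x = 0" by (rule ddir_eq[OF has_derivative_const])
  have D: "(F has_derivative (\<lambda>v. ddir v F x)) (at x)" and DY: "(ddir Y F has_derivative (\<lambda>v. ddir v (ddir Y F) x)) (at x)"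
    by (simp_all add: has_derivative_ddir F_differentiable ddir_F_differentiable x')
  have "ddir X (\<lambda>x. form \<epsilon> (fst (F x)) (fst (ddir Y F x))) x = ddir X (\<lambda>x. 0 :: real) x"
    using ddir_F_tangent by (intro ddir_cong_open[OF open_\<Omega> x']) (auto simp: T_iff)
  then have 1: "form \<epsilon> (fst ?V) (fst (F x)) = - form \<epsilon> (fst (ddir X F x)) (fst (ddir Y F x))"
    using ddir_eq[OF form_has_derivative[OF has_derivative_fst[OF D] has_derivative_fst[OF DY]], of X]
    by (simp add: c form_commute)
  have "ddir X (\<lambda>x. dual_form \<epsilon> (F x) (ddir Y F x)) x = ddir X (\<lambda>x. 0 :: real) x"
    using ddir_F_tangent
    by (intro ddir_cong_open[OF open_\<Omega> x']) (simp add: T_iff dual_form_def add.commute)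
  then have 2: "dual_form \<epsilon> ?V (F x) = - dual_form \<epsilon> X Y"
    using ddir_bilinear[OF bounded_bilinear_dual_form F_differentiable[OF x'] ddir_F_differentiable[OF x'], of X \<epsilon> Y]
      isometric_M[OF x X Y]
    by (simp add: c dual_form_commute)
  show ?thesis using V unfolding 1 2 by (simp add: scaleR_add_right)
qed

lemma dual_form_normal:
  assumes "y \<in> M"
  shows "dual_form \<epsilon> (- \<epsilon> *\<^sub>R (a *\<^sub>R y + b *\<^sub>R (0, fst y))) (- \<epsilon> *\<^sub>R (c *\<^sub>R y + d *\<^sub>R (0, fst y))) = \<epsilon> * (a * d + b * c)"
proof -
  have "form \<epsilon> (fst y) (fst y) = \<epsilon>" "form \<epsilon> (fst y) (snd y) = 0" using assms by (auto simp: M_iff surface_form)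
  then show ?thesis by (simp add: dual_form_def form_linear algebra_simps)
qed

text \<open>The Gauss equations of \<open>F\<close> and \<open>\<pi>\<close> compared: the
  Kulkarni-Nomizu product of \<open>dual_form\<close> with the defect \<open>h\<close> vanishes on
  (X, Y).\<close>

lemma horizontal_form_relation:
  fixes X Y x
  defines "h \<equiv> \<lambda>X Y. form \<epsilon> (fst (ddir X F x)) (fst (ddir Y F x)) - form \<epsilon> (fst X) (fst Y)"
  assumes x: "x \<in> M" and X: "X \<in> T x" and Y: "Y \<in> T x"
  shows "h X X * dual_form \<epsilon> Y Y + dual_form \<epsilon> X X * h Y Y = 2 * dual_form \<epsilon> X Y * h X Y"
proof -
  have "\<epsilon> * (h X X * dual_form \<epsilon> Y Y + dual_form \<epsilon> X X * h Y Y - 2 * dual_form \<epsilon> X Y * h X Y) = 0"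
    using gauss[OF M_in_\<Omega>[OF x], of X Y]
    unfolding second_ddir_F[OF x X X] second_ddir_F[OF x Y Y] second_ddir_F[OF x X Y]
      second_ddir_\<pi>[OF x X X] second_ddir_\<pi>[OF x Y Y] second_ddir_\<pi>[OF x Y X]
      dual_form_normal[OF F_M[OF M_in_\<Omega>[OF x]]] dual_form_normal[OF x]
    by (simp add: h_def algebra_simps form_commute dual_form_commute)
  then show ?thesis by simp
qed

text \<open>For a null \<open>X\<close> and \<open>Y\<close> orthogonal to it, the relation reduces
  to \<open>h X X * dual_form Y Y = 0\<close>. Here \<open>Y\<close> has horizontal and vertical
  part b = J p n, so that \<open>dual_form Y Y\<close> is twice \<open>form \<epsilon> b b\<close>
  and positive. In the applications \<open>n\<close> is the vertical or the horizontal part of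
  \<open>X\<close>, and \<open>b\<close> is orthogonal to it.\<close>

lemma horizontal_form_null:
  assumes x: "x \<in> M" and X: "X \<in> T x" "dual_form \<epsilon> X X = 0"
    and n: "form \<epsilon> (fst x) n = 0" "n \<noteq> 0" "form \<epsilon> n (snd X) = 0 \<or> fst X = 0"
    and orth: "dual_form \<epsilon> X (J (fst x) n, J (fst x) n - (\<epsilon> * form \<epsilon> (J (fst x) n) (snd x)) *\<^sub>R fst x) = 0"
  shows "form \<epsilon> (fst (ddir X F x)) (fst (ddir X F x)) = form \<epsilon> (fst X) (fst X)"
proof -
  define b where "b = J (fst x) n"
  define Y where "Y = (b, b - (\<epsilon> * form \<epsilon> b (snd x)) *\<^sub>R fst x)"
  have p: "form \<epsilon> (fst x) (fst x) = \<epsilon>" "fst x \<in> surface \<epsilon>" using x by (auto simp: M_iff surface_form)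
  have pb: "form \<epsilon> (fst x) b = 0" by (simp add: b_def)
  have Y: "Y \<in> T x" using p pb by (simp add: Y_def T_iff form_linear)
  have "b \<noteq> 0"
  proof
    assume "b = 0"
    then have "J (fst x) b = 0" by (simp add: bounded_bilinear.zero_right[OF bounded_bilinear_complex_structure])
    then show False using J_J[of "fst x" n] n p by (simp add: b_def)
  qed
  then have "form \<epsilon> b b > 0" using form_pos[OF p(2) pb] by simp
  then have "dual_form \<epsilon> Y Y \<noteq> 0" using pb by (simp add: dual_form_def Y_def form_linear form_commute)
  then show ?thesis
    using horizontal_form_relation[OF x X(1) Y] X(2) orth[folded b_def, folded Y_def] by simp
qed

text \<open>Vertical vectors are null with zero horizontal part, so the image has a horizontal part
  of length zero; tangent planes of the surface are definite.\<close>

lemma ddir_F_vertical: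
  assumes x: "x \<in> M" and n: "form \<epsilon> (fst x) n = 0"
  shows "fst (ddir (0, n) F x) = 0"
proof (cases "n = 0")
  case True
  then show ?thesis using linear_0[OF linear_ddir_F[OF M_in_\<Omega>[OF x]]] by (simp add: zero_prod_def)
next
  case False
  have X: "(0, n) \<in> T x" using n by (simp add: T_iff form_linear)
  have "form \<epsilon> (fst (ddir (0, n) F x)) (fst (ddir (0, n) F x)) = 0"
    using horizontal_form_null[OF x X _ n False] by (simp add: dual_form_def form_linear)
  moreover have "fst (F x) \<in> surface \<epsilon>" "form \<epsilon> (fst (F x)) (fst (ddir (0, n) F x)) = 0"
    using F_M ddir_F_tangent M_in_\<Omega>[OF x] by (auto simp: M_iff T_iff)
  ultimately show ?thesis using form_eq_0_surface by blast
qed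

text \<open>Splits \<open>X\<close> into the horizontal lift of \<open>fst X\<close>, which is null,
  and a vertical vector, whose image has no horizontal part.\<close>

lemma ddir_F_horizontal:
  assumes x: "x \<in> M" and X: "X \<in> T x"
  shows "form \<epsilon> (fst (ddir X F x)) (fst (ddir X F x)) = form \<epsilon> (fst X) (fst X)"
proof -
  define a where "a = fst X"
  define k where "k = \<epsilon> * form \<epsilon> a (snd x)"
  let ?X = "(a, - k *\<^sub>R fst x)"
  have p: "form \<epsilon> (fst x) (fst x) = \<epsilon>" using x by (auto simp: M_iff surface_form)
  have a: "form \<epsilon> (fst x) a = 0" using X by (simp add: T_iff a_def)
  have X': "?X \<in> T x" using a p by (simp add: T_iff form_linear k_def)
  have "form \<epsilon> (fst x) (snd X + k *\<^sub>R fst x) = 0"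
    using X p by (simp add: T_iff form_linear k_def a_def mult.commute)
  from ddir_F_vertical[OF x this] have v: "fst (ddir (0, snd X + k *\<^sub>R fst x) F x) = 0" .
  have "X = ?X + (0, snd X + k *\<^sub>R fst x)" by (simp add: prod_eq_iff a_def)
  then have "ddir X F x = ddir ?X F x + ddir (0, snd X + k *\<^sub>R fst x) F x"
    using linear_add[OF linear_ddir_F[OF M_in_\<Omega>[OF x]]] by metis
  then have eq: "fst (ddir X F x) = fst (ddir ?X F x)" using v by simp
  show ?thesis
  proof (cases "a = 0")
    case True
    then show ?thesis unfolding eq using linear_0[OF linear_ddir_F[OF M_in_\<Omega>[OF x]]]
      by (simp add: k_def form_linear a_def zero_prod_def)
  next
    case False
    show ?thesis
      unfolding eq using horizontal_form_null[OF x X' _ a False] a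
      by (simp add: dual_form_def form_linear form_commute a_def[symmetric])
  qed
qed

lemma zero_section: "p \<in> surface \<epsilon> \<Longrightarrow> (p, 0) \<in> M"
  by (simp add: M_iff form_linear)

text \<open>Along a unit speed geodesic of the zero section, \<open>F\<close> satisfies \<open>u'' = -\<epsilon> u\<close>.\<close>

lemma F_geodesic:
  assumes p: "p \<in> surface \<epsilon>" and a: "form \<epsilon> p a = 0" "form \<epsilon> a a = 1"
  shows "F (gcos t *\<^sub>R p + gsin t *\<^sub>R a, 0) = gcos t *\<^sub>R F (p, 0) + gsin t *\<^sub>R ddir (a, 0) F (p, 0)"
proof -
  define c where "c = (\<lambda>t. (gcos t *\<^sub>R p + gsin t *\<^sub>R a, 0 :: real^3))"
  define c' where "c' = (\<lambda>t. (- \<epsilon> * gsin t) *\<^sub>R (p, 0) + gcos t *\<^sub>R (a, 0 :: real^3))"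
  have cM: "c t \<in> M" for t unfolding c_def by (intro zero_section geodesic_in_surface p a)
  have c\<Omega>: "c t \<in> \<Omega>" for t by (rule M_in_\<Omega>[OF cM])
  have c_alt: "c = (\<lambda>t. gcos t *\<^sub>R (p, 0) + gsin t *\<^sub>R (a, 0))" by (simp add: c_def fun_eq_iff)
  have dc: "(c has_vector_derivative c' t) (at t)" for t
    unfolding c_alt c'_def
    by (auto intro!: derivative_eq_intros gcos_derivative gsin_derivative)
  have pp: "form \<epsilon> p p = \<epsilon>" using p by (rule surface_form)
  have c'T: "c' t \<in> T (c t)" for t
    using pp a by (simp add: T_iff c_def c'_def form_linear form_commute[of \<epsilon> a p])
  have c'1: "form \<epsilon> (fst (c' t)) (fst (c' t)) = 1" for t
  proof -
    have "form \<epsilon> (fst (c' t)) (fst (c' t)) = (gcos t)\<^sup>2 + \<epsilon> * (gsin t)\<^sup>2"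
      using pp a by (simp add: c'_def form_linear form_commute[of \<epsilon> a p] power2_eq_square algebra_simps)
    then show ?thesis by (simp add: gcos_gsin)
  qed
  define A where "A = (\<lambda>t. ddir (a, 0) F (c t))"
  define B where "B = (\<lambda>t. ddir (p, 0) F (c t))"
  define u where "u = (\<lambda>t. F (c t))"
  define u' where "u' = (\<lambda>t. gcos t *\<^sub>R A t - (\<epsilon> * gsin t) *\<^sub>R B t)"
  have lin: "ddir (\<alpha> *\<^sub>R X + \<beta> *\<^sub>R Y) F y = \<alpha> *\<^sub>R ddir X F y + \<beta> *\<^sub>R ddir Y F y" if "y \<in> \<Omega>" for \<alpha> \<beta> X Y y
    by (simp add: linear_add[OF linear_ddir_F[OF that]] linear_scale[OF linear_ddir_F[OF that]])
  have u'_eq: "u' t = ddir (c' t) F (c t)" for t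
    unfolding c'_def lin[OF c\<Omega>] by (simp add: u'_def A_def B_def)
  have du: "(u has_vector_derivative u' t) (at t)" for t
    unfolding u_def u'_eq by (intro has_vector_derivative_ddir F_differentiable c\<Omega> dc)
  have dA: "(A has_vector_derivative ddir (c' t) (ddir (a, 0) F) (c t)) (at t)" for t
    unfolding A_def by (intro has_vector_derivative_ddir ddir_F_differentiable c\<Omega> dc)
  have dB: "(B has_vector_derivative ddir (c' t) (ddir (p, 0) F) (c t)) (at t)" for t
    unfolding B_def by (intro has_vector_derivative_ddir ddir_F_differentiable c\<Omega> dc)
  \<comment> \<open>For fixed \<open>t\<close> the velocity \<open>c' t\<close> is a constant
    direction, so \<open>second_ddir_F\<close> applies. Its coefficients are 1, as the speed is
    preserved, and 0, as \<open>c' t\<close> has no second component.\<close>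
  have second: "gcos t *\<^sub>R ddir (c' t) (ddir (a, 0) F) (c t) - (\<epsilon> * gsin t) *\<^sub>R ddir (c' t) (ddir (p, 0) F) (c t)
      = - \<epsilon> *\<^sub>R u t" for t
  proof -
    have d1: "((\<lambda>y. (- \<epsilon> * gsin t) *\<^sub>R ddir (p, 0) F y + gcos t *\<^sub>R ddir (a, 0) F y)
        has_derivative (\<lambda>v. (- \<epsilon> * gsin t) *\<^sub>R ddir v (ddir (p, 0) F) (c t) + gcos t *\<^sub>R ddir v (ddir (a, 0) F) (c t))) (at (c t))"
      by (intro has_derivative_add has_derivative_scaleR_right has_derivative_ddir ddir_F_differentiable c\<Omega>)
    have "ddir (c' t) (ddir (c' t) F) (c t)
        = ddir (c' t) (\<lambda>y. (- \<epsilon> * gsin t) *\<^sub>R ddir (p, 0) F y + gcos t *\<^sub>R ddir (a, 0) F y) (c t)"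
      by (rule ddir_cong_open[OF open_\<Omega> c\<Omega>]) (simp only: c'_def lin)
    also have "\<dots> = gcos t *\<^sub>R ddir (c' t) (ddir (a, 0) F) (c t) - (\<epsilon> * gsin t) *\<^sub>R ddir (c' t) (ddir (p, 0) F) (c t)"
      unfolding ddir_eq[OF d1] by simp
    finally show ?thesis
      using ddir_F_horizontal[OF cM c'T, of t] c'1[of t]
      unfolding second_ddir_F[OF cM c'T c'T] by (simp add: u_def dual_form_def c'_def form_linear zero_prod_def[symmetric])
  qed
  \<comment> \<open>\<open>u'\<close> also differentiates the coefficients of the velocity, which
    adds a multiple of the derivative of \<open>F\<close> in the direction \<open>c t\<close>
    itself; that direction is radial.\<close>
  have radial: "gsin t *\<^sub>R A t + gcos t *\<^sub>R B t = 0" for t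
    using ddir_F_radial[OF cM, of t] lin[OF c\<Omega>, of "gcos t" "(p, 0)" "gsin t" "(a, 0)" t]
    by (simp add: c_alt A_def B_def add.commute)
  have du': "(u' has_vector_derivative - \<epsilon> *\<^sub>R u t) (at t)" for t
  proof -
    have "(u' has_vector_derivative
        (gcos t *\<^sub>R ddir (c' t) (ddir (a, 0) F) (c t) + (- \<epsilon> * gsin t) *\<^sub>R A t)
        - ((\<epsilon> * gsin t) *\<^sub>R ddir (c' t) (ddir (p, 0) F) (c t) + (\<epsilon> * gcos t) *\<^sub>R B t)) (at t)"
      unfolding u'_def
      by (intro has_vector_derivative_diff has_vector_derivative_scaleR dA dB DERIV_cmult gcos_derivative gsin_derivative)
    moreover have "(gcos t *\<^sub>R ddir (c' t) (ddir (a, 0) F) (c t) + (- \<epsilon> * gsin t) *\<^sub>R A t)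
        - ((\<epsilon> * gsin t) *\<^sub>R ddir (c' t) (ddir (p, 0) F) (c t) + (\<epsilon> * gcos t) *\<^sub>R B t)
        = - \<epsilon> *\<^sub>R u t - \<epsilon> *\<^sub>R (gsin t *\<^sub>R A t + gcos t *\<^sub>R B t)"
      unfolding second[of t, symmetric] by (simp add: algebra_simps)
    ultimately show ?thesis by (simp add: radial)
  qed
  \<comment> \<open>Variation of constants: the inverse of the fundamental matrix applied to (u,
    u'). Both entries are constant and hence equal to the initial data.\<close>
  define w1 where "w1 = (\<lambda>t. gcos t *\<^sub>R u t - gsin t *\<^sub>R u' t)"
  define w2 where "w2 = (\<lambda>t. (\<epsilon> * gsin t) *\<^sub>R u t + gcos t *\<^sub>R u' t)"
  have "(w1 has_vector_derivative (gcos t *\<^sub>R u' t + (- \<epsilon> * gsin t) *\<^sub>R u t) - (gsin t *\<^sub>R (- \<epsilon> *\<^sub>R u t) + gcos t *\<^sub>R u' t)) (at t)" for t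
    unfolding w1_def
    by (intro has_vector_derivative_diff has_vector_derivative_scaleR du du' gcos_derivative gsin_derivative)
  then have "(w1 has_vector_derivative 0) (at t)" for t
    by (simp add: algebra_simps)
  from constant_of_vector_derivative_zero[OF this, of t 0] have w1: "w1 t = F (p, 0)"
    by (simp add: w1_def u_def c_def)
  have "(w2 has_vector_derivative ((\<epsilon> * gsin t) *\<^sub>R u' t + (\<epsilon> * gcos t) *\<^sub>R u t) + (gcos t *\<^sub>R (- \<epsilon> *\<^sub>R u t) + (- \<epsilon> * gsin t) *\<^sub>R u' t)) (at t)" for t
    unfolding w2_def
    by (intro has_vector_derivative_add has_vector_derivative_scaleR du du' DERIV_cmult gcos_derivative gsin_derivative)
  then have "(w2 has_vector_derivative 0) (at t)" for t
    by (simp add: algebra_simps)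
  from constant_of_vector_derivative_zero[OF this, of t 0] have w2: "w2 t = ddir (a, 0) F (p, 0)"
    by (simp add: w2_def u'_def A_def c_def)
  have "gcos t *\<^sub>R w1 t + gsin t *\<^sub>R w2 t = ((gcos t)\<^sup>2 + \<epsilon> * (gsin t)\<^sup>2) *\<^sub>R u t"
    by (simp add: w1_def w2_def algebra_simps power2_eq_square)
  then show ?thesis by (simp add: gcos_gsin w1 w2 u_def c_def)
qed

end

section \<open>Linear maps preserving the form\<close>

context sign
begin

definition preserves_form :: "real^3^3 \<Rightarrow> bool" where
  "preserves_form A \<longleftrightarrow> (\<forall>x y. form \<epsilon> (A *v x) (A *v y) = form \<epsilon> x y)"

lemma preserves_formD: "preserves_form A \<Longrightarrow> form \<epsilon> (A *v x) (A *v y) = form \<epsilon> x y"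
  by (simp add: preserves_form_def)

lemma preserves_form_surj:
  assumes "preserves_form A"
  obtains x where "A *v x = y"
proof -
  have "inj ((*v) A)"
  proof (rule injI)
    fix x y assume "A *v x = A *v y"
    then have "form \<epsilon> (x - y) z = 0" for z
      using preserves_formD[OF assms, of x z] preserves_formD[OF assms, of y z] by (simp add: form_linear)
    then have "x - y = 0" by (rule form_nondegenerate)
    then show "x = y" by simp
  qed
  then have "surj ((*v) A)"
    using linear_injective_imp_surjective matrix_vector_mul_linear by blast
  then show thesis using that by (metis surjD)
qed

lemma triple_product_matrix:
  fixes A :: "real^3^3"
  shows "inner (cross3 (A *v x) (A *v y)) (A *v z) = det A * inner (cross3 x y) z"
proof -
  have "inner (cross3 (A *v x) (A *v y)) (A *v z) = inner (transpose A *v cross3 (A *v x) (A *v y)) z"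
    by (metis dot_lmul_matrix transpose_matrix_vector)
  then show ?thesis unfolding cross_matrix_mult by simp
qed

text \<open>Paired with \<open>A *v z\<close>, the left side is a triple product, which
  \<open>A\<close> multiplies by its determinant. Such vectors exhaust the space and the form is
  nondegenerate.\<close>

lemma J_preserves_form:
  assumes A: "preserves_form A"
  shows "J (A *v p) (A *v x) = det A *\<^sub>R (A *v J p x)"
proof -
  have "form \<epsilon> (J (A *v p) (A *v x) - det A *\<^sub>R (A *v J p x)) y = 0" for y
  proof -
    obtain z where z: "y = A *v z" using preserves_form_surj[OF A, of y] by metis
    have "form \<epsilon> (J (A *v p) (A *v x)) y = det A * form \<epsilon> (J p x) z"
      by (simp add: z form_complex_structure triple_product_matrix)
    then show ?thesis by (simp add: z form_linear preserves_formD[OF A])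
  qed
  then have "J (A *v p) (A *v x) - det A *\<^sub>R (A *v J p x) = 0" by (rule form_nondegenerate)
  then show ?thesis by simp
qed

text \<open>By \<open>J_J\<close> the square of \<open>J p\<close> is expressed through the form
  alone and so commutes with \<open>A\<close>, whereas moving \<open>J\<close> past \<open>A\<close>
  twice produces the factor \<open>(det A)\<^sup>2\<close>. Two coordinate vectors suffice for the
  comparison.\<close>

lemma preserves_form_det:
  assumes A: "preserves_form A"
  shows "(det A)\<^sup>2 = 1"
proof -
  let ?p = "axis 1 1 :: real^3" and ?x = "axis 2 1 :: real^3"
  have f: "form \<epsilon> ?p ?p = 1" "form \<epsilon> ?p ?x = 0" by (simp_all add: form_def axis_def)
  have "J (A *v ?p) (J (A *v ?p) (A *v ?x)) = (det A)\<^sup>2 *\<^sub>R (A *v J ?p (J ?p ?x))"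
    by (simp add: J_preserves_form[OF A] power2_eq_square
        bounded_bilinear.scaleR_right[OF bounded_bilinear_complex_structure])
  then have "- \<epsilon> *\<^sub>R (A *v ?x) = (det A)\<^sup>2 *\<^sub>R (- \<epsilon> *\<^sub>R (A *v ?x))"
    by (simp add: J_J f preserves_formD[OF A] matrix_vector_mult_scaleR linear_neg[OF matrix_vector_mul_linear])
  then have "(\<epsilon> * (1 - (det A)\<^sup>2)) *\<^sub>R (A *v ?x) = 0"
    by (simp add: algebra_simps)
  moreover have "A *v ?x \<noteq> 0"
  proof
    assume "A *v ?x = 0"
    then have "form \<epsilon> ?x ?x = 0" using preserves_formD[OF A, of ?x ?x] by (simp add: form_linear)
    then show False by (simp add: form_def axis_def)
  qed
  ultimately show ?thesis by simp
qed

lemma skew_eq_J: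
  assumes K: "linear K" and skew: "\<And>z. form \<epsilon> z (K z) = 0"
  obtains s where "\<And>z. K z = J z s"
proof -
  let ?e = "\<lambda>i. axis i 1 :: real^3"
  define w1 w2 w3 where "w1 = K (?e 1)" and "w2 = K (?e 2)" and "w3 = K (?e 3)"
  note d = w1_def[symmetric] w2_def[symmetric] w3_def[symmetric]
  have s: "w1$1 = 0" "w2$2 = 0" "w3$3 = 0" "w1$2 + w2$1 = 0" "w3$1 + \<epsilon> * w1$3 = 0" "w3$2 + \<epsilon> * w2$3 = 0"
    using skew[of "?e 1"] skew[of "?e 2"] skew[of "?e 3"] skew[of "?e 1 + ?e 2"] skew[of "?e 1 + ?e 3"]
      skew[of "?e 2 + ?e 3"]
    by (simp_all add: linear_add[OF K] d) (simp_all add: form_def axis_def)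
  have eq: "K z = z$1 *\<^sub>R w1 + z$2 *\<^sub>R w2 + z$3 *\<^sub>R w3" for z
  proof -
    have "z = z$1 *\<^sub>R ?e 1 + z$2 *\<^sub>R ?e 2 + z$3 *\<^sub>R ?e 3"
      by (simp add: vec_eq_iff forall_3 axis_def)
    then have "K z = K (z$1 *\<^sub>R ?e 1 + z$2 *\<^sub>R ?e 2 + z$3 *\<^sub>R ?e 3)" by simp
    then show ?thesis by (simp add: linear_add[OF K] linear_scale[OF K] d)
  qed
  have "w3$1 = - (\<epsilon> * w1$3)" "w3$2 = - (\<epsilon> * w2$3)" "w2$1 = - w1$2" using s by linarith+
  \<comment> \<open>The coordinates of \<open>s\<close> are read off from J e1 s = w1 and J e2 s =
    w2.\<close>
  then have "K z = J z (vector [- \<epsilon> * w2$3, \<epsilon> * w1$3, - w1$2])" for z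
    unfolding eq using s(1-3)
    by (simp add: vec_eq_iff forall_3 complex_structure_def cross3_def Let_def algebra_simps)
  then show thesis by (rule that)
qed

lemma J_J_surface: "p \<in> surface \<epsilon> \<Longrightarrow> J p (J p v) = (\<epsilon> * form \<epsilon> p v) *\<^sub>R p - v"
  by (simp add: J_J surface_form algebra_simps)

end

section \<open>Explicit form of an isometry in the coordinates (p, m)\<close>

context model_isometry
begin

definition base :: "real^3" where "base = axis 3 1"

lemma base: "base \<in> surface \<epsilon>" "form \<epsilon> base base = \<epsilon>"
  by (simp_all add: base_def surface_def form_def axis_def)

text \<open>The linear map given by the value of \<open>F\<close> and its derivative at one point.
  As the derivative ignores the radial component of \<open>y\<close>, \<open>L\<close> sends
  \<open>base\<close> to \<open>F (base, 0)\<close> and a tangent vector \<open>a\<close> to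
  \<open>ddir (a, 0) F (base, 0)\<close>.\<close>

definition L :: "real^3 \<Rightarrow> (real^3) \<times> (real^3)" where
  "L y = (\<epsilon> * form \<epsilon> y base) *\<^sub>R F (base, 0) + ddir (y, 0) F (base, 0)"

lemma linear_L: "linear L"
proof -
  have \<Omega>: "(base, 0) \<in> \<Omega>" by (intro M_in_\<Omega> zero_section base)
  show ?thesis
  proof (rule linearI)
    show "L (x + y) = L x + L y" for x y
      using linear_add[OF linear_ddir_F[OF \<Omega>], of "(x, 0)" "(y, 0)"] by (simp add: L_def form_linear algebra_simps)
    show "L (c *\<^sub>R x) = c *\<^sub>R L x" for c x
      using linear_scale[OF linear_ddir_F[OF \<Omega>], of c "(x, 0)"] by (simp add: L_def form_linear algebra_simps)
  qed
qed

text \<open>Every \<open>q\<close> lies on a geodesic issuing from \<open>base\<close>, and along it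
  \<open>F_geodesic\<close> is linear in the starting point and velocity.\<close>

lemma F_zero_section:
  assumes q: "q \<in> surface \<epsilon>"
  shows "F (q, 0) = L q"
proof -
  define k where "k = \<epsilon> * form \<epsilon> q base"
  define b where "b = q - k *\<^sub>R base"
  have kq: "k = q $ 3" by (simp add: k_def base_def form_def axis_def)
  have b: "form \<epsilon> base b = 0" using base(2) by (simp add: b_def k_def form_linear form_commute)
  have bb: "form \<epsilon> b b = \<epsilon> * (1 - k\<^sup>2)"
  proof -
    have "form \<epsilon> q base = \<epsilon> * k" by (simp add: k_def)
    then show ?thesis
      using base(2) surface_form[OF q]
      by (simp add: b_def form_linear form_commute[of \<epsilon> base q] algebra_simps power2_eq_square)
  qed
  have bb0: "form \<epsilon> b b \<ge> 0"
    using form_pos[OF base(1) b] by (cases "b = 0") (auto simp: form_linear)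
  define s where "s = sqrt (form \<epsilon> b b)"
  \<comment> \<open>For \<open>q\<close> equal to \<open>base\<close> or its antipode the direction
    is undetermined and any unit tangent vector serves.\<close>
  define a where "a = (if b = 0 then axis 1 1 else (1 / s) *\<^sub>R b)"
  have s2: "s\<^sup>2 = \<epsilon> * (1 - k\<^sup>2)" using bb bb0 by (simp add: s_def)
  have sb: "b = s *\<^sub>R a" and a: "form \<epsilon> base a = 0" "form \<epsilon> a a = 1"
  proof (atomize (full), cases "b = 0")
    case True
    then show "b = s *\<^sub>R a \<and> form \<epsilon> base a = 0 \<and> form \<epsilon> a a = 1"
      by (simp add: a_def s_def base_def form_def axis_def)
  next
    case False
    have "s > 0" "form \<epsilon> b b = s * s"
      using form_pos[OF base(1) b False] by (simp_all add: s_def)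
    then show "b = s *\<^sub>R a \<and> form \<epsilon> base a = 0 \<and> form \<epsilon> a a = 1"
      using b False by (simp add: a_def form_linear)
  qed
  have "k\<^sup>2 + \<epsilon> * s\<^sup>2 = 1" by (simp add: s2)
  moreover have "\<epsilon> < 0 \<Longrightarrow> k > 0" using q by (simp add: kq surface_def)
  ultimately obtain t where t: "gcos t = k" "gsin t = s" using gcos_gsin_total by metis
  have "q = gcos t *\<^sub>R base + gsin t *\<^sub>R a" using sb by (simp add: t b_def algebra_simps)
  then have "F (q, 0) = gcos t *\<^sub>R F (base, 0) + gsin t *\<^sub>R ddir (a, 0) F (base, 0)"
    using F_geodesic[OF base(1) a, of t] by simp
  also have "\<dots> = k *\<^sub>R L base + s *\<^sub>R L a"
    using ddir_F_radial[OF zero_section[OF base(1)]] a base by (simp add: L_def t form_commute)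
  also have "\<dots> = L (k *\<^sub>R base + s *\<^sub>R a)"
    by (simp add: linear_add[OF linear_L] linear_scale[OF linear_L])
  also have "k *\<^sub>R base + s *\<^sub>R a = q" using sb by (simp add: b_def algebra_simps)
  finally show ?thesis .
qed

definition A :: "real^3 \<Rightarrow> real^3" where "A y = fst (L y)"
definition S :: "real^3 \<Rightarrow> real^3" where "S y = snd (L y)"

lemma linear_A: "linear A" and linear_S: "linear S"
  using linear_compose[OF linear_L linear_fst] linear_compose[OF linear_L linear_snd]
  by (simp_all add: A_def[abs_def] S_def[abs_def] o_def)

lemma fibre_in_M: "(q, m) \<in> M \<Longrightarrow> (q, t *\<^sub>R m) \<in> M"
  by (simp add: M_iff form_linear)

lemma fibre_derivative:
  assumes "(q, m) \<in> M"
  shows "((\<lambda>t. F (q, t *\<^sub>R m)) has_vector_derivative ddir (0, m) F (q, t *\<^sub>R m)) (at t)"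
  by (intro has_vector_derivative_ddir F_differentiable M_in_\<Omega> fibre_in_M assms)
    (auto intro!: derivative_eq_intros)

text \<open>The segment t |-> (q, t m) joins the zero section to \<open>x\<close> inside a fibre,
  where the derivative of \<open>fst\<close> after \<open>F\<close> vanishes by
  \<open>ddir_F_vertical\<close>.\<close>

lemma fst_F:
  assumes x: "x \<in> M"
  shows "fst (F x) = A (fst x)"
proof -
  obtain q m where qm: "x = (q, m)" by (cases x)
  have M: "(q, m) \<in> M" using x qm by simp
  have "((\<lambda>t. fst (F (q, t *\<^sub>R m))) has_vector_derivative 0) (at t)" for t
  proof -
    have "fst (ddir (0, m) F (q, t *\<^sub>R m)) = 0"
      using ddir_F_vertical[OF fibre_in_M[OF M, of t], of m] M by (simp add: M_iff)
    then show ?thesis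
      using bounded_linear.has_vector_derivative[OF bounded_linear_fst fibre_derivative[OF M]] by metis
  qed
  from constant_of_vector_derivative_zero[OF this, of 1 0]
  show ?thesis using M F_zero_section[of q] by (simp add: qm A_def M_iff)
qed

lemma fst_ddir_F:
  assumes x: "x \<in> M" and X: "X \<in> T x"
  shows "fst (ddir X F x) = A (fst X)"
proof -
  have x': "x \<in> \<Omega>" using x by (rule M_in_\<Omega>)
  have "ddir X (\<lambda>x. fst (F x)) x = ddir X (\<lambda>x. A (fst (\<pi> x))) x"
  proof (rule ddir_cong_open[OF open_\<Omega> x'])
    show "fst (F y) = A (fst (\<pi> y))" if "y \<in> \<Omega>" for y
      using fst_F[OF \<pi>_in_M[OF that]] F_\<pi>[OF that] by simp
  qed
  moreover have "ddir X (\<lambda>x. fst (F x)) x = fst (ddir X F x)"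
    by (rule ddir_linear_image[OF bounded_linear_fst F_differentiable[OF x']])
  moreover have "bounded_linear (\<lambda>x::(real^3)\<times>(real^3). A (fst x))"
    unfolding linear_conv_bounded_linear[symmetric]
    by (rule linearI) (simp_all add: linear_add[OF linear_A] linear_scale[OF linear_A])
  then have "ddir X (\<lambda>x. A (fst (\<pi> x))) x = A (fst (ddir X \<pi> x))"
    using \<pi>_has_derivative[OF x'] by (intro ddir_linear_image) (auto simp: differentiable_def)
  ultimately show ?thesis using ddir_\<pi>_M[OF x X] by simp
qed

text \<open>Checked on \<open>base\<close>, whose image lies on the surface, on its complement by
  \<open>ddir_F_horizontal\<close>, and on the mixed term by tangency; then polarised.\<close>

lemma A_form: "form \<epsilon> (A y) (A z) = form \<epsilon> y z"
proof -
  have self: "form \<epsilon> (A y) (A y) = form \<epsilon> y y" for y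
  proof -
    define k where "k = \<epsilon> * form \<epsilon> y base"
    define a where "a = y - k *\<^sub>R base"
    let ?x = "(base, 0 :: real^3)"
    have x: "?x \<in> M" by (intro zero_section base)
    have a: "form \<epsilon> base a = 0" using base(2) by (simp add: a_def k_def form_linear form_commute)
    have X: "(a, 0) \<in> T ?x" using a by (simp add: T_iff form_linear)
    have 1: "form \<epsilon> (A a) (A a) = form \<epsilon> a a"
      using ddir_F_horizontal[OF x X] fst_ddir_F[OF x X] by simp
    have 2: "form \<epsilon> (A base) (A base) = \<epsilon>" "form \<epsilon> (A base) (A a) = 0"
      using F_M[OF M_in_\<Omega>[OF x]] ddir_F_tangent[OF M_in_\<Omega>[OF x], of "(a, 0)"] fst_F[OF x] fst_ddir_F[OF x X]
      by (auto simp: M_iff T_iff surface_form)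
    have "y = a + k *\<^sub>R base" by (simp add: a_def)
    then show ?thesis
      using 1 2 a base(2) form_commute[of \<epsilon> "A a" "A base"] form_commute[of \<epsilon> a base]
      by (simp add: linear_add[OF linear_A] linear_scale[OF linear_A] form_linear)
  qed
  show ?thesis
    using self[of "y + z"] self[of y] self[of z] form_commute[of \<epsilon> "A z" "A y"] form_commute[of \<epsilon> z y]
    by (simp add: linear_add[OF linear_A] form_linear)
qed

lemma A_matrix: "matrix A *v y = A y"
  by (rule matrix_works[OF linear_matrix_vector_mul_eq[THEN iffD2, OF linear_A]])

lemma preserves_form_A: "preserves_form (matrix A)"
  by (simp add: preserves_form_def A_matrix A_form)

lemma decompose_surface:
  assumes "q \<in> surface \<epsilon>"
  obtains k a where "y = k *\<^sub>R q + a" "form \<epsilon> q a = 0"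
proof (rule that)
  show "y = (\<epsilon> * form \<epsilon> q y) *\<^sub>R q + (y - (\<epsilon> * form \<epsilon> q y) *\<^sub>R q)" by simp
  show "form \<epsilon> q (y - (\<epsilon> * form \<epsilon> q y) *\<^sub>R q) = 0" using surface_form[OF assms] by (simp add: form_linear)
qed

text \<open>A vertical vector pairs only with horizontal parts, on which the differential acts as
  \<open>A\<close>. Pairing with horizontal lifts determines the image up to a multiple of
  \<open>A (fst x)\<close>, and tangency excludes that multiple.\<close>

lemma snd_ddir_F_vertical:
  assumes x: "x \<in> M" and n: "form \<epsilon> (fst x) n = 0"
  shows "snd (ddir (0, n) F x) = A n"
proof -
  let ?D = "snd (ddir (0, n) F x)"
  have q: "fst x \<in> surface \<epsilon>" using x by (simp add: M_iff)
  have X: "(0, n) \<in> T x" using n by (simp add: T_iff form_linear)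
  have A0: "A 0 = 0" by (rule linear_0[OF linear_A])
  have "form \<epsilon> (?D - A n) y = 0" for y
  proof -
    obtain z where z: "y = A z" using preserves_form_surj[OF preserves_form_A, of y] A_matrix by metis
    obtain k a where ka: "z = k *\<^sub>R fst x + a" "form \<epsilon> (fst x) a = 0" using decompose_surface[OF q] .
    let ?Y = "(a, (- \<epsilon> * form \<epsilon> a (snd x)) *\<^sub>R fst x)"
    have Y: "?Y \<in> T x" using ka surface_form[OF q] by (simp add: T_iff form_linear)
    have "form \<epsilon> (A a) ?D = form \<epsilon> a n"
      using isometric_M[OF x X Y] fst_ddir_F[OF x X] fst_ddir_F[OF x Y] n
      by (simp add: dual_form_def form_linear A0)
    moreover have "form \<epsilon> (A (fst x)) ?D = 0"
      using ddir_F_tangent[OF M_in_\<Omega>[OF x], of "(0, n)"] fst_F[OF x] fst_ddir_F[OF x X]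
      by (simp add: T_iff A0 form_linear)
    ultimately show ?thesis
      using n form_commute[of \<epsilon> ?D "A a"] form_commute[of \<epsilon> ?D "A (fst x)"] form_commute[of \<epsilon> n a]
        form_commute[of \<epsilon> n "fst x"]
      by (simp add: z ka linear_add[OF linear_A] linear_scale[OF linear_A] form_linear A_form)
  qed
  then have "?D - A n = 0" by (rule form_nondegenerate)
  then show ?thesis by simp
qed

lemma F_eq:
  assumes x: "x \<in> M"
  shows "F x = (A (fst x), A (snd x) + S (fst x))"
proof -
  obtain q m where qm: "x = (q, m)" by (cases x)
  have M: "(q, m) \<in> M" using x qm by simp
  have "((\<lambda>t. snd (F (q, t *\<^sub>R m)) - t *\<^sub>R A m) has_vector_derivative 0) (at t)" for t
  proof -
    have "snd (ddir (0, m) F (q, t *\<^sub>R m)) = A m"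
      using snd_ddir_F_vertical[OF fibre_in_M[OF M, of t], of m] M by (simp add: M_iff)
    then have "((\<lambda>t. snd (F (q, t *\<^sub>R m))) has_vector_derivative A m) (at t)"
      using bounded_linear.has_vector_derivative[OF bounded_linear_snd fibre_derivative[OF M]] by metis
    moreover have "((\<lambda>t. t *\<^sub>R A m) has_vector_derivative A m) (at t)"
      by (auto intro!: derivative_eq_intros)
    ultimately show ?thesis using has_vector_derivative_diff by fastforce
  qed
  from constant_of_vector_derivative_zero[OF this, of 1 0]
  have "snd (F (q, m)) = A m + S q"
    using M F_zero_section[of q] by (simp add: S_def M_iff algebra_simps)
  then show ?thesis using fst_F[OF x] by (simp add: qm prod_eq_iff)
qed

lemma ddir_F_zero_section:
  assumes q: "q \<in> surface \<epsilon>" and a: "form \<epsilon> q a = 0"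
  shows "ddir (a, 0) F (q, 0) = (A a, S a)"
proof -
  have x: "(q, 0) \<in> M" by (rule zero_section[OF q])
  have x': "(q, 0) \<in> \<Omega>" using x by (rule M_in_\<Omega>)
  have X: "(a, 0) \<in> T (q, 0)" using a by (simp add: T_iff form_linear)
  let ?G = "\<lambda>x. (A (fst x), A (snd x) + S (fst x))"
  have "linear ?G"
    by (rule linearI) (simp_all add: linear_add[OF linear_A] linear_scale[OF linear_A] linear_add[OF linear_S]
        linear_scale[OF linear_S] scaleR_add_right)
  then have G: "bounded_linear ?G" by (simp add: linear_conv_bounded_linear)
  have "ddir (a, 0) F (q, 0) = ddir (a, 0) (\<lambda>x. ?G (\<pi> x)) (q, 0)"
  proof (rule ddir_cong_open[OF open_\<Omega> x'])
    show "F y = ?G (\<pi> y)" if "y \<in> \<Omega>" for y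
      using F_eq[OF \<pi>_in_M[OF that]] F_\<pi>[OF that] by simp
  qed
  also have "\<dots> = ?G (ddir (a, 0) \<pi> (q, 0))"
    using \<pi>_has_derivative[OF x'] by (intro ddir_linear_image[OF G]) (auto simp: differentiable_def)
  finally show ?thesis by (simp add: ddir_\<pi>_M[OF x X] linear_0[OF linear_A])
qed

text \<open>The quadratic form vanishes on \<open>base\<close> because \<open>F (base, 0)\<close>
  lies in \<open>M\<close>, on tangent vectors \<open>a\<close> because \<open>(a, 0)\<close> is
  null, and on mixed pairs because the image of \<open>(a, 0)\<close> is tangent.\<close>

lemma A_S_skew: "form \<epsilon> (A y) (S y) = 0"
proof -
  let ?x = "(base, 0 :: real^3)"
  have x: "?x \<in> M" by (intro zero_section base)
  obtain k a where ka: "y = k *\<^sub>R base + a" "form \<epsilon> base a = 0" using decompose_surface[OF base(1)] .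
  have X: "(a, 0) \<in> T ?x" using ka by (simp add: T_iff form_linear)
  have Fx: "F ?x = (A base, S base)" using F_eq[OF x] by (simp add: linear_0[OF linear_A])
  have 1: "form \<epsilon> (A base) (S base) = 0" using F_M[OF M_in_\<Omega>[OF x]] Fx by (simp add: M_iff)
  have 2: "form \<epsilon> (A a) (S a) = 0"
    using isometric_M[OF x X X] ddir_F_zero_section[OF base(1) ka(2)] by (simp add: dual_form_def form_linear)
  have 3: "form \<epsilon> (A a) (S base) + form \<epsilon> (A base) (S a) = 0"
    using ddir_F_tangent[OF M_in_\<Omega>[OF x], of "(a, 0)"] ddir_F_zero_section[OF base(1) ka(2)] Fx by (simp add: T_iff)
  have "form \<epsilon> (A y) (S y) = k\<^sup>2 * form \<epsilon> (A base) (S base) + form \<epsilon> (A a) (S a)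
      + k * (form \<epsilon> (A a) (S base) + form \<epsilon> (A base) (S a))"
    by (simp add: ka linear_add[OF linear_A] linear_scale[OF linear_A] linear_add[OF linear_S]
        linear_scale[OF linear_S] form_linear power2_eq_square algebra_simps)
  then show ?thesis using 1 2 3 by simp
qed

text \<open>\<open>S\<close> composed with the inverse of \<open>A\<close> is skew by
  \<open>A_S_skew\<close>, hence a cross product with a fixed vector \<open>s\<close>, the
  translation.\<close>

lemma classification:
  obtains B s where "preserves_form B" "\<And>q m. (q, m) \<in> M \<Longrightarrow> F (q, m) = (B *v q, B *v m + J (B *v q) s)"
proof -
  have "inj A"
  proof (rule injI)
    fix y z assume "A y = A z"
    then have "form \<epsilon> (y - z) w = 0" for w using A_form[of y w] A_form[of z w] by (simp add: form_linear)
    then have "y - z = 0" by (rule form_nondegenerate)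
    then show "y = z" by simp
  qed
  then obtain A' where A': "linear A'" "A' \<circ> A = id" using linear_injective_left_inverse[OF linear_A] by blast
  then have A'A: "A' (A y) = y" for y by (metis comp_apply id_apply)
  have AA': "A (A' z) = z" for z
    using preserves_form_surj[OF preserves_form_A, of z] A_matrix A'A by metis
  have K: "linear (\<lambda>z. S (A' z))" using linear_compose[OF A'(1) linear_S] by (simp add: o_def)
  obtain s where s: "\<And>z. S (A' z) = J z s"
    using skew_eq_J[OF K] A_S_skew[of "A' _"] by (auto simp: AA')
  show thesis
  proof (rule that[OF preserves_form_A])
    show "F (q, m) = (matrix A *v q, matrix A *v m + J (matrix A *v q) s)" if "(q, m) \<in> M" for q m
      using F_eq[OF that] s[of "A q"] by (simp add: A_matrix A'A)
  qed
qed

end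

section \<open>Isometries and their parameters\<close>

lemma smooth_on_open_imp_Ck_on:
  assumes "open S" "smooth_on S f"
  shows "Ck_on k S f"
proof (rule Ck_on_local)
  fix x assume "x \<in> S"
  then obtain U G where U: "open U" "x \<in> U" "\<And>k. Ck_on k U G" "\<And>y. y \<in> S \<inter> U \<Longrightarrow> G y = f y"
    using assms(2) unfolding smooth_on_def by metis
  have "Ck_on k (S \<inter> U) f"
    by (rule Ck_on_cong[OF _ U(4) Ck_on_subset[OF U(3)]]) (auto simp: assms(1) U(1))
  then show "\<exists>V. open V \<and> x \<in> V \<and> Ck_on k V f"
    using U \<open>x \<in> S\<close> assms(1) by (intro exI[of _ "S \<inter> U"]) auto
qed

lemma smooth_on_UNIV_Ck: "\<lbrakk>\<And>k. Ck_on k UNIV G; \<And>x. x \<in> S \<Longrightarrow> G x = f x\<rbrakk> \<Longrightarrow> smooth_on S f"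
  unfolding smooth_on_def by (intro ballI exI[of _ UNIV] exI[of _ G]) auto

lemma Ck_on_matrix: "open U \<Longrightarrow> Ck_on k U f \<Longrightarrow> Ck_on k U (\<lambda>x. (A :: real^'n^'m) *v f x)"
  by (rule Ck_on_linear_image[OF matrix_vector_mul_bounded_linear])

section \<open>Passage between the tangent bundle and the coordinates (p, m)\<close>

context sign
begin

text \<open>For \<epsilon> = 1 the second component is p x v, the negative of the moment of the line
  through \<open>v\<close> with direction \<open>p\<close>.\<close>

definition moment :: "(real^3) \<times> (real^3) \<Rightarrow> (real^3) \<times> (real^3)" where
  "moment z = (fst z, J (fst z) (snd z))"

definition unmoment :: "(real^3) \<times> (real^3) \<Rightarrow> (real^3) \<times> (real^3)" where
  "unmoment z = (fst z, - J (fst z) (snd z))"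

definition dmoment :: "(real^3) \<times> (real^3) \<Rightarrow> (real^3) \<times> (real^3) \<Rightarrow> (real^3) \<times> (real^3)" where
  "dmoment z X = (fst X, J (fst z) (snd X) + J (fst X) (snd z))"

lemma J_minus: "J p (- v) = - J p v"
  by (rule bounded_bilinear.minus_right[OF bounded_bilinear_complex_structure])

lemma moment_M: "z \<in> M \<Longrightarrow> moment z \<in> M" "z \<in> M \<Longrightarrow> unmoment z \<in> M"
  by (simp_all add: moment_def unmoment_def M_iff form_linear)

lemma moment_unmoment: "z \<in> M \<Longrightarrow> moment (unmoment z) = z" "z \<in> M \<Longrightarrow> unmoment (moment z) = z"
  by (simp_all add: moment_def unmoment_def M_iff J_minus J_J_surface prod_eq_iff)

lemmas Ck_on_J = Ck_on_bilinear[OF bounded_bilinear_complex_structure]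

lemma Ck_on_moment: "open U \<Longrightarrow> Ck_on k U moment"
  unfolding moment_def[abs_def] by (intro Ck_on_Pair Ck_on_J Ck_on_fst_snd)

lemma Ck_on_uminus: "\<lbrakk>open U; Ck_on k U f\<rbrakk> \<Longrightarrow> Ck_on k U (\<lambda>x. - f x)"
  using Ck_on_diff[OF _ Ck_on_const, of U k f 0] by simp

lemma Ck_on_unmoment: "open U \<Longrightarrow> Ck_on k U unmoment"
  unfolding unmoment_def[abs_def] by (intro Ck_on_Pair Ck_on_J Ck_on_fst_snd Ck_on_uminus)

lemma moment_has_derivative: "(moment has_derivative dmoment z) (at z)"
  unfolding moment_def[abs_def] dmoment_def[abs_def]
  by (intro has_derivative_Pair bounded_bilinear.FDERIV[OF bounded_bilinear_complex_structure]
      has_derivative_fst has_derivative_snd has_derivative_ident)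

text \<open>All terms are triple products. The two that contain the base vector \<open>snd z\<close>
  differ by exchanging the horizontal parts of \<open>X\<close> and \<open>Y\<close>, so they
  cancel; the others make up \<open>neutral_metric_eq\<close>.\<close>

lemma dual_form_dmoment:
  assumes "Y \<in> T z"
  shows "dual_form \<epsilon> (dmoment z X) (dmoment z Y) = neutral_metric \<epsilon> z X Y"
proof -
  have f: "form \<epsilon> x (J y w) = inner (cross3 y w) x" for x y w
    using form_complex_structure[of \<epsilon> y w x] by (simp add: form_commute)
  show ?thesis
    unfolding neutral_metric_eq[OF sign_square(1) assms] dual_form_def dmoment_def fst_conv snd_conv form_linear f
    by (simp add: cross3_simps)
qed

text \<open>Conjugation into the coordinates (p, m); the inner \<open>\<pi>\<close> provides an open
  domain.\<close>

definition moment_conj :: "((real^3) \<times> (real^3) \<Rightarrow> (real^3) \<times> (real^3)) \<Rightarrow> (real^3) \<times> (real^3) \<Rightarrow> (real^3) \<times> (real^3)" where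
  "moment_conj f x = moment (f (unmoment (\<pi> x)))"

lemma unmoment_\<pi>_in_M: "x \<in> \<Omega> \<Longrightarrow> unmoment (\<pi> x) \<in> M"
  by (intro moment_M \<pi>_in_M)

lemma Ck_on_unmoment_\<pi>: "Ck_on k \<Omega> (\<lambda>x. unmoment (\<pi> x))"
  by (rule Ck_on_compose[OF open_\<Omega> open_UNIV _ Ck_on_unmoment Ck_on_\<pi>]) auto

lemma Ck_on_moment_conj:
  assumes "smooth_on M f"
  shows "Ck_on k \<Omega> (moment_conj f)"
proof (rule Ck_on_local)
  fix x assume x: "x \<in> \<Omega>"
  let ?g = "\<lambda>x. unmoment (\<pi> x)"
  obtain U G where U: "open U" "?g x \<in> U" "\<And>k. Ck_on k U G" "\<And>y. y \<in> M \<inter> U \<Longrightarrow> G y = f y"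
    using assms unmoment_\<pi>_in_M[OF x] unfolding smooth_on_def by metis
  define V where "V = \<Omega> \<inter> ?g -` U"
  have V: "open V"
    using continuous_open_preimage[OF _ open_\<Omega> U(1)] Ck_on_unmoment_\<pi>[of 0] by (simp add: V_def)
  have "Ck_on k V (\<lambda>x. G (?g x))"
    by (rule Ck_on_compose[OF V U(1) _ U(3) Ck_on_subset[OF Ck_on_unmoment_\<pi>]]) (auto simp: V_def)
  then have "Ck_on k V (\<lambda>x. moment (G (?g x)))"
    by (intro Ck_on_compose[OF V open_UNIV _ Ck_on_moment]) auto
  then have "Ck_on k V (moment_conj f)"
    by (rule Ck_on_cong[OF V, rotated]) (use U(4) unmoment_\<pi>_in_M in \<open>auto simp: V_def moment_conj_def\<close>)
  then show "\<exists>V. open V \<and> x \<in> V \<and> Ck_on k V (moment_conj f)"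
    using V U(2) x by (intro exI[of _ V]) (auto simp: V_def)
qed

lemma moment_conj_isometric:
  assumes f: "f \<in> M \<rightarrow> M" and pm: "preserves_metric (neutral_tangent_bundle \<epsilon>) f" and x: "x \<in> \<Omega>"
  shows "dual_form \<epsilon> (ddir X (moment_conj f) x) (ddir Y (moment_conj f) x) = dual_form \<epsilon> (ddir X \<pi> x) (ddir Y \<pi> x)"
proof -
  let ?g = "\<lambda>x. unmoment (\<pi> x)"
  let ?z = "?g x"
  have z: "?z \<in> M" by (rule unmoment_\<pi>_in_M[OF x])
  obtain D where D: "(f has_derivative D) (at ?z within M)"
    and iso: "\<And>X Y. \<lbrakk>X \<in> T ?z; Y \<in> T ?z\<rbrakk> \<Longrightarrow> neutral_metric \<epsilon> (f ?z) (D X) (D Y) = neutral_metric \<epsilon> ?z X Y"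
    using pm z unfolding preserves_metric_def neutral_tangent_bundle_def by auto
  have gd: "?g differentiable (at x)"
    using Ck_on_differentiable[OF Ck_on_unmoment_\<pi>[of "Suc 0"] open_\<Omega> x] .
  let ?E = "\<lambda>X. ddir X ?g x"
  have g: "(?g has_derivative ?E) (at x)" by (rule has_derivative_ddir[OF gd])
  have ET: "?E X \<in> T ?z" for X by (rule ddir_tangent[OF open_\<Omega> x unmoment_\<pi>_in_M gd])
  \<comment> \<open>\<open>f\<close> has a derivative within \<open>M\<close> only. Composing with
    \<open>?g\<close>, which maps the open set \<open>\<Omega>\<close> into \<open>M\<close>,
    produces an ordinary derivative.\<close>
  have "(f has_derivative D) (at ?z within ?g ` \<Omega>)"
    by (rule has_derivative_subset[OF D]) (use unmoment_\<pi>_in_M in blast)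
  from has_derivative_in_compose[OF has_derivative_at_withinI[OF g] this] have fg: "((\<lambda>x. f (?g x)) has_derivative (\<lambda>X. D (?E X))) (at x)"
    using at_within_open[OF x open_\<Omega>] by simp
  have DT: "D (?E X) \<in> T (f ?z)" for X
  proof -
    have "(\<lambda>x. f (?g x)) differentiable (at x)" using fg by (auto simp: differentiable_def)
    moreover have "f (?g y) \<in> M" if "y \<in> \<Omega>" for y using f unmoment_\<pi>_in_M[OF that] by blast
    ultimately show ?thesis
      using ddir_tangent[OF open_\<Omega> x, of "\<lambda>x. f (?g x)" X] by (simp add: ddir_eq[OF fg])
  qed
  have 1: "ddir X (moment_conj f) x = dmoment (f ?z) (D (?E X))" for X
    unfolding moment_conj_def[abs_def] by (rule ddir_eq[OF has_derivative_compose[OF fg moment_has_derivative]])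
  have 2: "ddir X \<pi> x = dmoment ?z (?E X)" for X
  proof -
    have "ddir X \<pi> x = ddir X (\<lambda>x. moment (?g x)) x"
      by (rule ddir_cong_open[OF open_\<Omega> x]) (simp add: moment_unmoment \<pi>_in_M)
    then show ?thesis using ddir_eq[OF has_derivative_compose[OF g moment_has_derivative]] by simp
  qed
  show ?thesis
    unfolding 1 2 dual_form_dmoment[OF DT] dual_form_dmoment[OF ET] by (rule iso[OF ET ET])
qed

lemma isometry_groupD:
  assumes "f \<in> carrier (isometry_group N)"
  shows "f \<in> extensional (points N)" "bij_betw f (points N) (points N)" "f \<in> points N \<rightarrow> points N"
    "smooth_on (points N) f" "smooth_on (points N) (inv_into (points N) f)" "preserves_metric N f"
  using assms by (auto simp: isometry_group_def Bij_def dest: bij_betwE)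

lemma points_bundle [simp]: "points (neutral_tangent_bundle \<epsilon>) = M"
  by (simp add: neutral_tangent_bundle_def)

lemma moment_conj_model_isometry:
  assumes "f \<in> carrier (isometry_group (neutral_tangent_bundle \<epsilon>))"
  shows "model_isometry \<epsilon> (moment_conj f) (moment_conj (inv_into M f))"
proof -
  note f = isometry_groupD[OF assms, simplified]
  let ?h = "inv_into M f"
  have h: "?h \<in> M \<rightarrow> M" using bij_betw_inv_into[OF f(2)] by (auto dest: bij_betwE)
  have fM: "z \<in> M \<Longrightarrow> f z \<in> M" and hM: "z \<in> M \<Longrightarrow> ?h z \<in> M" for z using f(3) h by auto
  have cM: "moment_conj g x \<in> M" if "g \<in> M \<rightarrow> M" "x \<in> \<Omega>" for g x
    using that unmoment_\<pi>_in_M[OF that(2)] by (auto simp: moment_conj_def intro!: moment_M)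
  have comp: "moment_conj g (moment_conj k x) = \<pi> x" if "k \<in> M \<rightarrow> M" "\<And>z. z \<in> M \<Longrightarrow> g (k z) = z" "x \<in> \<Omega>" for g k x
  proof -
    have z: "unmoment (\<pi> x) \<in> M" "k (unmoment (\<pi> x)) \<in> M" using that unmoment_\<pi>_in_M[OF that(3)] by auto
    then show ?thesis using that \<pi>_in_M[OF that(3)] by (simp add: moment_conj_def \<pi>_M moment_M moment_unmoment)
  qed
  show ?thesis
  proof unfold_locales
    show "Ck_on 3 \<Omega> (moment_conj f)" "Ck_on 1 \<Omega> (moment_conj ?h)" by (intro Ck_on_moment_conj f)+
    fix x assume x: "x \<in> \<Omega>"
    show "moment_conj f x \<in> M" "moment_conj ?h x \<in> M" using cM f(3) h x by auto
    show "moment_conj f (moment_conj ?h x) = \<pi> x"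
      by (rule comp[OF h _ x]) (use f(2) in \<open>simp add: bij_betw_inv_into_right\<close>)
    show "moment_conj ?h (moment_conj f x) = \<pi> x"
      by (rule comp[OF f(3) _ x]) (use f(2) in \<open>simp add: bij_betw_inv_into_left\<close>)
    show "dual_form \<epsilon> (ddir X (moment_conj f) x) (ddir Y (moment_conj f) x) = dual_form \<epsilon> (ddir X \<pi> x) (ddir Y \<pi> x)" for X Y
      by (rule moment_conj_isometric[OF f(3,6) x])
  qed
qed

text \<open>For det A = 1 this is the motion x |-> A x + s acting on the line through
  \<open>v\<close> with direction \<open>p\<close>: the component of \<open>s\<close> along the new
  direction is removed. The factor \<open>det A\<close> is what conjugation by \<open>J\<close>
  leaves when \<open>A\<close> reverses orientation.\<close>

definition bundle_action :: "(real^3^3) \<times> (real^3) \<Rightarrow> (real^3) \<times> (real^3) \<Rightarrow> (real^3) \<times> (real^3)" where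
  "bundle_action = (\<lambda>(A, s) z. (A *v fst z,
     det A *\<^sub>R (A *v snd z) + s - (\<epsilon> * form \<epsilon> (A *v fst z) s) *\<^sub>R (A *v fst z)))"

lemma bundle_isometry_classification:
  assumes "f \<in> carrier (isometry_group (neutral_tangent_bundle \<epsilon>))"
  obtains A s where "preserves_form A" "\<And>p. p \<in> surface \<epsilon> \<Longrightarrow> A *v p \<in> surface \<epsilon>"
    "\<And>z. z \<in> M \<Longrightarrow> f z = bundle_action (A, s) z"
proof -
  interpret model_isometry \<epsilon> "moment_conj f" "moment_conj (inv_into M f)" by (rule moment_conj_model_isometry[OF assms])
  note f = isometry_groupD[OF assms, simplified]
  obtain B s where B: "preserves_form B"
    and eq: "\<And>q m. (q, m) \<in> M \<Longrightarrow> moment_conj f (q, m) = (B *v q, B *v m + J (B *v q) s)"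
    using classification by metis
  have eq': "f (p, v) = bundle_action (B, s) (p, v)" and Bp: "B *v p \<in> surface \<epsilon>" if z: "(p, v) \<in> M" for p v
  proof -
    have fz: "f (p, v) \<in> M" using f(3) z by auto
    have m: "moment (p, v) = (p, J p v)" by (simp add: moment_def)
    have "moment_conj f (moment (p, v)) = moment (f (p, v))"
      using z by (simp add: moment_conj_def \<pi>_M moment_M moment_unmoment)
    moreover have "moment_conj f (moment (p, v)) = (B *v p, B *v J p v + J (B *v p) s)"
      using eq moment_M(1)[OF z] m by simp
    ultimately have e: "moment (f (p, v)) = (B *v p, B *v J p v + J (B *v p) s)" by simp
    have Bs: "B *v p \<in> surface \<epsilon>" using moment_M(1)[OF fz] e by (simp add: M_iff)
    then show "B *v p \<in> surface \<epsilon>" .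
    have "f (p, v) = unmoment (moment (f (p, v)))" using fz by (simp add: moment_unmoment)
    also have "\<dots> = (B *v p, - (J (B *v p) (B *v J p v) + J (B *v p) (J (B *v p) s)))"
      by (simp add: e unmoment_def bounded_bilinear.add_right[OF bounded_bilinear_complex_structure])
    \<comment> \<open>Moving \<open>J\<close> past \<open>B\<close> costs \<open>det B\<close>, and
      applying \<open>J\<close> twice to a tangent vector gives -1.\<close>
    also have "J (B *v p) (B *v J p v) = - det B *\<^sub>R (B *v v)"
      using z by (simp add: J_preserves_form[OF B] J_J_surface M_iff linear_neg[OF matrix_vector_mul_linear])
    finally show "f (p, v) = bundle_action (B, s) (p, v)"
      by (simp add: bundle_action_def J_J_surface[OF Bs])
  qed
  show thesis
  proof (rule that[OF B])
    show "B *v p \<in> surface \<epsilon>" if "p \<in> surface \<epsilon>" for p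
      using Bp[OF zero_section[OF that]] .
    show "f z = bundle_action (B, s) z" if "z \<in> M" for z
      using eq'[of "fst z" "snd z"] that by simp
  qed
qed

section \<open>Isometries of the flat space\<close>

lemma points_flat [simp]: "points (flat_space \<epsilon>) = UNIV"
  by (simp add: flat_space_def)

definition affine_action :: "(real^3^3) \<times> (real^3) \<Rightarrow> real^3 \<Rightarrow> real^3" where
  "affine_action = (\<lambda>(A, s) x. A *v x + s)"

lemma flat_isometry_classification:
  assumes "f \<in> carrier (isometry_group (flat_space \<epsilon>))"
  obtains A s where "preserves_form A" "f = affine_action (A, s)"
proof -
  note f = isometry_groupD[OF assms, simplified]
  have C: "Ck_on k UNIV f" for k by (rule smooth_on_open_imp_Ck_on[OF open_UNIV f(4)])
  have fd: "f differentiable (at x)" for x using Ck_on_differentiable[OF C[of "Suc 0"]] by auto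
  have fdd: "ddir Y f differentiable (at x)" for x Y
    using Ck_on_differentiable[OF Ck_on_ddir[OF C[of "Suc (Suc 0)"]]] by auto
  have id: "ddir X (\<lambda>x. x) x = X" for X x :: "real^3" by (rule ddir_eq[OF has_derivative_ident])
  have iso: "form \<epsilon> (ddir X f x) (ddir Y f x) = form \<epsilon> X Y" for X Y x
  proof -
    obtain D where D: "(f has_derivative D) (at x)" "\<And>X Y. form \<epsilon> (D X) (D Y) = form \<epsilon> X Y"
      using f(6) unfolding preserves_metric_def flat_space_def by simp blast
    then show ?thesis by (simp add: ddir_eq[OF D(1)])
  qed
  interpret equal_induced_metrics UNIV f "\<lambda>x. x" "form \<epsilon>"
    by (rule equal_induced_metrics.intro)
      (auto simp: C id iso bounded_bilinear_form form_commute intro!: Ck_on_bounded_linear)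
  have lin: "linear (\<lambda>X. ddir X f x)" for x
    by (rule has_derivative_linear[OF has_derivative_ddir[OF fd]])
  define A where "A = (\<lambda>x. matrix (\<lambda>X. ddir X f x))"
  have Av: "A x *v X = ddir X f x" for x X
    unfolding A_def by (rule matrix_works[OF linear_matrix_vector_mul_eq[THEN iffD2, OF lin]])
  have A: "preserves_form (A x)" for x by (simp add: preserves_form_def Av iso)
  \<comment> \<open>The reference map is the identity, with vanishing second derivatives. By
    \<open>koszul\<close> those of \<open>f\<close> are orthogonal to the image of its differential,
    which is the whole space.\<close>
  have zero: "ddir X (ddir Y f) x = 0" for X Y x
  proof (rule form_nondegenerate)
    fix y
    obtain Z where Z: "y = ddir Z f x" using preserves_form_surj[OF A] Av by metis
    have "ddir X (ddir Y (\<lambda>x. x)) x = ddir X (\<lambda>x. Y) x"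
      by (simp add: id[abs_def])
    also have "\<dots> = 0" by (rule ddir_eq[OF has_derivative_const])
    finally show "form \<epsilon> (ddir X (ddir Y f) x) y = 0"
      using koszul[of x X Y Z] by (simp add: Z form_linear)
  qed
  have const: "ddir Y f x = ddir Y f 0" for x Y
  proof -
    have "(ddir Y f has_derivative (\<lambda>h. 0)) (at x)" for x
      using has_derivative_ddir[OF fdd, of Y x] by (simp add: zero)
    then obtain c where "\<And>x. ddir Y f x = c"
      using has_derivative_zero_constant[OF convex_UNIV, of "ddir Y f"] by auto
    then show ?thesis by simp
  qed
  have "((\<lambda>x. f x - A 0 *v x) has_derivative (\<lambda>h. 0)) (at x)" for x
  proof -
    have "((\<lambda>x. f x - A 0 *v x) has_derivative (\<lambda>h. ddir h f x - A 0 *v h)) (at x)"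
      by (intro has_derivative_diff has_derivative_ddir fd bounded_linear_imp_has_derivative matrix_vector_mul_bounded_linear)
    moreover have "ddir h f x - A 0 *v h = 0" for h using const[of h x] by (simp add: Av)
    ultimately show ?thesis by simp
  qed
  then obtain s where "\<And>x. f x - A 0 *v x = s"
    using has_derivative_zero_constant[OF convex_UNIV, of "\<lambda>x. f x - A 0 *v x"] by auto
  then have "f x = A 0 *v x + s" for x by (metis add.commute diff_add_cancel)
  then show thesis using that[OF A[of 0], of s] by (simp add: affine_action_def fun_eq_iff)
qed

text \<open>SO(3), respectively the proper orthochronous Lorentz group; the entry condition keeps
  the upper sheet of the hyperboloid in place.\<close>

definition rotation :: "real^3^3 \<Rightarrow> bool" where
  "rotation A \<longleftrightarrow> preserves_form A \<and> det A = 1 \<and> (\<epsilon> < 0 \<longrightarrow> A$3$3 > 0)"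

text \<open>In the Lorentzian case the third coordinate of \<open>A *v p\<close> is minus the
  product of \<open>p\<close> with the preimage \<open>w\<close> of the third axis. Both are
  timelike with positive third coordinate, so the reversed Cauchy-Schwarz inequality gives the
  sign.\<close>

lemma rotation_surface:
  assumes A: "rotation A" and p: "p \<in> surface \<epsilon>"
  shows "A *v p \<in> surface \<epsilon>"
proof -
  have "(A *v p) $ 3 > 0" if "\<epsilon> < 0"
  proof -
    have e: "\<epsilon> = -1" using that sign by auto
    have A33: "A$3$3 > 0" using A that by (simp add: rotation_def)
    have ps: "form \<epsilon> (A *v x) (A *v y) = form \<epsilon> x y" for x y using A by (simp add: rotation_def preserves_form_def)
    obtain w where w: "A *v w = axis 3 1" using A preserves_form_surj by (auto simp: rotation_def)
    have col: "(A *v axis 3 1) $ 3 = A$3$3" by (simp add: matrix_vector_mult_basis column_def)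
    have w3: "w $ 3 = A$3$3"
      using ps[of w "axis 3 1"] e col unfolding w by (simp add: form_def axis_def)
    have "(A *v p) $ 3 = w$3 * p$3 - (w$1 * p$1 + w$2 * p$2)"
      using ps[of w p] e unfolding w by (simp add: form_def axis_def)
    moreover have "\<bar>w$1 * p$1 + w$2 * p$2\<bar> < w$3 * p$3"
    proof (rule power2_less_imp_less)
      have ww: "(w$1)\<^sup>2 + (w$2)\<^sup>2 = (w$3)\<^sup>2 - 1"
        using ps[of w w] e unfolding w by (simp add: form_def axis_def power2_eq_square)
      have pp: "(p$1)\<^sup>2 + (p$2)\<^sup>2 = (p$3)\<^sup>2 - 1" and p3: "p$3 > 0"
        using p e by (auto simp: surface_def form_def power2_eq_square)
      have "(w$1 * p$1 + w$2 * p$2)\<^sup>2 \<le> ((w$1)\<^sup>2 + (w$2)\<^sup>2) * ((p$1)\<^sup>2 + (p$2)\<^sup>2)"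
        using zero_le_power2[of "w$1 * p$2 - w$2 * p$1"] by (simp add: power2_eq_square algebra_simps)
      also have "\<dots> = ((w$3)\<^sup>2 - 1) * ((p$3)\<^sup>2 - 1)" by (simp only: ww pp)
      also have "\<dots> < (w$3 * p$3)\<^sup>2"
      proof -
        have "(w$3)\<^sup>2 \<ge> 1" "(p$3)\<^sup>2 \<ge> 1"
          using ww pp zero_le_power2[of "w$1"] zero_le_power2[of "w$2"] zero_le_power2[of "p$1"] zero_le_power2[of "p$2"]
          by linarith+
        then show ?thesis by (simp add: power_mult_distrib algebra_simps)
      qed
      finally show "\<bar>w$1 * p$1 + w$2 * p$2\<bar>\<^sup>2 < (w$3 * p$3)\<^sup>2" by simp
      show "0 \<le> w$3 * p$3" using w3 A33 p3 by simp
    qed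
    ultimately show ?thesis by linarith
  qed
  then show ?thesis using A p by (auto simp: surface_def rotation_def preserves_form_def)
qed

lemma rotation_inverse:
  assumes A: "rotation A"
  obtains B where "rotation B" "A ** B = mat 1" "B ** A = mat 1"
proof -
  have ps: "form \<epsilon> (A *v x) (A *v y) = form \<epsilon> x y" for x y using A by (simp add: rotation_def preserves_form_def)
  have "invertible A" using A invertible_det_nz[of A] by (simp add: rotation_def)
  then obtain B where B: "A ** B = mat 1" "B ** A = mat 1" by (auto simp: invertible_def)
  have ABv: "A *v (B *v x) = x" for x by (simp add: matrix_vector_mul_assoc B)
  have "preserves_form B" using ps[of "B *v _" "B *v _"] by (simp add: preserves_form_def ABv)
  moreover have "det B = 1" using B(1) A det_mul[of A B] by (simp add: rotation_def)
  \<comment> \<open>Pairing the third axis with its images under \<open>A\<close> and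
    \<open>B\<close> shows that the two matrices share this entry.\<close>
  moreover have "B$3$3 > 0" if "\<epsilon> < 0"
  proof -
    have "(C *v axis 3 1) $ 3 = C$3$3" for C :: "real^3^3" by (simp add: matrix_vector_mult_basis column_def)
    then show ?thesis
      using ps[of "B *v axis 3 1" "axis 3 1"] A that unfolding ABv by (simp add: form_def axis_def[of 3] rotation_def)
  qed
  ultimately have "rotation B" by (simp add: rotation_def)
  then show thesis using that B by blast
qed

section \<open>Motions acting isometrically on the bundle and on the flat space\<close>

lemma preserves_form_mult: "\<lbrakk>preserves_form A; preserves_form B\<rbrakk> \<Longrightarrow> preserves_form (A ** B)"
  by (simp add: preserves_form_def matrix_vector_mul_assoc[symmetric])

text \<open>\<open>A\<close> carries the projection of \<open>t\<close> off
  \<open>B *v fst z\<close> to the projection of \<open>A *v t\<close> off the image direction. The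
  resulting law is that of \<open>affine_action_compose\<close>, which makes matching parameters
  multiplicative.\<close>

lemma bundle_action_compose:
  assumes "rotation A" "det B = 1"
  shows "bundle_action (A, s) (bundle_action (B, t) z) = bundle_action (A ** B, A *v t + s) z"
  using assms
  by (simp add: bundle_action_def rotation_def preserves_formD det_mul matrix_vector_mul_assoc[symmetric]
      form_linear matrix_vector_right_distrib matrix_vector_mult_diff_distrib matrix_vector_mult_scaleR algebra_simps)

lemma affine_action_compose: "affine_action (A, s) (affine_action (B, t) x) = affine_action (A ** B, A *v t + s) x"
  by (simp add: affine_action_def matrix_vector_mul_assoc[symmetric] matrix_vector_right_distrib)

lemma bundle_action_M:
  assumes A: "rotation A" and z: "z \<in> M"
  shows "bundle_action (A, s) z \<in> M"
proof -
  have p: "A *v fst z \<in> surface \<epsilon>" using rotation_surface[OF A] z by (simp add: M_iff)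
  then show ?thesis
    using z surface_form[OF p] A by (simp add: M_iff bundle_action_def form_linear rotation_def preserves_formD)
qed

lemma bundle_action_inverse:
  assumes "rotation A" "rotation B" "B ** A = mat 1"
  shows "bundle_action (B, - (B *v s)) (bundle_action (A, s) z) = z"
  using assms(2,3) bundle_action_compose[OF assms(2), of A "- (B *v s)" s z] assms(1)
  by (simp add: rotation_def bundle_action_def form_linear)

lemma Ck_on_bundle_action: "Ck_on k UNIV (bundle_action (A, s))"
  unfolding bundle_action_def prod.case
  by (intro Ck_on_Pair Ck_on_diff Ck_on_add Ck_on_scaleR Ck_on_mult Ck_on_form Ck_on_const Ck_on_matrix
      Ck_on_fst_snd open_UNIV)

lemma bundle_action_isometry:
  assumes A: "rotation A"
  shows "restrict (bundle_action (A, s)) M \<in> carrier (isometry_group (neutral_tangent_bundle \<epsilon>))"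
proof -
  obtain B where B: "rotation B" "A ** B = mat 1" "B ** A = mat 1" using rotation_inverse[OF A] .
  let ?f = "restrict (bundle_action (A, s)) M"
  let ?g = "bundle_action (B, - (B *v s))"
  have gf: "?g (bundle_action (A, s) z) = z" for z by (rule bundle_action_inverse[OF A B(1,3)])
  have fg: "bundle_action (A, s) (?g z) = z" for z
  proof -
    have "- (A *v (- (B *v s))) = s"
      using B by (simp add: linear_neg[OF matrix_vector_mul_linear] matrix_vector_mul_assoc)
    then show ?thesis using bundle_action_inverse[OF B(1) A B(2), of "- (B *v s)" z] by simp
  qed
  have bij: "bij_betw ?f M M"
    by (rule bij_betw_byWitness[where f' = ?g]) (auto simp: gf fg bundle_action_M A B)
  then have "?f \<in> Bij M" by (simp add: Bij_def)
  moreover have "smooth_on M ?f"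
    by (rule smooth_on_UNIV_Ck[OF Ck_on_bundle_action]) simp
  moreover have "smooth_on M (inv_into M ?f)"
  proof (rule smooth_on_UNIV_Ck[OF Ck_on_bundle_action])
    fix z assume z: "z \<in> M"
    have "?g z \<in> M" "?f (?g z) = z" using z bundle_action_M[OF B(1)] fg by auto
    then show "?g z = inv_into M ?f z" using bij by (metis bij_betw_imp_inj_on inv_into_f_f)
  qed
  moreover have "preserves_metric (neutral_tangent_bundle \<epsilon>) ?f"
    unfolding preserves_metric_def neutral_tangent_bundle_def pseudo_riemannian.simps
  proof
    fix z assume z: "z \<in> M"
    define D where "D = (\<lambda>X. (A *v fst X, A *v snd X
      - (\<epsilon> * form \<epsilon> (A *v fst z) s) *\<^sub>R (A *v fst X) - (\<epsilon> * form \<epsilon> (A *v fst X) s) *\<^sub>R (A *v fst z)))"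
    have det: "det A = 1" and ps: "preserves_form A" using A by (auto simp: rotation_def)
    have dA: "((\<lambda>z. A *v h z) has_derivative (\<lambda>X. A *v h' X)) F" if "(h has_derivative h') F"
      for h h' and F :: "((real^3)\<times>(real^3)) filter"
      by (rule bounded_linear.has_derivative[OF matrix_vector_mul_bounded_linear that])
    have "(bundle_action (A, s) has_derivative D) (at z)"
      unfolding bundle_action_def D_def prod.case det
      by (rule derivative_eq_intros dA refl)+ (simp add: form_linear fun_eq_iff algebra_simps)
    then have "(?f has_derivative D) (at z within M)"
      by (intro has_derivative_transform[OF z _ has_derivative_at_withinI]) auto
    moreover have "neutral_metric \<epsilon> (?f z) (D X) (D Y) = neutral_metric \<epsilon> z X Y" if X: "X \<in> T z" and Y: "Y \<in> T z" for X Y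
    proof -
      have p: "form \<epsilon> (A *v fst z) (A *v fst z) = \<epsilon>" using z preserves_formD[OF ps] by (simp add: M_iff surface_form)
      have DY: "D Y \<in> T (bundle_action (A, s) z)"
        using Y p by (simp add: T_iff D_def bundle_action_def det form_linear preserves_formD[OF ps] form_commute[of \<epsilon> "fst Y" "fst z"] algebra_simps)
      have tr: "inner (A *v a) (cross3 (A *v b) (A *v c)) = inner a (cross3 b c)" for a b c
        using triple_product_matrix[of A b c a] det by (simp add: inner_commute)
      \<comment> \<open>Corrections along \<open>A *v fst z\<close> drop out of a triple product
        with that vector. The multiples of \<open>A *v fst X\<close> and \<open>A *v fst Y\<close>
        have the same coefficient and cancel by skew symmetry.\<close>
      have "neutral_metric \<epsilon> (bundle_action (A, s) z) (D X) (D Y) = neutral_metric \<epsilon> z X Y"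
        unfolding neutral_metric_eq[OF sign_square(1) DY] neutral_metric_eq[OF sign_square(1) Y]
        using cross_skew[of "A *v fst X" "A *v fst Y"]
        by (simp add: D_def bundle_action_def Cross3.left_diff_distrib cross_mult_left inner_diff_right inner_add_right dot_cross_self tr)
      then show ?thesis using z by simp
    qed
    ultimately show "\<exists>D. (?f has_derivative D) (at z within M) \<and>
        (\<forall>X\<in>T z. \<forall>Y\<in>T z. neutral_metric \<epsilon> (?f z) (D X) (D Y) = neutral_metric \<epsilon> z X Y)" by blast
  qed
  ultimately show ?thesis by (simp add: isometry_group_def)
qed

lemma Ck_on_affine_action: "Ck_on k UNIV (affine_action (A, s))"
  unfolding affine_action_def prod.case
  by (intro Ck_on_add Ck_on_const Ck_on_bounded_linear matrix_vector_mul_bounded_linear open_UNIV)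

lemma affine_action_isometry:
  assumes A: "rotation A"
  shows "affine_action (A, s) \<in> carrier (isometry_group (flat_space \<epsilon>))"
proof -
  obtain B where B: "rotation B" "A ** B = mat 1" "B ** A = mat 1" using rotation_inverse[OF A] .
  let ?f = "affine_action (A, s)"
  let ?g = "affine_action (B, - (B *v s))"
  have gf: "?g (?f x) = x" and fg: "?f (?g x) = x" for x
    using B by (simp_all add: affine_action_def matrix_vector_right_distrib matrix_vector_mul_assoc
        linear_neg[OF matrix_vector_mul_linear] linear_diff[OF matrix_vector_mul_linear])
  have bij: "bij ?f" by (rule bij_betw_byWitness[where f' = ?g]) (auto simp: gf fg)
  have "inv_into UNIV ?f = ?g" using gf fg by (intro inv_equality) auto
  then have "smooth_on UNIV ?f" "smooth_on UNIV (inv_into UNIV ?f)"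
    by (auto intro!: smooth_on_UNIV_Ck[OF Ck_on_affine_action])
  moreover have "preserves_metric (flat_space \<epsilon>) ?f"
    unfolding preserves_metric_def flat_space_def pseudo_riemannian.simps
  proof
    fix x
    have "(?f has_derivative (*v) A) (at x)"
      unfolding affine_action_def prod.case
      by (rule derivative_eq_intros bounded_linear_imp_has_derivative matrix_vector_mul_bounded_linear refl | simp)+
    then show "\<exists>D. (?f has_derivative D) (at x) \<and> (\<forall>X\<in>UNIV. \<forall>Y\<in>UNIV. form \<epsilon> (D X) (D Y) = form \<epsilon> X Y)"
      using A by (auto simp: rotation_def preserves_form_def)
  qed
  ultimately show ?thesis using bij by (simp add: isometry_group_def Bij_def)
qed

end

section \<open>The compact-open topology and the identity component\<close>

lemma topspace_compact_open: "topspace (compact_open_topology S F) = F"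
proof -
  \<comment> \<open>The empty compact set contributes \<open>F\<close> itself to the
    subbasis.\<close>
  have "F \<in> {{f \<in> F. f ` K \<subseteq> U} |K U. compact K \<and> K \<subseteq> S \<and> open U}"
    by (intro CollectI exI[of _ "{}"]) auto
  then show ?thesis unfolding compact_open_topology_def topology_generated_by_topspace by blast
qed

lemma continuous_map_evaluation:
  assumes "x \<in> S"
  shows "continuous_map (compact_open_topology S F) euclidean (\<lambda>f. f x)"
  unfolding continuous_map_def topspace_compact_open
proof (intro conjI allI impI)
  fix U :: "'a set" assume "openin euclidean U"
  then have "{f \<in> F. f ` {x} \<subseteq> U} \<in> {{f \<in> F. f ` K \<subseteq> U} |K U. compact K \<and> K \<subseteq> S \<and> open U}"
    using assms by - (rule CollectI, rule exI[of _ "{x}"], rule exI[of _ U], simp)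
  from topology_generated_by_Basis[OF this]
  show "openin (compact_open_topology S F) {f \<in> F. f x \<in> U}"
    by (simp add: compact_open_topology_def)
qed simp

text \<open>Joint continuity of the action makes each subbasic set the preimage of an open set of
  parameters; the other inclusion is the continuity of \<open>\<Phi>\<close>.\<close>

lemma compact_open_eq_pullback:
  fixes act :: "'p::topological_space \<Rightarrow> 'a::topological_space \<Rightarrow> 'a"
  assumes rep: "\<And>f x. \<lbrakk>f \<in> F; x \<in> S\<rbrakk> \<Longrightarrow> f x = act (\<Phi> f) x"
    and cont: "continuous_on UNIV (\<lambda>(p, x). act p x)"
    and \<Phi>: "continuous_map (compact_open_topology S F) euclidean \<Phi>"
  shows "compact_open_topology S F = pullback_topology F \<Phi> euclidean"
  unfolding topology_eq
proof (intro allI iffI)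
  let ?B = "{{f \<in> F. f ` K \<subseteq> U} |K U. compact K \<and> K \<subseteq> S \<and> open U}"
  fix V assume "openin (compact_open_topology S F) V"
  then have gen: "generate_topology_on ?B V"
    by (simp add: compact_open_topology_def openin_topology_generated_by_iff)
  show "openin (pullback_topology F \<Phi> euclidean) V"
  proof (rule generate_topology_on_coarsest[OF _ _ gen])
    fix W assume "W \<in> ?B"
    then obtain K U where K: "compact K" "K \<subseteq> S" "open U" "W = {f \<in> F. f ` K \<subseteq> U}" by blast
    let ?P = "{p. \<forall>x\<in>K. act p x \<in> U}"
    have "open ?P"
    \<comment> \<open>Tube lemma: the open preimage of \<open>U\<close> contains the slice over
      \<open>p\<close> along the compact set \<open>K\<close>, hence a product neighbourhood of
      it.\<close>
    proof (subst open_subopen, intro ballI)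
      fix p assume p: "p \<in> ?P"
      have "open ((\<lambda>(p, x). act p x) -` U)" by (rule open_vimage[OF K(3) cont])
      then have "\<exists>A B. openin euclidean A \<and> openin euclidean B \<and> p \<in> A \<and> K \<subseteq> B \<and> A \<times> B \<subseteq> (\<lambda>(p, x). act p x) -` U"
        using p K(1) by (intro tube_lemma_right) auto
      then obtain A B where "open A" "p \<in> A" "K \<subseteq> B" "A \<times> B \<subseteq> (\<lambda>(p, x). act p x) -` U" by auto
      then show "\<exists>T. open T \<and> p \<in> T \<and> T \<subseteq> ?P" by (intro exI[of _ A]) (auto simp: subset_iff)
    qed
    moreover have "W = \<Phi> -` ?P \<inter> F" using K(2,4) rep by (auto simp: subset_iff)
    ultimately show "openin (pullback_topology F \<Phi> euclidean) W"
      by (auto simp: openin_pullback_topology)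
  qed simp
next
  fix V assume "openin (pullback_topology F \<Phi> euclidean) V"
  then obtain U where "open U" "V = {f \<in> F. \<Phi> f \<in> U}" by (auto simp: openin_pullback_topology)
  then show "openin (compact_open_topology S F) V"
    using \<Phi> by (simp add: continuous_map_def topspace_compact_open)
qed

lemma homeomorphic_map_pullback:
  assumes h: "bij_betw h A B" and eq: "\<And>f. f \<in> A \<Longrightarrow> \<Psi> (h f) = \<Phi> f"
  shows "homeomorphic_map (pullback_topology A \<Phi> euclidean) (pullback_topology B \<Psi> euclidean) h"
  unfolding homeomorphic_map_maps
proof (rule exI[of _ "inv_into A h"])
  have hB: "f \<in> A \<Longrightarrow> h f \<in> B" for f using h by (auto dest: bij_betwE)
  have g: "y \<in> B \<Longrightarrow> inv_into A h y \<in> A" "y \<in> B \<Longrightarrow> h (inv_into A h y) = y" for y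
    using h by (auto simp: bij_betw_def inv_into_into f_inv_into_f)
  have g': "f \<in> A \<Longrightarrow> inv_into A h (h f) = f" for f using h by (simp add: bij_betw_def)
  have g\<Phi>: "y \<in> B \<Longrightarrow> \<Phi> (inv_into A h y) = \<Psi> y" for y using eq[OF g(1)] g(2) by simp
  have "{f \<in> A. h f \<in> \<Psi> -` U \<inter> B} = \<Phi> -` U \<inter> A" "{y \<in> B. inv_into A h y \<in> \<Phi> -` U \<inter> A} = \<Psi> -` U \<inter> B" for U
    using hB eq g g\<Phi> by auto
  then show "homeomorphic_maps (pullback_topology A \<Phi> euclidean) (pullback_topology B \<Psi> euclidean) h (inv_into A h)"
    using hB g g'
    by (auto simp: homeomorphic_maps_def continuous_map_def topspace_pullback_topology openin_pullback_topology)
qed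

lemma subtopology_pullback:
  assumes "B \<subseteq> A"
  shows "subtopology (pullback_topology A \<Phi> T) B = pullback_topology B \<Phi> T"
  unfolding topology_eq openin_subtopology openin_pullback_topology using assms by blast

lemma connected_component_of_clopen:
  assumes "openin X S" "closedin X S" "x \<in> S"
  shows "connected_component_of_set X x \<subseteq> S"
proof -
  have "connectedin X (connected_component_of_set X x)" by (rule connectedin_connected_component_of)
  from connectedin_clopen_cases[OF this assms(2,1)] show ?thesis
  proof
    assume d: "disjnt (connected_component_of_set X x) S"
    have "x \<in> topspace X" using assms(1,3) openin_subset by blast
    then have "x \<in> connected_component_of_set X x" by (simp add: connected_component_of_refl)
    then show ?thesis using d assms(3) by (auto simp: disjnt_def)
  qed
qed

lemma continuous_on_matrix_vector:
  fixes A :: "'a::topological_space \<Rightarrow> real^'n^'m"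
  shows "\<lbrakk>continuous_on S A; continuous_on S v\<rbrakk> \<Longrightarrow> continuous_on S (\<lambda>x. A x *v v x)"
  unfolding matrix_vector_mult_def by (intro continuous_intros)

lemma continuous_on_det3:
  fixes A :: "'a::topological_space \<Rightarrow> real^3^3"
  shows "continuous_on S A \<Longrightarrow> continuous_on S (\<lambda>x. det (A x))"
  unfolding det_3 by (intro continuous_intros)

definition matrix_of_columns :: "real^3 \<Rightarrow> real^3 \<Rightarrow> real^3 \<Rightarrow> real^3^3" where
  "matrix_of_columns a b c = (\<chi> i j. if j = 1 then a $ i else if j = 2 then b $ i else c $ i)"

lemma matrix_of_columns:
  "matrix_of_columns (A *v axis 1 1) (A *v axis 2 1) (A *v axis 3 1) = A"
  by (simp add: matrix_of_columns_def vec_eq_iff forall_3 matrix_vector_mult_basis column_def)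

lemma continuous_on_matrix_of_columns:
  "\<lbrakk>continuous_on S a; continuous_on S b; continuous_on S c\<rbrakk> \<Longrightarrow>
    continuous_on S (\<lambda>x. matrix_of_columns (a x) (b x) (c x))"
proof -
  \<comment> \<open>Coefficients 0 and 1 in place of the case distinction exhibit each entry as a
    continuous expression.\<close>
  have eq: "matrix_of_columns a b c = (\<chi> i j. (if j = 1 then 1 else 0) * a $ i
    + ((if j = 2 then 1 else 0) * b $ i + (if j = 3 then 1 else 0) * c $ i))" for a b c
    by (simp add: matrix_of_columns_def vec_eq_iff forall_3)
  show "\<lbrakk>continuous_on S a; continuous_on S b; continuous_on S c\<rbrakk> \<Longrightarrow> ?thesis"
    unfolding eq by (intro continuous_intros)
qed

section \<open>Recovering the parameters from finitely many values\<close>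

context sign
begin

definition flat_params :: "(real^3 \<Rightarrow> real^3) \<Rightarrow> (real^3^3) \<times> (real^3)" where
  "flat_params f = (matrix_of_columns (f (axis 1 1) - f 0) (f (axis 2 1) - f 0) (f (axis 3 1) - f 0), f 0)"

lemma flat_params_affine_action: "flat_params (affine_action (A, s)) = (A, s)"
  by (simp add: flat_params_def affine_action_def matrix_of_columns)

text \<open>Three linearly independent points \<open>p\<^sub>0, p\<^sub>1, p\<^sub>2\<close> of the surface. The values of an isometry at
  \<open>(p\<^sub>i, 0)\<close> determine \<open>A\<close>. They also determine \<open>s\<close>, through its tangential parts at \<open>A p\<^sub>0\<close> and \<open>A p\<^sub>1\<close>.\<close>

definition \<kappa> :: real where "\<kappa> = sqrt (1 - \<epsilon>)"

definition p0 :: "real^3" where "p0 = axis 3 1"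
definition p1 :: "real^3" where "p1 = axis 1 1 + \<kappa> *\<^sub>R axis 3 1"
definition p2 :: "real^3" where "p2 = axis 2 1 + \<kappa> *\<^sub>R axis 3 1"

text \<open>\<open>q0\<close> is the third column of \<open>A\<close>, and subtracting \<kappa>
  \<open>q0\<close> from \<open>q1\<close> and \<open>q2\<close> leaves the other two. With ci =
  form qi s one has wi = s - \<epsilon> ci qi, so \<epsilon> c0 q0 must be added to
  \<open>w0\<close>. The coefficient is found from form w1 q0 + \<kappa> form w0 q1 = (1 -
  \<kappa>^2) c0 = \<epsilon> c0.\<close>

definition bundle_params :: "((real^3) \<times> (real^3) \<Rightarrow> (real^3) \<times> (real^3)) \<Rightarrow> (real^3^3) \<times> (real^3)" where
  "bundle_params f = (
    let q0 = fst (f (p0, 0)); q1 = fst (f (p1, 0)); q2 = fst (f (p2, 0));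
      w0 = snd (f (p0, 0)); w1 = snd (f (p1, 0))
    in (matrix_of_columns (q1 - \<kappa> *\<^sub>R q0) (q2 - \<kappa> *\<^sub>R q0) q0,
        w0 + (form \<epsilon> w1 q0 + \<kappa> * form \<epsilon> w0 q1) *\<^sub>R q0))"

text \<open>\<kappa> solves 1 + \<epsilon> \<kappa>^2 = \<epsilon>, which puts \<open>p1\<close> and
  \<open>p2\<close> on the surface: it is 0 on the sphere and the square root of 2 on the
  hyperboloid.\<close>

lemma \<kappa>: "\<kappa>\<^sup>2 = 1 - \<epsilon>" "\<epsilon> * \<kappa>\<^sup>2 = \<epsilon> - 1" "\<epsilon> < 0 \<Longrightarrow> \<kappa> > 0"
proof -
  show "\<kappa>\<^sup>2 = 1 - \<epsilon>" using sign unfolding \<kappa>_def by auto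
  then show "\<epsilon> * \<kappa>\<^sup>2 = \<epsilon> - 1" by (simp add: right_diff_distrib)
qed (simp add: \<kappa>_def)

lemma p_surface: "p0 \<in> surface \<epsilon>" "p1 \<in> surface \<epsilon>" "p2 \<in> surface \<epsilon>"
  using \<kappa> by (simp_all add: surface_def form_def p0_def p1_def p2_def axis_def power2_eq_square[symmetric] algebra_simps)

lemma bundle_params_action:
  assumes A: "preserves_form A" and f: "\<And>z. z \<in> M \<Longrightarrow> f z = bundle_action (A, s) z"
  shows "bundle_params f = (A, s)"
proof -
  have M: "p \<in> surface \<epsilon> \<Longrightarrow> (p, 0) \<in> M" for p by (simp add: M_iff form_linear)
  have fp: "f (p, 0) = (A *v p, s - (\<epsilon> * form \<epsilon> (A *v p) s) *\<^sub>R (A *v p))" if "p \<in> surface \<epsilon>" for p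
    using f[OF M[OF that]] by (simp add: bundle_action_def)
  have cols: "A *v p1 - \<kappa> *\<^sub>R (A *v p0) = A *v axis 1 1" "A *v p2 - \<kappa> *\<^sub>R (A *v p0) = A *v axis 2 1"
    by (simp_all add: p0_def p1_def p2_def matrix_vector_right_distrib matrix_vector_mult_scaleR)
  define q0 where "q0 = A *v p0"
  define q1 where "q1 = A *v p1"
  define c0 where "c0 = form \<epsilon> q0 s"
  define c1 where "c1 = form \<epsilon> q1 s"
  have q: "form \<epsilon> q0 q0 = \<epsilon>" "form \<epsilon> q1 q0 = \<epsilon> * \<kappa>" "form \<epsilon> q0 q1 = \<epsilon> * \<kappa>"
    using surface_form[OF p_surface(1)]
    by (simp_all add: q0_def q1_def preserves_formD[OF A]) (simp_all add: p0_def p1_def form_def axis_def)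
  have "form \<epsilon> (s - (\<epsilon> * c1) *\<^sub>R q1) q0 + \<kappa> * form \<epsilon> (s - (\<epsilon> * c0) *\<^sub>R q0) q1 = \<epsilon> * c0"
  proof -
    have "form \<epsilon> (s - (\<epsilon> * c1) *\<^sub>R q1) q0 + \<kappa> * form \<epsilon> (s - (\<epsilon> * c0) *\<^sub>R q0) q1
        = c0 - \<kappa>\<^sup>2 * c0"
      using q by (simp add: form_linear c0_def c1_def form_commute[of \<epsilon> s] algebra_simps power2_eq_square)
    also have "\<dots> = \<epsilon> * c0" by (simp add: \<kappa> algebra_simps)
    finally show ?thesis .
  qed
  then show ?thesis
    unfolding bundle_params_def fp[OF p_surface(1)] fp[OF p_surface(2)] fp[OF p_surface(3)] Let_def fst_conv snd_conv cols
    by (simp add: q0_def[symmetric] q1_def[symmetric] c0_def[symmetric] c1_def[symmetric])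
      (simp add: q0_def p0_def matrix_of_columns)
qed

lemma continuous_map_flat_params: "continuous_map (compact_open_topology UNIV F) euclidean flat_params"
proof -
  let ?G = "\<lambda>y :: (real^3) \<times> (real^3) \<times> (real^3) \<times> (real^3).
    (matrix_of_columns (fst (snd y) - fst y) (fst (snd (snd y)) - fst y) (snd (snd (snd y)) - fst y), fst y)"
  have "continuous_map (compact_open_topology UNIV F) (prod_topology euclidean (prod_topology euclidean (prod_topology euclidean euclidean)))
      (\<lambda>f. (f 0, f (axis 1 1 :: real^3), f (axis 2 1), f (axis 3 1)))"
    by (intro continuous_map_pairedI continuous_map_evaluation UNIV_I)
  then have 1: "continuous_map (compact_open_topology UNIV F) euclidean (\<lambda>f. (f 0, f (axis 1 1 :: real^3), f (axis 2 1), f (axis 3 1)))"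
    by simp
  have 2: "continuous_map euclidean euclidean ?G"
    by (simp, intro continuous_on_matrix_of_columns continuous_intros)
  from continuous_map_compose[OF 1 2]
  show ?thesis by (simp add: o_def flat_params_def[abs_def])
qed

lemma continuous_map_bundle_params: "continuous_map (compact_open_topology M F) euclidean bundle_params"
proof -
  let ?G = "\<lambda>y :: ((real^3) \<times> (real^3)) \<times> ((real^3) \<times> (real^3)) \<times> ((real^3) \<times> (real^3)).
    (matrix_of_columns (fst (fst (snd y)) - \<kappa> *\<^sub>R fst (fst y)) (fst (snd (snd y)) - \<kappa> *\<^sub>R fst (fst y)) (fst (fst y)),
     snd (fst y) + (form \<epsilon> (snd (fst (snd y))) (fst (fst y)) + \<kappa> * form \<epsilon> (snd (fst y)) (fst (fst (snd y)))) *\<^sub>R fst (fst y))"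
  have M: "p \<in> surface \<epsilon> \<Longrightarrow> (p, 0) \<in> M" for p by (simp add: M_iff form_linear)
  have "continuous_map (compact_open_topology M F) (prod_topology euclidean (prod_topology euclidean euclidean))
      (\<lambda>f. (f (p0, 0), f (p1, 0), f (p2, 0)))"
    by (intro continuous_map_pairedI continuous_map_evaluation M p_surface)
  then have 1: "continuous_map (compact_open_topology M F) euclidean (\<lambda>f. (f (p0, 0), f (p1, 0), f (p2, 0)))"
    by simp
  have 2: "continuous_map euclidean euclidean ?G"
    by (simp, intro continuous_on_matrix_of_columns continuous_intros)
  from continuous_map_compose[OF 1 2]
  show ?thesis by (simp add: o_def bundle_params_def[abs_def] Let_def case_prod_unfold)
qed

section \<open>Topology of the isometry groups and the matching of their components\<close>

abbreviation G_bundle :: "((real^3) \<times> (real^3) \<Rightarrow> (real^3) \<times> (real^3)) set" where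
  "G_bundle \<equiv> carrier (isometry_group (neutral_tangent_bundle \<epsilon>))"

abbreviation G_flat :: "(real^3 \<Rightarrow> real^3) set" where
  "G_flat \<equiv> carrier (isometry_group (flat_space \<epsilon>))"

lemma G_bundle_params:
  assumes "f \<in> G_bundle"
  shows "preserves_form (fst (bundle_params f))" "z \<in> M \<Longrightarrow> f z = bundle_action (bundle_params f) z"
    "\<epsilon> < 0 \<Longrightarrow> fst (bundle_params f) $ 3 $ 3 > 0"
proof -
  obtain A s where A: "preserves_form A" "\<And>p. p \<in> surface \<epsilon> \<Longrightarrow> A *v p \<in> surface \<epsilon>"
    and f: "\<And>z. z \<in> M \<Longrightarrow> f z = bundle_action (A, s) z"
    using bundle_isometry_classification[OF assms] by metis
  note eq = bundle_params_action[OF A(1) f]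
  show "preserves_form (fst (bundle_params f))" using A(1) by (simp add: eq)
  show "z \<in> M \<Longrightarrow> f z = bundle_action (bundle_params f) z" using f by (simp add: eq)
  show "fst (bundle_params f) $ 3 $ 3 > 0" if "\<epsilon> < 0"
    using A(2)[OF p_surface(1)] that by (simp add: eq surface_def p0_def matrix_vector_mult_basis column_def)
qed

lemma G_flat_params:
  assumes "f \<in> G_flat"
  shows "preserves_form (fst (flat_params f))" "f = affine_action (flat_params f)"
  using flat_isometry_classification[OF assms] by (metis flat_params_affine_action fst_conv)+

lemma compact_open_bundle:
  assumes "F \<subseteq> G_bundle"
  shows "compact_open_topology M F = pullback_topology F bundle_params euclidean"
proof (rule compact_open_eq_pullback[OF _ _ continuous_map_bundle_params])
  show "f x = bundle_action (bundle_params f) x" if "f \<in> F" "x \<in> M" for f x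
    using G_bundle_params(2) that assms by blast
  show "continuous_on UNIV (\<lambda>(p, x). bundle_action p x)"
    unfolding bundle_action_def case_prod_unfold
    by (intro continuous_intros continuous_on_matrix_vector continuous_on_det3)
qed

lemma compact_open_flat:
  assumes "F \<subseteq> G_flat"
  shows "compact_open_topology UNIV F = pullback_topology F flat_params euclidean"
proof (rule compact_open_eq_pullback[OF _ _ continuous_map_flat_params])
  show "f x = affine_action (flat_params f) x" if "f \<in> F" for f x
    using G_flat_params(2) that assms by (metis subsetD)
  show "continuous_on UNIV (\<lambda>(p, x). affine_action p x)"
    unfolding affine_action_def case_prod_unfold by (intro continuous_intros continuous_on_matrix_vector)
qed

text \<open>Preserving the form forces determinant 1 or -1 and, in the Lorentzian case, a nonzero
  corner entry. So the conditions and their negation are both given by strict inequalities.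
  \<open>\<Phi>\<close> is arbitrary in order to serve both groups.\<close>

lemma rotation_clopen:
  fixes \<Phi> :: "'f \<Rightarrow> (real^3^3) \<times> (real^3)"
  assumes "\<And>f. f \<in> F \<Longrightarrow> preserves_form (fst (\<Phi> f))"
  shows "openin (pullback_topology F \<Phi> euclidean) {f \<in> F. rotation (fst (\<Phi> f))}"
    and "closedin (pullback_topology F \<Phi> euclidean) {f \<in> F. rotation (fst (\<Phi> f))}"
proof -
  let ?V = "{P :: (real^3^3) \<times> (real^3). 0 < det (fst P)} \<inter> (if \<epsilon> < 0 then {P. 0 < fst P $ 3 $ 3} else UNIV)"
  define W where "W = {P :: (real^3^3) \<times> (real^3). det (fst P) < 0} \<union> (if \<epsilon> < 0 then {P. fst P $ 3 $ 3 < 0} else {})"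
  have d: "continuous_on UNIV (\<lambda>P :: (real^3^3) \<times> (real^3). det (fst P))"
    by (intro continuous_on_det3 continuous_intros)
  have V: "open ?V" and W: "open W"
    using d by (auto simp: W_def intro!: open_Int open_Un open_Collect_less continuous_intros)
  have det: "det A = 1 \<or> det A = -1" if "preserves_form A" for A
    using preserves_form_det[OF that] by (simp add: power2_eq_1_iff)
  have A33: "A $ 3 $ 3 \<noteq> 0" if "preserves_form A" "\<epsilon> < 0" for A
  proof
    \<comment> \<open>The image of the timelike third axis would have no third coordinate and so be
      spacelike or zero.\<close>
    assume "A $ 3 $ 3 = 0"
    then have "(A *v axis 3 1) $ 3 = 0" by (simp add: matrix_vector_mult_basis column_def)
    then have "form \<epsilon> (A *v axis 3 1) (A *v axis 3 1) \<ge> 0" by (simp add: form_def)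
    then show False using preserves_formD[OF that(1), of "axis 3 1" "axis 3 1"] that(2) by (simp add: form_def axis_def)
  qed
  have "{f \<in> F. rotation (fst (\<Phi> f))} = \<Phi> -` ?V \<inter> F"
    using assms det by (fastforce simp: rotation_def)
  then show "openin (pullback_topology F \<Phi> euclidean) {f \<in> F. rotation (fst (\<Phi> f))}"
    using V by (auto simp: openin_pullback_topology)
  have "F - {f \<in> F. rotation (fst (\<Phi> f))} = \<Phi> -` W \<inter> F"
  proof -
    have "\<not> rotation (fst (\<Phi> f)) \<longleftrightarrow> \<Phi> f \<in> W" if "f \<in> F" for f
      using det[OF assms[OF that]] A33[OF assms[OF that]] assms[OF that]
      by (auto simp: rotation_def W_def)
    then show ?thesis by blast
  qed
  then show "closedin (pullback_topology F \<Phi> euclidean) {f \<in> F. rotation (fst (\<Phi> f))}"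
    using W by (auto simp: closedin_def topspace_pullback_topology openin_pullback_topology)
qed

definition affine_counterpart :: "((real^3) \<times> (real^3) \<Rightarrow> (real^3) \<times> (real^3)) \<Rightarrow> real^3 \<Rightarrow> real^3" where
  "affine_counterpart f = affine_action (bundle_params f)"

definition R_bundle where "R_bundle = {f \<in> G_bundle. rotation (fst (bundle_params f))}"
definition R_flat where "R_flat = {f \<in> G_flat. rotation (fst (flat_params f))}"

lemma affine_counterpart_params: "flat_params (affine_counterpart f) = bundle_params f"
  by (cases "bundle_params f") (simp add: affine_counterpart_def flat_params_affine_action)

text \<open>The inverse lets the parameters act on the bundle again; \<open>restrict\<close> is
  there because elements of \<open>BijGroup\<close> are extensional.\<close>

lemma affine_counterpart_bij: "bij_betw affine_counterpart R_bundle R_flat"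
proof (rule bij_betw_byWitness[where f' = "\<lambda>f. restrict (bundle_action (flat_params f)) M"])
  have params: "bundle_params (restrict (bundle_action (A, s)) M) = (A, s)" if "rotation A" for A s
    by (rule bundle_params_action) (use that in \<open>auto simp: rotation_def\<close>)
  show "\<forall>f\<in>R_bundle. restrict (bundle_action (flat_params (affine_counterpart f))) M = f"
  proof
    fix f assume "f \<in> R_bundle"
    then have f: "f \<in> G_bundle" by (simp add: R_bundle_def)
    show "restrict (bundle_action (flat_params (affine_counterpart f))) M = f"
      unfolding affine_counterpart_params
      using G_bundle_params(2)[OF f] isometry_groupD(1)[OF f] by (auto simp: fun_eq_iff extensional_def)
  qed
  show "\<forall>f\<in>R_flat. affine_counterpart (restrict (bundle_action (flat_params f)) M) = f"
  proof
    fix f assume f: "f \<in> R_flat"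
    obtain A s where As: "flat_params f = (A, s)" by (cases "flat_params f")
    then show "affine_counterpart (restrict (bundle_action (flat_params f)) M) = f"
      using f G_flat_params(2)[of f] params[of A s] by (simp add: R_flat_def affine_counterpart_def)
  qed
  show "affine_counterpart ` R_bundle \<subseteq> R_flat"
  proof
    fix g assume "g \<in> affine_counterpart ` R_bundle"
    then obtain f where f: "f \<in> R_bundle" "g = affine_counterpart f" by blast
    obtain A s where As: "bundle_params f = (A, s)" by (cases "bundle_params f")
    then show "g \<in> R_flat"
      using f affine_action_isometry[of A s] by (simp add: R_bundle_def R_flat_def affine_counterpart_params) (simp add: affine_counterpart_def)
  qed
  show "(\<lambda>f. restrict (bundle_action (flat_params f)) M) ` R_flat \<subseteq> R_bundle"
  proof
    fix g assume "g \<in> (\<lambda>f. restrict (bundle_action (flat_params f)) M) ` R_flat"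
    then obtain f where f: "f \<in> R_flat" "g = restrict (bundle_action (flat_params f)) M" by blast
    obtain A s where As: "flat_params f = (A, s)" by (cases "flat_params f")
    then show "g \<in> R_bundle"
      using f params[of A s] bundle_action_isometry[of A s] by (simp add: R_bundle_def R_flat_def)
  qed
qed

lemma affine_counterpart_compose:
  assumes "f \<in> R_bundle" "g \<in> R_bundle"
  shows "affine_counterpart (compose M f g) = affine_counterpart f \<circ> affine_counterpart g"
proof -
  obtain A s where As: "bundle_params f = (A, s)" by (cases "bundle_params f")
  obtain B t where Bt: "bundle_params g = (B, t)" by (cases "bundle_params g")
  have f: "f \<in> G_bundle" "rotation A" and g: "g \<in> G_bundle" "rotation B"
    using assms As Bt by (auto simp: R_bundle_def)
  have "bundle_params (compose M f g) = (A ** B, A *v t + s)"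
  proof (rule bundle_params_action)
    show "preserves_form (A ** B)" using f(2) g(2) by (simp add: rotation_def preserves_form_mult)
    fix z assume z: "z \<in> M"
    then have "g z \<in> M" using isometry_groupD(3)[OF g(1)] by auto
    then show "compose M f g z = bundle_action (A ** B, A *v t + s) z"
      using z G_bundle_params(2)[OF f(1)] G_bundle_params(2)[OF g(1)] As Bt bundle_action_compose[OF f(2), of B s t z] g(2)
      by (simp add: compose_def rotation_def)
  qed
  then show ?thesis by (simp add: affine_counterpart_def As Bt affine_action_compose fun_eq_iff)
qed

lemma one_isometry_group: "\<one>\<^bsub>isometry_group N\<^esub> = (\<lambda>x\<in>points N. x)"
  by (simp add: isometry_group_def BijGroup_def)

lemma id_R_bundle: "(\<lambda>x\<in>M. x) \<in> R_bundle" and affine_counterpart_id: "affine_counterpart (\<lambda>x\<in>M. x) = (\<lambda>x. x)"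
proof -
  have rot: "rotation (mat 1)" by (simp add: rotation_def preserves_form_def) (simp add: mat_def)
  have eq: "(\<lambda>x\<in>M. x) = restrict (bundle_action (mat 1, 0)) M"
    by (auto simp: fun_eq_iff bundle_action_def form_linear restrict_def)
  have p: "bundle_params (\<lambda>x\<in>M. x) = (mat 1, 0)"
    by (rule bundle_params_action) (use rot in \<open>auto simp: rotation_def bundle_action_def form_linear\<close>)
  show "(\<lambda>x\<in>M. x) \<in> R_bundle"
    using bundle_action_isometry[OF rot, of 0] rot by (simp add: R_bundle_def p) (simp add: eq)
  show "affine_counterpart (\<lambda>x\<in>M. x) = (\<lambda>x. x)"
    by (simp add: affine_counterpart_def p affine_action_def fun_eq_iff)
qed

theorem Isom0_isomorphic:
  "isomorphic_topological_groups (Isom0 (neutral_tangent_bundle \<epsilon>)) (Isom0_topology (neutral_tangent_bundle \<epsilon>))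
     (Isom0 (flat_space \<epsilon>)) (Isom0_topology (flat_space \<epsilon>))"
proof -
  let ?X = "pullback_topology G_bundle bundle_params euclidean"
  let ?Y = "pullback_topology G_flat flat_params euclidean"
  let ?C = "carrier (Isom0 (neutral_tangent_bundle \<epsilon>))"
  let ?D = "carrier (Isom0 (flat_space \<epsilon>))"
  let ?i = "\<lambda>x\<in>M. x"
  have X: "compact_open_topology M G_bundle = ?X" by (rule compact_open_bundle) simp
  have Y: "compact_open_topology UNIV G_flat = ?Y" by (rule compact_open_flat) simp
  have restrict_UNIV: "(\<lambda>x\<in>UNIV. x) = (\<lambda>x :: real^3. x)" by (simp add: restrict_def)
  have C: "?C = connected_component_of_set ?X ?i"
    by (simp add: Isom0_def one_isometry_group X)
  have D: "?D = connected_component_of_set ?Y (affine_counterpart ?i)"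
    by (simp add: Isom0_def one_isometry_group Y affine_counterpart_id restrict_UNIV)
  have id: "?i \<in> R_bundle" "affine_counterpart ?i \<in> R_flat"
    using id_R_bundle affine_counterpart_bij by (auto dest: bij_betwE)
  have CR: "?C \<subseteq> R_bundle"
    unfolding C R_bundle_def
    by (intro connected_component_of_clopen rotation_clopen G_bundle_params id(1)[unfolded R_bundle_def])
  have DR: "?D \<subseteq> R_flat"
    unfolding D R_flat_def
    by (intro connected_component_of_clopen rotation_clopen G_flat_params id(2)[unfolded R_flat_def])
  have RG: "R_bundle \<subseteq> G_bundle" "R_flat \<subseteq> G_flat" by (auto simp: R_bundle_def R_flat_def)
  \<comment> \<open>A component contained in a subset is also its component in the subspace
    topology, and on \<open>R_bundle\<close> matching parameters is a homeomorphism onto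
    \<open>R_flat\<close>.\<close>
  have C': "?C = connected_component_of_set (pullback_topology R_bundle bundle_params euclidean) ?i"
    using CR connected_component_of_subtopology_eq[of ?X R_bundle ?i]
    unfolding C subtopology_pullback[OF RG(1)] by simp
  have D': "?D = connected_component_of_set (pullback_topology R_flat flat_params euclidean) (affine_counterpart ?i)"
    using DR connected_component_of_subtopology_eq[of ?Y R_flat "affine_counterpart ?i"]
    unfolding D subtopology_pullback[OF RG(2)] by simp
  have "homeomorphic_map (pullback_topology R_bundle bundle_params euclidean)
      (pullback_topology R_flat flat_params euclidean) affine_counterpart"
    by (rule homeomorphic_map_pullback[OF affine_counterpart_bij]) (rule affine_counterpart_params)
  \<comment> \<open>A homeomorphism carries the component of a point to that of its image, here from
    identity to identity.\<close>
  from homeomorphic_map_connected_component_of[OF this, of ?i] have DC: "?D = affine_counterpart ` ?C"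
    unfolding C' D' using id(1) by (simp add: topspace_pullback_topology)
  have bij: "bij_betw affine_counterpart ?C ?D"
    unfolding DC using affine_counterpart_bij CR by (meson bij_betw_imageI bij_betw_imp_inj_on inj_on_subset)
  have "homeomorphic_map (Isom0_topology (neutral_tangent_bundle \<epsilon>)) (Isom0_topology (flat_space \<epsilon>)) affine_counterpart"
    using CR DR RG homeomorphic_map_pullback[OF bij, of flat_params bundle_params] affine_counterpart_params
    by (simp add: Isom0_topology_def compact_open_bundle compact_open_flat)
  moreover have "affine_counterpart \<in> iso (Isom0 (neutral_tangent_bundle \<epsilon>)) (Isom0 (flat_space \<epsilon>))"
  proof -
    have mult: "f \<otimes>\<^bsub>Isom0 N\<^esub> g = compose (points N) f g"
      if "f \<in> carrier (isometry_group N)" "g \<in> carrier (isometry_group N)" for f g :: "'x::euclidean_space \<Rightarrow> 'x" and N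
      using that by (simp add: Isom0_def isometry_group_def BijGroup_def)
    have "affine_counterpart (f \<otimes>\<^bsub>Isom0 (neutral_tangent_bundle \<epsilon>)\<^esub> g) = affine_counterpart f \<otimes>\<^bsub>Isom0 (flat_space \<epsilon>)\<^esub> affine_counterpart g"
      if f: "f \<in> ?C" "g \<in> ?C" for f g
    proof -
      have R: "f \<in> R_bundle" "g \<in> R_bundle" using that CR by auto
      then have "affine_counterpart f \<in> R_flat" "affine_counterpart g \<in> R_flat" using affine_counterpart_bij by (auto dest: bij_betwE)
      then show ?thesis
        using R RG mult[of f "neutral_tangent_bundle \<epsilon>" g] mult[of "affine_counterpart f" "flat_space \<epsilon>" "affine_counterpart g"]
        by (simp add: affine_counterpart_compose[OF R] subset_iff) (simp add: compose_def restrict_def o_def)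
    qed
    then show ?thesis using bij by (auto simp: iso_def hom_def dest: bij_betwE)
  qed
  ultimately show ?thesis unfolding isomorphic_topological_groups_def by blast
qed

end

theorem theorem1:
  shows "isomorphic_topological_groups (Isom0 TS2) (Isom0_topology TS2) (Isom0 E3) (Isom0_topology E3) \<and>
    isomorphic_topological_groups (Isom0 TH2) (Isom0_topology TH2) (Isom0 E31) (Isom0_topology E31)"
proof -
  interpret S: sign 1 by unfold_locales simp
  interpret H: sign "-1" by unfold_locales simp
  show ?thesis
    unfolding TS2_def TH2_def E3_def E31_def using S.Isom0_isomorphic H.Isom0_isomorphic by simp
qed

end
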